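(* Let $A$ be an expansive dilation on $\mathbb{R}^n$ and let $p(\cdot)\in C^{\log}$ satisfy $0<p_-\le p_+\le 1$. Then there exists a positive constant $C$ (independent of $f$ and $x$) such that, for any $f\in\mathcal{H}^{p(\cdot)}_A(\mathbb{R}^n)$, there exists a continuous function $F$ on $\mathbb{R}^n$ with $\widehat f=F$ in $\mathcal{S}'(\mathbb{R}^n)$ and, for any $x\in\mathbb{R}^n$, $$|F(x)|\le C\,\|f\|_{\mathcal{H}^{p(\cdot)}_A}\max\left\{[\rho_{A^*}(x)]^{1/p_--1},\,[\rho_{A^*}(x)]^{1/p_+-1}\right\},$$ where $A^*$ denotes the transposed matrix of $A$ and $\widehat f$ is the Fourier transform of $f$.
   Context: Dilations. A real $n\times n$ matrix $A$ is an expansive dilation if all its eigenvalues $\lambda$ satisfy $|\lambda|>1$. Put $b:=|\det A|$. Let $\lambda_-$ be a fixed number with $1<\lambda_-<\min\{|\lambda|:\lambda\text{ an eigenvalue of }A\}$ (equality with the minimum is allowed if $A$ is diagonalizable over $\mathbb{C}$). There exist $r\in(1,\infty)$ and an ellipsoid $\Delta=\{x\in\mathbb{R}^n:|Px|<1\}$, with $P$ a non-degenerate $n\times n$ matrix, such that $|\Delta|=1$ and $\Delta\subset r\Delta\subset A\Delta$; fix these and set $B_k:=A^k\Delta$ for $k\in\mathbb{Z}$, so $|B_k|=b^k$. The step quasi-norm is $\rho(x)=\rho_A(x):=b^k$ if $x\in B_{k+1}\setminus B_k$ ($k\in\mathbb{Z}$), and $\rho_A(0):=0$. $\rho_{A^*}$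 is the step quasi-norm defined in the same way from the dilation $A^*$ (the transpose of $A$, with $|\det A^*|=b$). Variable exponents. A variable exponent is a measurable function $p(\cdot):\mathbb{R}^n\to(0,\infty)$; $p_-:=\operatorname{ess\,inf}p$, $p_+:=\operatorname{ess\,sup}p$, $\underline{p}:=\min\{p_-,1\}$; $\mathcal{P}$ is the set of variable exponents with $0<p_-\le p_+<\infty$. For $p(\cdot)\in\mathcal P$, $\|f\|_{L^{p(\cdot)}}:=\inf\{\lambda\in(0,\infty):\int_{\mathbb{R}^n}(|f(x)|/\lambda)^{p(x)}dx\le1\}$, and $L^{p(\cdot)}$ is the set of measurable $f$ with $\int_{\mathbb{R}^n}|f(x)|^{p(x)}dx<\infty$. $p(\cdot)\in C^{\log}$ means that $p(\cdot)\in\mathcal{P}$ and there exist positive constants $C_{\log}(p),C_\infty$ and $p_\infty\in\mathbb{R}$ such that for all $x,y\in\mathbb{R}^n$: $|p(x)-p(y)|\le C_{\log}(p)/\log(e+1/\rho(x-y))$ and $|p(x)-p_\infty|\le C_\infty/\log(e+\rho(x))$. Hardy space. $\mathcal{S}$ is the Schwartz space and $\mathcal{S}'$ the space of tempered distributions. For $N\in\mathbb{N}$, $\mathcal{S}_N$ is the set of $\varphi\in\mathcal{S}$ with $\sup_{x}[\rho(x)]^\ell|\partial^\alpha\varphi(x)|\le1$ for all multi-indices $|\alpha|\le N$ and integers $0\le\ell\le N$. For $\varphi\in\mathcal S$, $\varphi_k(x):=b^{-k}\varphi(A^{-k}x)$. For $f\in\mathcal{S}'$, $M_N(f)(x):=\sup_{\varphi\in\mathcal{S}_N}\sup_{k\in\mathbb{Z},\,y\in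 x+B_k}|f*\varphi_k(y)|$. Fix an integer $N\ge\lfloor(1/\underline{p}-1)\ln b/\ln\lambda_-\rfloor+2$. Then $\mathcal{H}^{p(\cdot)}_A:=\{f\in\mathcal{S}':M_N(f)\in L^{p(\cdot)}\}$ with $\|f\|_{\mathcal{H}^{p(\cdot)}_A}:=\|M_N(f)\|_{L^{p(\cdot)}}$. The Fourier transform is $\widehat f(x)=\int_{\mathbb{R}^n}f(\xi)e^{-2\pi i\langle x,\xi\rangle}d\xi$ for integrable $f$, extended to $\mathcal{S}'$ by duality. *)

theory Defs
  imports "HOL-Analysis.Analysis" "HOL-Probability.Essential_Supremum"
begin

section \<open>Expansive dilations and step quasi-norms\<close>

definition cmatrix :: "real^'n^'n \<Rightarrow> complex^'n^'n" where
  "cmatrix A = map_matrix complex_of_real A"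

definition is_eigenvalue :: "real^'n^'n \<Rightarrow> complex \<Rightarrow> bool" where
  "is_eigenvalue A \<mu> \<longleftrightarrow> (\<exists>v. v \<noteq> 0 \<and> cmatrix A *v v = \<mu> *s v)"

definition expansive_dilation :: "real^'n^'n \<Rightarrow> bool" where
  "expansive_dilation A \<longleftrightarrow> (\<forall>\<mu>. is_eigenvalue A \<mu> \<longrightarrow> cmod \<mu> > 1)"

definition diagonalizable_over_C :: "real^'n^'n \<Rightarrow> bool" where
  "diagonalizable_over_C A \<longleftrightarrow>
     (\<exists>(P :: complex^'n^'n) (D :: complex^'n^'n). invertible P \<and> (\<forall>i j. i \<noteq> j \<longrightarrow> D $ i $ j = 0) \<and>
            cmatrix A = P ** D ** matrix_inv P)"

definition lower_exponent :: "real^'n^'n \<Rightarrow> real \<Rightarrow> bool" where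
  "lower_exponent A lam \<longleftrightarrow> 1 < lam \<and>
     ((\<forall>\<mu>. is_eigenvalue A \<mu> \<longrightarrow> lam < cmod \<mu>) \<or>
      diagonalizable_over_C A \<and> (\<forall>\<mu>. is_eigenvalue A \<mu> \<longrightarrow> lam \<le> cmod \<mu>))"

definition ellipsoid :: "real^'n^'n \<Rightarrow> (real^'n) set" where
  "ellipsoid P = {x. norm (P *v x) < 1}"

definition dilation_ellipsoid :: "real^'n^'n \<Rightarrow> real \<Rightarrow> real^'n^'n \<Rightarrow> bool" where
  "dilation_ellipsoid A r P \<longleftrightarrow> 1 < r \<and> invertible P \<and>
     measure lebesgue (ellipsoid P) = 1 \<and>
     ellipsoid P \<subseteq> (\<lambda>x. r *\<^sub>R x) ` ellipsoid P \<and>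
     (\<lambda>x. r *\<^sub>R x) ` ellipsoid P \<subseteq> (\<lambda>x. A *v x) ` ellipsoid P"

text \<open>The operators \<open>*\<close> and \<open>^\<close> on \<open>real^'n^'n\<close> are componentwise, hence the explicit
  integer power of a matrix.\<close>

definition matrix_powi :: "real^'n^'n \<Rightarrow> int \<Rightarrow> real^'n^'n" where
  "matrix_powi A k =
     (if k \<ge> 0 then (((**) A) ^^ nat k) (mat 1)
      else (((**) (matrix_inv A)) ^^ nat (- k)) (mat 1))"

definition dil_ball :: "real^'n^'n \<Rightarrow> real^'n^'n \<Rightarrow> int \<Rightarrow> (real^'n) set" where
  "dil_ball A P k = (\<lambda>x. matrix_powi A k *v x) ` ellipsoid P"

definition dil_b :: "real^'n^'n \<Rightarrow> real" where
  "dil_b A = \<bar>det A\<bar>"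

text \<open>If \<open>A\<close> is an expansive dilation and \<open>dilation_ellipsoid A r P\<close> holds, then the sets
  \<open>dil_ball A P (k + 1) - dil_ball A P k\<close> partition the complement of the origin, so the
  description below determines \<open>k\<close>.\<close>

definition step_norm :: "real^'n^'n \<Rightarrow> real^'n^'n \<Rightarrow> real^'n \<Rightarrow> real" where
  "step_norm A P x =
     (if x = 0 then 0
      else dil_b A powi (THE k. x \<in> dil_ball A P (k + 1) - dil_ball A P k))"

section \<open>Variable exponents\<close>

definition p_minus :: "(real^'n \<Rightarrow> real) \<Rightarrow> ereal" where
  "p_minus p = - esssup lebesgue (\<lambda>x. - ereal (p x))"

definition p_plus :: "(real^'n \<Rightarrow> real) \<Rightarrow> ereal" where
  "p_plus p = esssup lebesgue (\<lambda>x. ereal (p x))"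

definition p_under :: "(real^'n \<Rightarrow> real) \<Rightarrow> real" where
  "p_under p = min (real_of_ereal (p_minus p)) 1"

definition variable_exponents :: "(real^'n \<Rightarrow> real) set" where
  "variable_exponents = {p. p \<in> borel_measurable lebesgue \<and> (\<forall>x. 0 < p x) \<and>
     0 < p_minus p \<and> p_minus p \<le> p_plus p \<and> p_plus p < \<infinity>}"

text \<open>For \<open>x = y\<close> the division by zero in the first inequality is harmless: its left-hand
  side is then 0.\<close>

definition C_log :: "real^'n^'n \<Rightarrow> real^'n^'n \<Rightarrow> (real^'n \<Rightarrow> real) set" where
  "C_log A P = {p. p \<in> variable_exponents \<and>
     (\<exists>C>0. \<exists>Cinf>0. \<exists>pinf.
        (\<forall>x y. \<bar>p x - p y\<bar> \<le> C / ln (exp 1 + 1 / step_norm A P (x - y))) \<and>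
        (\<forall>x. \<bar>p x - pinf\<bar> \<le> Cinf / ln (exp 1 + step_norm A P x)))}"

text \<open>The grand maximal function takes values in \<open>[0,\<infinity>]\<close>, so the variable Lebesgue space is
  set up for \<open>ennreal\<close>-valued functions (moduli). The exponent \<open>a\<close> is positive throughout.\<close>

definition ennreal_rpow :: "ennreal \<Rightarrow> real \<Rightarrow> ennreal" where
  "ennreal_rpow t a = (if t = \<infinity> then \<infinity> else ennreal (enn2real t powr a))"

definition Lp_modular :: "(real^'n \<Rightarrow> real) \<Rightarrow> (real^'n \<Rightarrow> ennreal) \<Rightarrow> ennreal" where
  "Lp_modular p g = (\<integral>\<^sup>+ x. ennreal_rpow (g x) (p x) \<partial>lebesgue)"

definition variable_Lp :: "(real^'n \<Rightarrow> real) \<Rightarrow> (real^'n \<Rightarrow> ennreal) set" where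
  "variable_Lp p = {g. g \<in> borel_measurable lebesgue \<and> Lp_modular p g < \<infinity>}"

text \<open>For \<open>g\<close> in \<open>variable_Lp p\<close> with \<open>0 < p_minus p\<close> and \<open>p_plus p < \<infinity>\<close> the set below is
  nonempty.\<close>

definition Lp_norm :: "(real^'n \<Rightarrow> real) \<Rightarrow> (real^'n \<Rightarrow> ennreal) \<Rightarrow> real" where
  "Lp_norm p g = Inf {s::real. 0 < s \<and> Lp_modular p (\<lambda>x. g x / ennreal s) \<le> 1}"

section \<open>Schwartz functions and tempered distributions\<close>

text \<open>Multi-indices are represented by lists of coordinates: \<open>[i\<^sub>1, \<dots>, i\<^sub>m]\<close> stands for
  \<open>\<partial>\<close> with respect to \<open>i\<^sub>1, \<dots>, i\<^sub>m\<close>, of order \<open>m\<close>. For smooth functions the order of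
  differentiation is immaterial, so quantifying over lists of length at most \<open>N\<close> amounts to
  quantifying over multi-indices of order at most \<open>N\<close>.\<close>

primrec partials :: "'n list \<Rightarrow> (real^'n \<Rightarrow> complex) \<Rightarrow> real^'n \<Rightarrow> complex" where
  "partials [] f = f"
| "partials (i # is) f = (\<lambda>x. frechet_derivative (partials is f) (at x) (axis i 1))"

definition smooth_fun :: "(real^'n \<Rightarrow> complex) \<Rightarrow> bool" where
  "smooth_fun f \<longleftrightarrow> (\<forall>is x. partials is f differentiable (at x))"

definition schwartz :: "(real^'n \<Rightarrow> complex) set" where
  "schwartz = {\<phi>. smooth_fun \<phi> \<and>
     (\<forall>m is. bdd_above (range (\<lambda>x. norm x ^ m * cmod (partials is \<phi> x))))}"

definition schwartz_seminorm :: "nat \<Rightarrow> 'n list \<Rightarrow> (real^'n \<Rightarrow> complex) \<Rightarrow> real" where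
  "schwartz_seminorm m is \<phi> = (SUP x. norm x ^ m * cmod (partials is \<phi> x))"

definition schwartz_topology :: "(real^'n \<Rightarrow> complex) topology" where
  "schwartz_topology = topology_generated_by
     {{\<psi> \<in> schwartz. schwartz_seminorm m is (\<lambda>x. \<psi> x - \<phi> x) < \<epsilon>} | m is \<phi> \<epsilon>.
        \<phi> \<in> schwartz \<and> 0 < \<epsilon>}"

text \<open>A tempered distribution is a functional on \<open>schwartz\<close>; its values elsewhere are
  irrelevant.\<close>

definition tempered :: "((real^'n \<Rightarrow> complex) \<Rightarrow> complex) set" where
  "tempered = {f.
     (\<forall>\<phi>\<in>schwartz. \<forall>\<psi>\<in>schwartz. f (\<lambda>x. \<phi> x + \<psi> x) = f \<phi> + f \<psi>) \<and>
     (\<forall>c. \<forall>\<phi>\<in>schwartz. f (\<lambda>x. c * \<phi> x) = c * f \<phi>) \<and>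
     continuous_map schwartz_topology euclidean f}"

definition fourier :: "(real^'n \<Rightarrow> complex) \<Rightarrow> real^'n \<Rightarrow> complex" where
  "fourier \<phi> x = (LINT \<xi>|lebesgue. \<phi> \<xi> * exp (- 2 * of_real pi * \<i> * of_real (x \<bullet> \<xi>)))"

definition dist_fourier ::
  "((real^'n \<Rightarrow> complex) \<Rightarrow> complex) \<Rightarrow> (real^'n \<Rightarrow> complex) \<Rightarrow> complex" where
  "dist_fourier f \<phi> = f (fourier \<phi>)"

text \<open>Equality of a tempered distribution with a function; the pairing of the function with
  every Schwartz function is required to converge.\<close>

definition dist_eq_fun :: "((real^'n \<Rightarrow> complex) \<Rightarrow> complex) \<Rightarrow> (real^'n \<Rightarrow> complex) \<Rightarrow> bool" where
  "dist_eq_fun f F \<longleftrightarrow>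
     (\<forall>\<phi>\<in>schwartz. integrable lebesgue (\<lambda>x. F x * \<phi> x) \<and>
                   f \<phi> = (LINT x|lebesgue. F x * \<phi> x))"

definition dist_conv ::
  "((real^'n \<Rightarrow> complex) \<Rightarrow> complex) \<Rightarrow> (real^'n \<Rightarrow> complex) \<Rightarrow> real^'n \<Rightarrow> complex" where
  "dist_conv f \<phi> y = f (\<lambda>z. \<phi> (y - z))"

section \<open>Variable anisotropic Hardy spaces\<close>

definition schwartz_N :: "real^'n^'n \<Rightarrow> real^'n^'n \<Rightarrow> nat \<Rightarrow> (real^'n \<Rightarrow> complex) set" where
  "schwartz_N A P N = {\<phi> \<in> schwartz.
     \<forall>is l. length is \<le> N \<longrightarrow> l \<le> N \<longrightarrow>
       (\<forall>x. step_norm A P x ^ l * cmod (partials is \<phi> x) \<le> 1)}"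

definition dilate :: "real^'n^'n \<Rightarrow> int \<Rightarrow> (real^'n \<Rightarrow> complex) \<Rightarrow> real^'n \<Rightarrow> complex" where
  "dilate A k \<phi> x = of_real (dil_b A powi (- k)) * \<phi> (matrix_powi A (- k) *v x)"

definition grand_maximal ::
  "real^'n^'n \<Rightarrow> real^'n^'n \<Rightarrow> nat \<Rightarrow> ((real^'n \<Rightarrow> complex) \<Rightarrow> complex) \<Rightarrow> real^'n \<Rightarrow> ennreal" where
  "grand_maximal A P N f x =
     (SUP \<phi>\<in>schwartz_N A P N. SUP k. SUP y\<in>(\<lambda>z. x + z) ` dil_ball A P k.
        ennreal (cmod (dist_conv f (dilate A k \<phi>) y)))"

definition hardy ::
  "real^'n^'n \<Rightarrow> real^'n^'n \<Rightarrow> nat \<Rightarrow> (real^'n \<Rightarrow> real) \<Rightarrow> ((real^'n \<Rightarrow> complex) \<Rightarrow> complex) set" where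
  "hardy A P N p = {f \<in> tempered. grand_maximal A P N f \<in> variable_Lp p}"

definition hardy_norm ::
  "real^'n^'n \<Rightarrow> real^'n^'n \<Rightarrow> nat \<Rightarrow> (real^'n \<Rightarrow> real) \<Rightarrow>
   ((real^'n \<Rightarrow> complex) \<Rightarrow> complex) \<Rightarrow> real" where
  "hardy_norm A P N p f = Lp_norm p (grand_maximal A P N f)"

text \<open>Power of a nonnegative real with the convention \<open>0\<^sup>0 = 1\<close>; the library has
  \<open>0 powr 0 = 0\<close>.\<close>

definition rpow :: "real \<Rightarrow> real \<Rightarrow> real" where
  "rpow t a = (if a = 0 then 1 else t powr a)"

end

theory Submission
  imports Defs
begin

text \<open>Let \<open>\<phi>\<close> be a normalized Gaussian, \<open>\<phi>\<^sub>k\<close> its dilates and \<open>g\<^sub>k = f * \<phi>\<^sub>k\<close>. On \<open>y + B\<^sub>k\<close> the grand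
  maximal function dominates a fixed multiple of \<open>\<bar>g\<^sub>k y\<bar>\<close>; testing the modular on \<open>y + B\<^sub>k\<close> first bounds
  \<open>g\<^sub>k\<close> pointwise and then, since all exponents are at most 1, in \<open>L\<^sup>1\<close>, with norm at most a constant times
  \<open>\<parallel>f\<parallel> b\<^bsup>-k(1/p - 1)\<^esup>\<close> for one of the exponents \<open>p = p\<^sub>-, p\<^sub>+\<close>. The transforms of \<open>g\<^sub>k\<close> and \<open>\<phi>\<^sub>k\<close> are
  continuous, and their quotient \<open>F\<close> does not depend on \<open>k\<close> because \<open>g\<^sub>k * \<phi>\<^sub>j = g\<^sub>j * \<phi>\<^sub>k\<close>. The transform of
  \<open>\<phi>\<^sub>k\<close> at \<open>x\<close> is that of \<open>\<phi>\<close> at the image of \<open>x\<close> under the \<open>k\<close>-th power of the transposed dilation, so it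
  is bounded below when \<open>b\<^sup>-\<^sup>k\<close> is comparable to the quasi-norm of \<open>x\<close>; this choice of \<open>k\<close> gives the bound
  for \<open>F x\<close>. Letting \<open>k\<close> tend to minus infinity identifies \<open>F\<close> with the transform of \<open>f\<close>. Atomic
  decompositions are avoided.\<close>

section \<open>Linear changes of variables\<close>

text \<open>Two obstacles shape the proof. A tempered distribution is only a continuous functional,
  so each identity that moves it under an integral has to be earned:
  \<open>tempered_convolution\<close> replaces the identity map by simple functions, for which
  linearity suffices, and controls the error in the Schwartz seminorms. Secondly, what is extracted
  about the transform of the Gaussian is that it is continuous, bounded by 1 and equal to 1 at the
  origin; this bounds it below near the origin only, so the scale in the quotient has to follow
  \<open>x\<close>. The two exponents of the final bound come from a split by size: after
  normalization, values of at least 1 are governed by the smallest exponent, smaller ones by the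
  largest. All estimates carry an arbitrary \<open>s\<close> admissible in the infimum behind
  \<open>Lp_norm\<close>, and the infimum is taken last. At the origin the quasi-norm selects no
  scale, so every \<open>k\<close> is available there; either \<open>k = 0\<close> or the limit of
  large \<open>k\<close> gives the bound.\<close>

lemma det_shear:
  fixes m n :: "'n::finite"
  assumes "m \<noteq> n"
  shows "det (matrix (\<lambda>v::real^'n. \<chi> i. if i = m then v $ m + v $ n else v $ i)) = 1"
proof -
  have "matrix (\<lambda>v::real^'n. \<chi> i. if i = m then v $ m + v $ n else v $ i)
      = (\<chi> k. if k = m then row m (mat 1) + 1 *s row n (mat 1) else row k (mat 1))"
    by (simp add: vec_eq_iff matrix_def row_def mat_def axis_def)
  then show ?thesis
    using det_row_operation[OF assms, of "mat 1" "1::real"] by simp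
qed

lemma det_swap:
  fixes m n :: "'n::finite"
  shows "\<bar>det (matrix (\<lambda>v::real^'n. \<chi> i. v $ Transposition.transpose m n i))\<bar> = 1"
proof -
  let ?p = "Transposition.transpose m n"
  have p: "?p permutes (UNIV :: 'n set)"
    by (simp add: permutes_swap_id)
  have "matrix (\<lambda>v::real^'n. \<chi> i. v $ ?p i) = (\<chi> i. mat 1 $ ?p i)"
    by (simp add: vec_eq_iff matrix_def mat_def axis_def)
  then have "det (matrix (\<lambda>v::real^'n. \<chi> i. v $ ?p i)) = of_int (sign ?p)"
    using det_permute_rows[OF p, of "mat 1 :: real^'n^'n"] by simp
  then show ?thesis
    by (simp add: sign_def)
qed

lemma measure_shear_cbox:
  fixes m n :: "'n::finite"
  assumes "m \<noteq> n"
  shows "measure lebesgue ((\<lambda>v::real^'n. \<chi> i. if i = m then v $ m + v $ n else v $ i) ` cbox a b)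
       = measure lebesgue (cbox a b)" (is "measure _ (?h ` _) = _")
proof (cases "cbox a b = {}")
  case False
  \<comment> \<open>\<open>measure_shear_interval\<close> wants a lower corner whose
    \<open>n\<close>-th coordinate is nonnegative. Translating by \<open>w\<close> makes that
    coordinate 0, and translations preserve measure on both sides of the shear.\<close>
  define w where "w = (axis n (- a $ n) :: real^'n)"
  have add: "?h (x + y) = ?h x + ?h y" for x y
    by (simp add: vec_eq_iff)
  have "?h ` cbox a b = ?h ` ((+) (- w) ` cbox (a + w) (b + w))"
    by (subst cbox_translation[symmetric]) (simp add: algebra_simps)
  also have "\<dots> = (+) (?h (- w)) ` ?h ` cbox (a + w) (b + w)"
    by (simp only: image_image add)
  finally have "measure lebesgue (?h ` cbox a b) = measure lebesgue (?h ` cbox (a + w) (b + w))"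
    by (simp only: measure_translation)
  also have "\<dots> = measure lebesgue (cbox (a + w) (b + w))"
  proof (rule measure_shear_interval[OF assms])
    show "cbox (a + w) (b + w) \<noteq> {}"
      using False by (auto simp: box_ne_empty inner_simps)
    show "0 \<le> (a + w) $ n"
      by (simp add: w_def axis_def)
  qed
  also have "cbox (a + w) (b + w) = (+) w ` cbox a b"
    by (subst cbox_translation[symmetric]) (simp add: algebra_simps)
  finally show ?thesis
    by (simp only: measure_translation)
qed simp

lemma measure_swap_cbox:
  fixes m n :: "'n::finite"
  shows "measure lebesgue ((\<lambda>v::real^'n. \<chi> i. v $ Transposition.transpose m n i) ` cbox a b)
       = measure lebesgue (cbox a b)" (is "measure _ (?h ` _) = _")
proof (cases "cbox a b = {}")
  case False
  let ?p = "Transposition.transpose m n"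
  have p: "?p permutes (UNIV :: 'n set)"
    by (simp add: permutes_swap_id)
  have inv: "?h (?h x) = x" for x
    by (simp add: vec_eq_iff)
  have "?h ` cbox a b = cbox (?h a) (?h b)"
  proof (intro equalityI subsetI)
    fix x assume "x \<in> ?h ` cbox a b"
    then show "x \<in> cbox (?h a) (?h b)"
      by (auto simp: mem_box_cart)
  next
    fix x assume x: "x \<in> cbox (?h a) (?h b)"
    have "a $ i \<le> ?h x $ i" "?h x $ i \<le> b $ i" for i
    proof -
      have "?h a $ (?p i) \<le> x $ (?p i) \<and> x $ (?p i) \<le> ?h b $ (?p i)"
        using x by (simp only: mem_box_cart)
      then show "a $ i \<le> ?h x $ i" "?h x $ i \<le> b $ i"
        by simp_all
    qed
    then have "?h x \<in> cbox a b"
      unfolding mem_box_cart by (intro allI conjI)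
    then show "x \<in> ?h ` cbox a b"
      by (intro image_eqI[where x="?h x"]) (simp only: inv)
  qed
  moreover from this have "cbox (?h a) (?h b) \<noteq> {}"
    using False by (metis image_is_empty)
  moreover have "(\<Prod>i\<in>UNIV. b $ ?p i - a $ ?p i) = (\<Prod>i\<in>UNIV. b $ i - a $ i)"
    using prod.permute[OF p, of "\<lambda>i. b $ i - a $ i"] by (simp add: o_def)
  ultimately show ?thesis
    using False by (simp add: content_cbox_cart)
qed simp

text \<open>The library has this for index types of class \<open>wellorder\<close> only.\<close>

proposition measure_linear_image_finite:
  fixes f :: "real^'n \<Rightarrow> real^'n"
  assumes "linear f" and "S \<in> lmeasurable"
  shows measurable_linear_image_finite: "f ` S \<in> lmeasurable"
    and measure_linear_image_det: "measure lebesgue (f ` S) = \<bar>det (matrix f)\<bar> * measure lebesgue S"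
proof -
  \<comment> \<open>\<open>Q\<close> quantifies over all measurable sets because the composition
    case applies the hypothesis for the outer map to the image under the inner one.\<close>
  define Q where "Q f \<longleftrightarrow> (\<forall>S\<in>lmeasurable. f ` S \<in> lmeasurable \<and>
    measure lebesgue (f ` S) = \<bar>det (matrix f)\<bar> * measure lebesgue S)" for f :: "real^'n \<Rightarrow> real^'n"
  have "Q f"
  proof (rule induct_linear_elementary[OF assms(1)])
    fix f g :: "real^'n \<Rightarrow> real^'n"
    assume *: "linear f" "linear g" "Q f" "Q g"
    have "matrix (f \<circ> g) = matrix f ** matrix g"
      by (rule matrix_compose) (use * in auto)
    with * show "Q (f \<circ> g)"
      unfolding Q_def image_comp[symmetric] by (simp add: det_mul abs_mult)
  next
    fix f :: "real^'n \<Rightarrow> real^'n" and i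
    assume f: "linear f" and 0: "\<And>x. f x $ i = 0"
    have "\<not> surj f"
    proof
      assume "surj f"
      then obtain x where "axis i 1 = f x" by (metis surjD)
      with 0[of x] show False by (metis axis_nth one_neq_zero)
    qed
    then have ninj: "\<not> inj f"
      using linear_injective_imp_surjective f by blast
    have "negligible (f ` S)" for S
      using negligible_linear_singular_image f ninj by blast
    moreover have "det (matrix f) = 0"
      using det_nz_iff_inj[OF f] ninj by blast
    ultimately show "Q f"
      unfolding Q_def by (auto simp: negligible_iff_measure)
  next
    fix c :: "'n \<Rightarrow> real"
    have "det (matrix (\<lambda>x::real^'n. \<chi> i. c i * x $ i)) = prod c UNIV"
      by (simp add: axis_def matrix_def det_diagonal)
    then show "Q (\<lambda>x. \<chi> i. c i * x $ i)"
      unfolding Q_def by (auto simp: measurable_stretch measure_stretch)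
  next
    fix m n :: 'n
    have lin: "linear (\<lambda>v::real^'n. \<chi> i. v $ Transposition.transpose m n i)"
      by (rule linearI) (simp_all add: vec_eq_iff)
    show "Q (\<lambda>x. \<chi> i. x $ Transposition.transpose m n i)"
      unfolding Q_def det_swap mult_1
    proof (intro ballI)
      fix S :: "(real^'n) set" assume "S \<in> lmeasurable"
      from measure_linear_sufficient[OF lin this, where m=1, unfolded mult_1, OF measure_swap_cbox]
      show "(\<lambda>v. \<chi> i. v $ Transposition.transpose m n i) ` S \<in> lmeasurable \<and>
        measure lebesgue ((\<lambda>v. \<chi> i. v $ Transposition.transpose m n i) ` S) = measure lebesgue S"
        by metis
    qed
  next
    fix m n :: 'n assume "m \<noteq> n"
    have lin: "linear (\<lambda>v::real^'n. \<chi> i. if i = m then v $ m + v $ n else v $ i)"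
      by (rule linearI) (auto simp: vec_eq_iff algebra_simps)
    show "Q (\<lambda>x. \<chi> i. if i = m then x $ m + x $ n else x $ i)"
      unfolding Q_def det_shear[OF \<open>m \<noteq> n\<close>] mult_1 abs_one
    proof (intro ballI)
      fix S :: "(real^'n) set" assume "S \<in> lmeasurable"
      from measure_linear_sufficient[OF lin this, where m=1, unfolded mult_1, OF measure_shear_cbox[OF \<open>m \<noteq> n\<close>]]
      show "(\<lambda>v. \<chi> i. if i = m then v $ m + v $ n else v $ i) ` S \<in> lmeasurable \<and>
        measure lebesgue ((\<lambda>v. \<chi> i. if i = m then v $ m + v $ n else v $ i) ` S) = measure lebesgue S"
        by metis
    qed
  qed
  then show "f ` S \<in> lmeasurable" "measure lebesgue (f ` S) = \<bar>det (matrix f)\<bar> * measure lebesgue S"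
    using assms(2) by (auto simp: Q_def)
qed

section \<open>Matrix inverses and linear substitution in integrals\<close>

lemma matrix_inv_mult:
  fixes M :: "real^'n^'n"
  assumes "invertible M"
  shows "M ** matrix_inv M = mat 1" "matrix_inv M ** M = mat 1"
  using assms unfolding invertible_def matrix_inv_def by (metis (mono_tags, lifting) someI_ex)+

lemma matrix_inv_vector_mult:
  fixes M :: "real^'n^'n"
  assumes "invertible M"
  shows "M *v (matrix_inv M *v x) = x" "matrix_inv M *v (M *v x) = x"
  by (simp_all add: matrix_vector_mul_assoc matrix_inv_mult[OF assms])

text \<open>By \<open>lborel_eqI\<close> boxes suffice. The preimage of a box under \<open>M\<close>
  is its image under the inverse matrix, whose measure is known, and the two determinants cancel. In
  this form the substitution rules for integrals and for integrability both follow by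
  simplification.\<close>

lemma lborel_linear_density:
  fixes M :: "real^'n^'n"
  assumes "invertible M"
  shows "lborel = density (distr lborel borel ((*v) M)) (\<lambda>_. ennreal \<bar>det M\<bar>)" (is "_ = ?D")
proof (rule lborel_eqI)
  fix l u :: "real^'n"
  assume le: "\<And>b. b \<in> Basis \<Longrightarrow> l \<bullet> b \<le> u \<bullet> b"
  have [measurable]: "(*v) M \<in> borel_measurable borel"
    by (intro borel_measurable_continuous_onI) (simp add: matrix_vector_mul_bounded_linear linear_continuous_on)
  have vim: "(*v) M -` box l u = (*v) (matrix_inv M) ` box l u"
  proof (intro equalityI subsetI)
    fix x assume "x \<in> (*v) M -` box l u"
    then show "x \<in> (*v) (matrix_inv M) ` box l u"
      by (intro image_eqI[where x="M *v x"]) (simp_all add: matrix_inv_vector_mult[OF assms])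
  qed (auto simp: matrix_inv_vector_mult[OF assms])
  have lm: "(*v) M -` box l u \<in> lmeasurable"
    and ms: "measure lebesgue ((*v) M -` box l u) = \<bar>det (matrix_inv M)\<bar> * measure lebesgue (box l u)"
    unfolding vim
    using measurable_linear_image_finite[of "(*v) (matrix_inv M)" "box l u"]
      measure_linear_image_det[of "(*v) (matrix_inv M)" "box l u"]
    by (simp_all add: matrix_vector_mul_linear)
  have d1: "\<bar>det M\<bar> * \<bar>det (matrix_inv M)\<bar> = 1"
    using matrix_inv_mult(1)[OF assms] by (metis abs_mult abs_one det_I det_mul)
  have B: "(*v) M -` box l u \<in> sets borel"
    using measurable_sets[of "(*v) M" borel borel "box l u"] by simp
  have "emeasure ?D (box l u) = ennreal \<bar>det M\<bar> * emeasure lborel ((*v) M -` box l u)"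
    by (simp add: emeasure_density nn_integral_cmult_indicator emeasure_distr)
  also have "emeasure lborel ((*v) M -` box l u) = emeasure lebesgue ((*v) M -` box l u)"
    using B by simp
  also have "\<dots> = ennreal (\<bar>det (matrix_inv M)\<bar> * measure lebesgue (box l u))"
    using lm ms by (simp add: emeasure_eq_measure2)
  also have "ennreal \<bar>det M\<bar> * \<dots> = ennreal (measure lebesgue (box l u))"
    using d1 by (simp add: ennreal_mult[symmetric] mult.assoc[symmetric])
  also have "\<dots> = (\<Prod>b\<in>Basis. (u - l) \<bullet> b)"
    using le by (simp add: measure_lborel_box_eq inner_simps)
  finally show "emeasure ?D (box l u) = (\<Prod>b\<in>Basis. (u - l) \<bullet> b)" .
qed simp

lemma borel_measurable_matrix_vector_mult [measurable]:
  "(*v) (M :: real^'n^'m) \<in> borel_measurable borel"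
  by (intro borel_measurable_continuous_onI) (simp add: matrix_vector_mul_bounded_linear linear_continuous_on)

lemma lborel_integral_linear:
  fixes M :: "real^'n^'n" and g :: "real^'n \<Rightarrow> 'a::{banach, second_countable_topology}"
  assumes "invertible M" and [measurable]: "g \<in> borel_measurable borel"
  shows "(LINT x|lborel. g x) = \<bar>det M\<bar> *\<^sub>R (LINT x|lborel. g (M *v x))"
    and "integrable lborel g \<longleftrightarrow> integrable lborel (\<lambda>x. g (M *v x))"
proof -
  have nz: "\<bar>det M\<bar> \<noteq> 0"
    using assms(1) by (simp add: invertible_det_nz)
  show "(LINT x|lborel. g x) = \<bar>det M\<bar> *\<^sub>R (LINT x|lborel. g (M *v x))"
    by (subst lborel_linear_density[OF assms(1)])
      (simp add: integral_density integral_distr)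
  show "integrable lborel g \<longleftrightarrow> integrable lborel (\<lambda>x. g (M *v x))"
  proof -
    have "integrable lborel g \<longleftrightarrow> integrable lborel (\<lambda>x. \<bar>det M\<bar> *\<^sub>R g (M *v x))"
      by (subst lborel_linear_density[OF assms(1)])
        (simp add: integrable_density integrable_distr_eq)
    also have "\<dots> \<longleftrightarrow> integrable lborel (\<lambda>x. g (M *v x))"
    proof
      assume "integrable lborel (\<lambda>x. \<bar>det M\<bar> *\<^sub>R g (M *v x))"
      then have "integrable lborel (\<lambda>x. inverse \<bar>det M\<bar> *\<^sub>R \<bar>det M\<bar> *\<^sub>R g (M *v x))"
        by (rule integrable_scaleR_right)
      then show "integrable lborel (\<lambda>x. g (M *v x))"
        unfolding scaleR_scaleR using nz by simp
    qed (rule integrable_scaleR_right)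
    finally show ?thesis .
  qed
qed

section \<open>Integer powers of a dilation and the step quasi-norm\<close>

lemma matrix_powi_0 [simp]: "matrix_powi A 0 = mat 1"
  by (simp add: matrix_powi_def)

lemma matrix_powi_succ:
  assumes "invertible A"
  shows "matrix_powi A (k + 1) = A ** matrix_powi A k"
proof (cases "k \<ge> 0")
  case True
  then have "nat (k + 1) = Suc (nat k)" by simp
  with True show ?thesis by (simp add: matrix_powi_def)
next
  case False
  then have "nat (- k) = Suc (nat (- (k + 1)))" by simp
  then have "matrix_powi A k = matrix_inv A ** (((**) (matrix_inv A)) ^^ nat (- (k + 1))) (mat 1)"
    using False by (simp add: matrix_powi_def)
  also have "(((**) (matrix_inv A)) ^^ nat (- (k + 1))) (mat 1) = matrix_powi A (k + 1)"
    using False by (auto simp: matrix_powi_def)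
  finally show ?thesis
    by (simp add: matrix_mul_assoc matrix_inv_mult[OF assms])
qed

lemma matrix_powi_pred:
  assumes "invertible A"
  shows "matrix_powi A (k - 1) = matrix_inv A ** matrix_powi A k"
  using matrix_powi_succ[OF assms, of "k - 1"]
  by (simp add: matrix_mul_assoc matrix_inv_mult[OF assms])

lemma matrix_powi_add:
  assumes "invertible A"
  shows "matrix_powi A (j + k) = matrix_powi A j ** matrix_powi A k"
proof (induction j rule: int_induct[where k=0])
  case (step1 i)
  then show ?case
    using matrix_powi_succ[OF assms, of "i + k"] matrix_powi_succ[OF assms, of i]
    by (simp add: matrix_mul_assoc add.commute add.left_commute)
next
  case (step2 i)
  then show ?case
    using matrix_powi_pred[OF assms, of "i + k"] matrix_powi_pred[OF assms, of i]
    by (simp add: matrix_mul_assoc algebra_simps)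
qed simp

lemma matrix_powi_1 [simp]: "matrix_powi A 1 = A"
  by (simp add: matrix_powi_def)

lemma matrix_powi_mult_uminus:
  assumes "invertible A"
  shows "matrix_powi A k ** matrix_powi A (- k) = mat 1"
  using matrix_powi_add[OF assms, of k "- k"] by simp

lemma matrix_powi_vector_uminus:
  assumes "invertible A"
  shows "matrix_powi A k *v (matrix_powi A (- k) *v x) = x"
    and "matrix_powi A (- k) *v (matrix_powi A k *v x) = x"
  using matrix_powi_mult_uminus[OF assms, of k] matrix_powi_mult_uminus[OF assms, of "- k"]
  by (simp_all add: matrix_vector_mul_assoc)

lemma invertible_matrix_powi:
  assumes "invertible A"
  shows "invertible (matrix_powi A k)"
  using matrix_powi_mult_uminus[OF assms, of k] invertible_right_inverse by blast

lemma det_matrix_powi: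
  fixes A :: "real^'n^'n"
  assumes "invertible A"
  shows "det (matrix_powi A k) = det A powi k"
proof -
  have nz: "det A \<noteq> 0" using assms by (simp add: invertible_det_nz)
  show ?thesis
  proof (induction k rule: int_induct[where k=0])
    case (step1 i)
    then show ?case
      using nz by (simp add: matrix_powi_succ[OF assms] det_mul power_int_add)
  next
    case (step2 i)
    have "det A * det (matrix_powi A (i - 1)) = det (matrix_powi A i)"
      using matrix_powi_succ[OF assms, of "i - 1"] by (simp add: det_mul)
    then show ?case
      using nz step2 by (simp add: power_int_diff field_simps)
  qed simp
qed

lemma transpose_matrix_powi:
  fixes A :: "real^'n^'n"
  assumes "invertible A"
  shows "transpose (matrix_powi A k) = matrix_powi (transpose A) k"
proof -
  have it: "invertible (transpose A)"
    using assms by (simp add: invertible_det_nz)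
  \<comment> \<open>Transposition reverses products, so a factor has to be split off on the right
    here, whereas \<open>matrix_powi_succ\<close> splits it off on the left.\<close>
  have comm: "matrix_powi A (k + 1) = matrix_powi A k ** A" for k
    using matrix_powi_add[OF assms, of k 1] by simp
  show ?thesis
  proof (induction k rule: int_induct[where k=0])
    case (step1 i)
    then show ?case
      by (simp add: comm matrix_transpose_mul matrix_powi_succ[OF it])
  next
    case (step2 i)
    have "transpose (matrix_powi A i) = transpose A ** transpose (matrix_powi A (i - 1))"
      using comm[of "i - 1"] by (simp add: matrix_transpose_mul)
    then have "matrix_inv (transpose A) ** matrix_powi (transpose A) i = transpose (matrix_powi A (i - 1))"
      using step2 by (simp add: matrix_mul_assoc matrix_inv_mult[OF it])
    then show ?case
      by (simp add: matrix_powi_pred[OF it])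
  qed simp
qed

text \<open>The norm whose open unit ball is \<open>dil_ball A P k\<close> (see
  \<open>mem_dil_ball\<close>). It turns the nesting of the balls into inequalities between real
  numbers.\<close>

definition dil_gauge :: "real^'n^'n \<Rightarrow> real^'n^'n \<Rightarrow> int \<Rightarrow> real^'n \<Rightarrow> real" where
  "dil_gauge A P k x = norm (P *v (matrix_powi A (- k) *v x))"

lemma ellipsoid_lmeasurable:
  assumes "invertible P"
  shows "ellipsoid P \<in> lmeasurable"
proof -
  have "ellipsoid P = (*v) (matrix_inv P) ` ball 0 1"
  proof (intro equalityI subsetI)
    fix x assume "x \<in> ellipsoid P"
    then show "x \<in> (*v) (matrix_inv P) ` ball 0 1"
      by (intro image_eqI[where x="P *v x"]) (simp_all add: matrix_inv_vector_mult[OF assms] ellipsoid_def)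
  qed (auto simp: matrix_inv_vector_mult[OF assms] ellipsoid_def)
  then show ?thesis
    by (simp add: measurable_linear_image_finite matrix_vector_mul_linear)
qed

locale dilation =
  fixes A P :: "real^'n^'n" and r :: real
  assumes dil: "dilation_ellipsoid A r P"
begin

lemma r_gt_1: "1 < r" and invertible_P: "invertible P"
  and measure_ellipsoid: "measure lebesgue (ellipsoid P) = 1"
  using dil by (auto simp: dilation_ellipsoid_def)

text \<open>Compare volumes in the inclusion of the \<open>r\<close>-fold ellipsoid in its image
  under \<open>A\<close>: the left side has measure \<open>r ^ CARD('n)\<close>, the right side
  \<bar>det A\<bar>.\<close>

lemma dil_b_gt_1: "1 < dil_b A"
proof -
  have E: "ellipsoid P \<in> lmeasurable"
    by (rule ellipsoid_lmeasurable[OF invertible_P])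
  have s: "(\<lambda>x::real^'n. r *\<^sub>R x) = (\<lambda>x. \<chi> i. r * x $ i)"
    by (simp add: vec_eq_iff fun_eq_iff)
  have m: "(\<lambda>x. r *\<^sub>R x) ` ellipsoid P \<in> lmeasurable"
    "measure lebesgue ((\<lambda>x. r *\<^sub>R x) ` ellipsoid P) = r ^ CARD('n)"
    unfolding s using measurable_stretch[OF E, of "\<lambda>_. r"] measure_stretch[OF E, of "\<lambda>_. r"]
      measure_ellipsoid r_gt_1 by auto
  have "measure lebesgue ((\<lambda>x. r *\<^sub>R x) ` ellipsoid P) \<le> measure lebesgue ((*v) A ` ellipsoid P)"
    using dil m(1) measurable_linear_image_finite[OF _ E, of "(*v) A"]
    by (intro measure_mono_fmeasurable) (auto simp: dilation_ellipsoid_def matrix_vector_mul_linear fmeasurableD)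
  then have "r ^ CARD('n) \<le> dil_b A"
    using measure_linear_image_det[OF _ E, of "(*v) A"] measure_ellipsoid m
    by (simp add: matrix_vector_mul_linear dil_b_def)
  moreover have "1 < r ^ CARD('n)"
    using r_gt_1 by (simp add: one_less_power)
  ultimately show ?thesis by linarith
qed

lemma invertible_A: "invertible A"
  using dil_b_gt_1 by (auto simp: dil_b_def invertible_det_nz)

text \<open>The assumed inclusion speaks about the open unit ball of the gauge only. Scaling
  \<open>x\<close> by any \<open>t\<close> above its gauge brings it there, and
  \<open>dense_ge\<close> then lets \<open>t\<close> decrease to the gauge; a gauge of 0 needs no
  separate case.\<close>

lemma dil_gauge_contract: "norm (P *v (matrix_inv A *v x)) \<le> norm (P *v x) / r"
proof -
  have "norm (P *v (matrix_inv A *v x)) * r \<le> t" if t: "norm (P *v x) < t" for t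
  proof -
    have t0: "0 < t" using t norm_ge_zero[of "P *v x"] by linarith
    have "norm (P *v ((1 / t) *\<^sub>R x)) < 1"
      using t t0 by (simp add: matrix_vector_mult_scaleR)
    then have "r *\<^sub>R ((1 / t) *\<^sub>R x) \<in> (*v) A ` ellipsoid P"
      using dil by (auto simp: dilation_ellipsoid_def ellipsoid_def)
    then obtain d where d: "norm (P *v d) < 1" "A *v d = r *\<^sub>R ((1 / t) *\<^sub>R x)"
      by (auto simp: ellipsoid_def)
    have "d = (r / t) *\<^sub>R (matrix_inv A *v x)"
      using arg_cong[OF d(2), of "(*v) (matrix_inv A)"]
      by (simp add: matrix_inv_vector_mult[OF invertible_A] matrix_vector_mult_scaleR)
    with d(1) have "(r / t) * norm (P *v (matrix_inv A *v x)) < 1"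
      using t0 r_gt_1 by (simp add: matrix_vector_mult_scaleR)
    then show ?thesis
      using t0 by (simp add: field_simps)
  qed
  then have "norm (P *v (matrix_inv A *v x)) * r \<le> norm (P *v x)"
    by (rule dense_ge)
  then show ?thesis
    using r_gt_1 by (simp add: field_simps)
qed

lemma dil_gauge_succ: "dil_gauge A P (k + 1) x \<le> dil_gauge A P k x / r"
proof -
  have "- (k + 1) = - k - 1" by simp
  then show ?thesis
  using dil_gauge_contract[of "matrix_powi A (- k) *v x"] matrix_powi_pred[OF invertible_A, of "- k"]
    by (simp only: dil_gauge_def matrix_vector_mul_assoc)
qed

text \<open>Each further step of the scale shrinks the gauge by \<open>r\<close> or more. This
  geometric decay is what all later comparisons of scales rest on.\<close>

lemma dil_gauge_add: "dil_gauge A P (k + int m) x * r ^ m \<le> dil_gauge A P k x"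
proof (induction m)
  case (Suc m)
  have "dil_gauge A P (k + int (Suc m)) x * r \<le> dil_gauge A P (k + int m) x"
    using dil_gauge_succ[of "k + int m" x] r_gt_1 by (simp add: field_simps add.commute)
  then have "dil_gauge A P (k + int (Suc m)) x * r * r ^ m \<le> dil_gauge A P (k + int m) x * r ^ m"
    using r_gt_1 by (intro mult_right_mono) auto
  with Suc show ?case by (simp add: mult.assoc)
qed simp

lemma dil_gauge_nonneg [simp]: "0 \<le> dil_gauge A P k x"
  by (simp add: dil_gauge_def)

lemma dil_gauge_antimono:
  assumes "j \<le> k" shows "dil_gauge A P k x \<le> dil_gauge A P j x"
proof -
  have "dil_gauge A P k x * 1 \<le> dil_gauge A P k x * r ^ nat (k - j)"
    using r_gt_1 by (intro mult_left_mono) auto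
  also have "\<dots> \<le> dil_gauge A P j x"
    using dil_gauge_add[of j "nat (k - j)" x] assms by simp
  finally show ?thesis by simp
qed

lemma mem_dil_ball: "x \<in> dil_ball A P k \<longleftrightarrow> dil_gauge A P k x < 1"
proof
  assume "x \<in> dil_ball A P k"
  then show "dil_gauge A P k x < 1"
    by (auto simp: dil_ball_def dil_gauge_def ellipsoid_def matrix_powi_vector_uminus[OF invertible_A])
next
  assume "dil_gauge A P k x < 1"
  then show "x \<in> dil_ball A P k"
    unfolding dil_ball_def
    by (intro image_eqI[where x="matrix_powi A (- k) *v x"])
      (auto simp: dil_gauge_def ellipsoid_def matrix_powi_vector_uminus[OF invertible_A])
qed

lemma dil_ball_lmeasurable: "dil_ball A P k \<in> lmeasurable"
  unfolding dil_ball_def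
  by (simp add: measurable_linear_image_finite matrix_vector_mul_linear ellipsoid_lmeasurable invertible_P)

lemma measure_dil_ball: "measure lebesgue (dil_ball A P k) = dil_b A powi k"
  unfolding dil_ball_def
  by (subst measure_linear_image_det)
    (simp_all add: matrix_vector_mul_linear ellipsoid_lmeasurable invertible_P measure_ellipsoid
      det_matrix_powi invertible_A dil_b_def power_int_abs)

lemma dil_gauge_uminus: "dil_gauge A P k (- x) = dil_gauge A P k x"
  unfolding dil_gauge_def scaleR_minus1_left[symmetric, of x] matrix_vector_mult_scaleR by simp

text \<open>In \<open>k\<close> the gauge of a non-zero \<open>x\<close> decreases from arbitrarily
  large to arbitrarily small values, so it passes 1 exactly once. The last index with gauge at least
  1 is the one that the description in \<open>step_norm\<close> selects.\<close>

lemma step_norm_eq: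
  assumes "x \<noteq> 0"
  obtains k where "1 \<le> dil_gauge A P k x" "dil_gauge A P (k + 1) x < 1"
    "step_norm A P x = dil_b A powi k"
proof -
  have pos: "0 < dil_gauge A P 0 x"
    using assms matrix_inv_vector_mult[OF invertible_P, of x]
    by (auto simp: dil_gauge_def)
  obtain m where m: "dil_gauge A P 0 x < r ^ m"
    using real_arch_pow[OF r_gt_1] by blast
  have "dil_gauge A P (int m) x < 1"
  proof (rule ccontr)
    assume "\<not> dil_gauge A P (int m) x < 1"
    then have "r ^ m \<le> dil_gauge A P (0 + int m) x * r ^ m"
      using r_gt_1 by (simp add: mult_le_cancel_right1)
    with dil_gauge_add[of 0 m x] m show False by linarith
  qed
  obtain l where l: "1 / dil_gauge A P 0 x < r ^ l"
    using real_arch_pow[OF r_gt_1] by blast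
  have l1: "1 \<le> dil_gauge A P (- int l) x"
    using dil_gauge_add[of "- int l" l x] l pos by (simp add: field_simps)
  \<comment> \<open>\<open>LEAST\<close> searches the naturals, so the search starts at
    \<open>- int l\<close>, where the gauge is still at least 1. Hence \<open>n\<close> is not 0 and
    its predecessor gives \<open>k\<close>.\<close>
  define n where "n = (LEAST n. dil_gauge A P (- int l + int n) x < 1)"
  have ex: "dil_gauge A P (- int l + int (l + m)) x < 1"
    using \<open>dil_gauge A P (int m) x < 1\<close> by simp
  have n: "dil_gauge A P (- int l + int n) x < 1"
    unfolding n_def by (rule LeastI[where P="\<lambda>n. dil_gauge A P (- int l + int n) x < 1", OF ex])
  have n0: "n \<noteq> 0"
    using n l1 by (intro notI) simp
  define k where "k = - int l + int n - 1"
  have "\<not> dil_gauge A P (- int l + int (n - 1)) x < 1"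
    by (rule not_less_Least[where P="\<lambda>n. dil_gauge A P (- int l + int n) x < 1"])
      (unfold n_def[symmetric], use n0 in simp)
  moreover have "k = - int l + int (n - 1)" "k + 1 = - int l + int n"
    using n0 by (simp_all add: k_def of_nat_diff)
  ultimately have k: "1 \<le> dil_gauge A P k x" "dil_gauge A P (k + 1) x < 1"
    using n by simp_all
  have "(THE k. x \<in> dil_ball A P (k + 1) - dil_ball A P k) = k"
  proof (rule the_equality)
    show "x \<in> dil_ball A P (k + 1) - dil_ball A P k"
      using k by (simp add: mem_dil_ball)
    fix j assume "x \<in> dil_ball A P (j + 1) - dil_ball A P j"
    then have j: "1 \<le> dil_gauge A P j x" "dil_gauge A P (j + 1) x < 1"
      by (simp_all add: mem_dil_ball)
    show "j = k"
    proof (rule ccontr)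
      assume "j \<noteq> k"
      then consider "j + 1 \<le> k" | "k + 1 \<le> j" by linarith
      then show False
        by cases (use j k dil_gauge_antimono[of "j + 1" k x] dil_gauge_antimono[of "k + 1" j x] in linarith)+
    qed
  qed
  then show ?thesis
    using that[of k] k assms by (simp add: step_norm_def)
qed

lemma step_norm_nonneg: "0 \<le> step_norm A P x"
  using dil_b_gt_1 by (simp add: step_norm_def)

text \<open>If the quasi-norm of \<open>x\<close> is the \<open>m\<close>-th power of the
  determinant with positive \<open>m\<close>, then \<open>r ^ m\<close> is at most the gauge of
  \<open>x\<close> at scale 0, which is linear in \<open>norm x\<close>; the \<open>q\<close>-th
  power then dominates since \<open>dil_b A < r ^ q\<close>. The base
  \<open>(1 + K) * (1 + norm x)\<close> is at least 1, which settles the points of quasi-norm at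
  most 1.\<close>

lemma step_norm_le_power:
  obtains C q where "0 < C" "\<And>x. step_norm A P x \<le> C * (1 + norm x) ^ q"
proof -
  obtain q where q: "dil_b A < r ^ q"
    using real_arch_pow[OF r_gt_1] by blast
  obtain K where K: "0 < K" "\<And>x. norm (P *v x) \<le> norm x * K"
    using bounded_linear.pos_bounded[of "(*v) P"] by (auto simp: matrix_vector_mul_bounded_linear)
  have "step_norm A P x \<le> (1 + K) ^ q * (1 + norm x) ^ q" for x
  proof (cases "x = 0")
    case True
    then show ?thesis
      using K by (simp add: step_norm_def)
  next
    case False
    then obtain k where k: "1 \<le> dil_gauge A P k x" "step_norm A P x = dil_b A powi k"
      by (rule step_norm_eq) blast
    have one: "1 \<le> (1 + K) * (1 + norm x)"
      using K by (simp add: algebra_simps add_increasing2)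
    show ?thesis
    proof (cases "k \<le> 0")
      case True
      then have "step_norm A P x \<le> 1"
        using k dil_b_gt_1 power_int_increasing[of k 0 "dil_b A"] by simp
      also have "1 \<le> ((1 + K) * (1 + norm x)) ^ q"
        using one by (rule one_le_power)
      finally show ?thesis by (simp add: power_mult_distrib)
    next
      case False
      define m where "m = nat k"
      have km: "k = int m" using False by (simp add: m_def)
      have "r ^ m \<le> dil_gauge A P (0 + int m) x * r ^ m"
        using k r_gt_1 by (simp add: km mult_le_cancel_right1)
      also have "\<dots> \<le> norm (P *v x)"
        using dil_gauge_add[of 0 m x] by (simp add: dil_gauge_def)
      also have "\<dots> \<le> (1 + K) * (1 + norm x)"
      proof -
        have "(1 + K) * (1 + norm x) = 1 + K + norm x + norm x * K"
          by (simp add: algebra_simps)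
        then show ?thesis
          using K(2)[of x] K(1) norm_ge_zero[of x] by linarith
      qed
      finally have rm: "r ^ m \<le> (1 + K) * (1 + norm x)" .
      have "step_norm A P x = dil_b A ^ m"
        using k km by simp
      also have "\<dots> \<le> (r ^ q) ^ m"
        using q dil_b_gt_1 by (intro power_mono) auto
      also have "\<dots> = (r ^ m) ^ q"
        by (simp add: power_mult[symmetric] mult.commute)
      also have "\<dots> \<le> ((1 + K) * (1 + norm x)) ^ q"
        using rm r_gt_1 by (intro power_mono) auto
      finally show ?thesis by (simp add: power_mult_distrib)
    qed
  qed
  then show ?thesis
    using that[of "(1 + K) ^ q" q] K(1) by (simp add: zero_less_power)
qed

end

section \<open>Variable Lebesgue spaces\<close>

lemma p_minus_p_plus_bounds:
  assumes "p \<in> variable_exponents" and "p_plus p \<le> 1"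
  defines "pm \<equiv> real_of_ereal (p_minus p)" and "pp \<equiv> real_of_ereal (p_plus p)"
  shows "0 < pm" "pm \<le> pp" "pp \<le> 1" "AE x in lebesgue. pm \<le> p x \<and> p x \<le> pp"
proof -
  have p: "0 < p_minus p" "p_minus p \<le> p_plus p"
    using assms by (auto simp: variable_exponents_def)
  have m: "p_minus p = ereal pm" and q: "p_plus p = ereal pp"
    unfolding pm_def pp_def using p assms(2) by (cases "p_minus p"; cases "p_plus p"; auto)+
  show "0 < pm" "pm \<le> pp" "pp \<le> 1"
    using p assms(2) by (auto simp: m q)
  have "AE x in lebesgue. ereal (p x) \<le> p_plus p"
    unfolding p_plus_def by (rule esssup_AE)
  moreover have "AE x in lebesgue. - ereal (p x) \<le> - p_minus p"
    unfolding p_minus_def using esssup_AE[of "\<lambda>x. - ereal (p x)" lebesgue] by simp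
  ultimately show "AE x in lebesgue. pm \<le> p x \<and> p x \<le> pp"
    by eventually_elim (auto simp: m q)
qed

lemma ennreal_rpow_lower:
  assumes "ennreal t \<le> u" and "0 \<le> t" and "0 \<le> a"
  shows "ennreal (t powr a) \<le> ennreal_rpow u a"
proof (cases "u = \<infinity>")
  case False
  then have "t \<le> enn2real u"
    using assms by (cases u) auto
  with False assms show ?thesis
    by (auto simp: ennreal_rpow_def intro!: ennreal_leI powr_mono2)
qed (simp add: ennreal_rpow_def)

lemma ennreal_rpow_divide_le:
  assumes "1 \<le> s" and "0 < b" and "b \<le> a"
  shows "ennreal_rpow (u / ennreal s) a \<le> ennreal (s powr - b) * ennreal_rpow u a"
proof (cases u)
  case (real x)
  have "(x / s) powr a = s powr - a * x powr a"
    using assms real by (simp add: powr_divide powr_minus field_simps)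
  also have "\<dots> \<le> s powr - b * x powr a"
    using assms by (intro mult_right_mono powr_mono) auto
  finally show ?thesis
    using real assms
    by (simp add: ennreal_rpow_def divide_ennreal ennreal_mult[symmetric] ennreal_leI)
next
  case top
  then show ?thesis
    using assms by (simp add: ennreal_rpow_def ennreal_mult_top)
qed

lemma measurable_ennreal_rpow [measurable]:
  assumes [measurable]: "M \<in> borel_measurable L" "p \<in> borel_measurable L"
  shows "(\<lambda>x. ennreal_rpow (M x) (p x)) \<in> borel_measurable L"
  unfolding ennreal_rpow_def by measurable

text \<open>This makes the set behind \<open>Lp_norm\<close> nonempty, so that its infimum is
  meaningful and an admissible scaling is at hand.\<close>

lemma Lp_modular_scaled_le_1:
  fixes p :: "real^'n \<Rightarrow> real"
  assumes M: "M \<in> variable_Lp p" and [measurable]: "p \<in> borel_measurable lebesgue"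
    and pm: "0 < pm" "AE x in lebesgue. pm \<le> p x"
  obtains s where "0 < s" "Lp_modular p (\<lambda>x. M x / ennreal s) \<le> 1"
proof -
  have [measurable]: "M \<in> borel_measurable lebesgue" and fin: "Lp_modular p M < \<infinity>"
    using M by (auto simp: variable_Lp_def)
  obtain K where K: "0 \<le> K" "Lp_modular p M = ennreal K"
    using fin by (cases "Lp_modular p M") auto
  \<comment> \<open>Division by some \<open>s \<ge> 1\<close> shrinks the modular at least by the
    factor \<open>s powr - pm\<close>. The second argument of \<open>max\<close> makes this factor
    absorb \<open>K\<close>.\<close>
  define s where "s = max 1 (K powr (1 / pm))"
  have s: "1 \<le> s" "K \<le> s powr pm"
  proof -
    show "1 \<le> s" by (simp add: s_def)
    have "K = (K powr (1 / pm)) powr pm"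
      using K pm by (simp add: powr_powr)
    also have "\<dots> \<le> s powr pm"
      using pm by (intro powr_mono2) (auto simp: s_def)
    finally show "K \<le> s powr pm" .
  qed
  have "Lp_modular p (\<lambda>x. M x / ennreal s)
      \<le> (\<integral>\<^sup>+x. ennreal (s powr - pm) * ennreal_rpow (M x) (p x) \<partial>lebesgue)"
    unfolding Lp_modular_def
  proof (rule nn_integral_mono_AE)
    show "AE x in lebesgue. ennreal_rpow (M x / ennreal s) (p x)
        \<le> ennreal (s powr - pm) * ennreal_rpow (M x) (p x)"
      using pm(2) by eventually_elim (use s pm in \<open>auto intro: ennreal_rpow_divide_le\<close>)
  qed
  also have "\<dots> = ennreal (s powr - pm) * Lp_modular p M"
    unfolding Lp_modular_def by (rule nn_integral_cmult) measurable
  also have "\<dots> = ennreal (s powr - pm * K)"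
    using K by (simp add: ennreal_mult)
  also have "\<dots> \<le> 1"
    using s by (simp add: powr_minus field_simps)
  finally show ?thesis
    using that[of s] s by simp
qed

text \<open>Testing the modular on \<open>y + B\<close> bounds \<open>g y\<close>, and \<open>g = g\<^sup>p g\<^sup>1\<^sup>-\<^sup>p\<close> trades this pointwise
  bound for integrability.\<close>

lemma nn_integral_le_if_le_maximal:
  fixes p :: "real^'n \<Rightarrow> real" and g :: "real^'n \<Rightarrow> real" and M :: "real^'n \<Rightarrow> ennreal"
  assumes [measurable]: "p \<in> borel_measurable lebesgue" "M \<in> borel_measurable lebesgue"
      "g \<in> borel_measurable lebesgue"
    and p: "0 < pm" "pm \<le> pp" "pp \<le> 1" "AE x in lebesgue. pm \<le> p x \<and> p x \<le> pp"
    and B: "B \<in> lmeasurable" "measure lebesgue B = \<beta>" "0 < \<beta>" "0 \<in> B"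
    and g: "\<And>y. 0 \<le> g y" "\<And>y z. z \<in> B \<Longrightarrow> ennreal (g y) \<le> M (y + z)"
    and s: "0 < s" "Lp_modular p (\<lambda>x. M x / ennreal s) \<le> 1"
  shows "(\<integral>\<^sup>+y. ennreal (g y) \<partial>lebesgue)
    \<le> ennreal (s * max (\<beta> powr (1 - 1 / pm)) (\<beta> powr (1 - 1 / pp)))"
proof -
  define W where "W = max (\<beta> powr (1 - 1 / pm)) (\<beta> powr (1 - 1 / pp))"
  define t where "t y = g y / s" for y
  have t0: "0 \<le> t y" for y
    using g(1) s by (simp add: t_def)
  have tM: "ennreal (t y) \<le> M (y + z) / ennreal s" if "z \<in> B" for y z
    using divide_right_mono_ennreal[OF g(2)[OF that, of y], of "ennreal s"] g(1)[of y] s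
    by (simp add: t_def divide_ennreal)
  have W0: "0 \<le> W" by (simp add: W_def le_max_iff_disj)
  \<comment> \<open>The premise holds with \<open>q = pm\<close> when \<open>t y \<ge> 1\<close> and
    with \<open>q = pp\<close> when \<open>t y\<close> lies below 1. Integrating the constant
    \<open>t y powr q\<close> over the translate of \<open>B\<close> stays below the modular, hence
    below 1.\<close>
  have test: "t y powr q \<le> 1 / \<beta>"
    if q: "AE x in lebesgue. t y powr q \<le> t y powr p x" for y q
  proof -
    have Bm: "(+) y ` B \<in> lmeasurable" "measure lebesgue ((+) y ` B) = \<beta>"
      using B by (simp_all add: measurable_translation measure_translation)
    have "ennreal (t y powr q * \<beta>) = (\<integral>\<^sup>+x. ennreal (t y powr q) * indicator ((+) y ` B) x \<partial>lebesgue)"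
      using Bm B by (simp add: nn_integral_cmult_indicator emeasure_eq_measure2 ennreal_mult fmeasurableD)
    also have "\<dots> \<le> (\<integral>\<^sup>+x. ennreal_rpow (M x / ennreal s) (p x) \<partial>lebesgue)"
    proof (rule nn_integral_mono_AE)
      show "AE x in lebesgue. ennreal (t y powr q) * indicator ((+) y ` B) x
          \<le> ennreal_rpow (M x / ennreal s) (p x)"
        using q p(4)
      proof eventually_elim
        case (elim x)
        show ?case
        proof (cases "x \<in> (+) y ` B")
          case True
          then have "ennreal (t y) \<le> M x / ennreal s"
            using tM by auto
          then have "ennreal (t y powr p x) \<le> ennreal_rpow (M x / ennreal s) (p x)"
            using elim p(1) t0 by (intro ennreal_rpow_lower) auto
          moreover have "ennreal (t y powr q) \<le> ennreal (t y powr p x)"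
            using elim by (intro ennreal_leI) auto
          ultimately have "ennreal (t y powr q) \<le> ennreal_rpow (M x / ennreal s) (p x)"
            by (rule order_trans[rotated])
          then show ?thesis
            using True by simp
        qed simp
      qed
    qed
    also have "\<dots> \<le> 1"
      using s by (simp add: Lp_modular_def)
    finally show ?thesis
      using B by (simp add: field_simps)
  qed
  \<comment> \<open>The test gives \<open>t y \<le> \<beta> powr (- 1 / q)\<close>; raising this to
    the power \<open>1 - q\<close> produces the exponent of the weight.\<close>
  have root: "t y powr (1 - q) \<le> \<beta> powr (1 - 1 / q)"
    if "t y powr q \<le> 1 / \<beta>" "0 < q" "q \<le> 1" for y q
  proof -
    have "t y = (t y powr q) powr (1 / q)"
      using that t0[of y] by (simp add: powr_powr)
    also have "\<dots> \<le> (1 / \<beta>) powr (1 / q)"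
      using that by (intro powr_mono2) auto
    also have "\<dots> = \<beta> powr (- 1 / q)"
      using B by (simp add: powr_divide powr_minus field_simps)
    finally have "t y powr (1 - q) \<le> (\<beta> powr (- 1 / q)) powr (1 - q)"
      using that t0 by (intro powr_mono2) auto
    also have "\<dots> = \<beta> powr (1 - 1 / q)"
    proof -
      have "- 1 / q * (1 - q) = 1 - 1 / q"
        using that by (simp add: field_simps)
      then show ?thesis by (simp only: powr_powr)
    qed
    finally show ?thesis .
  qed
  have "AE y in lebesgue. ennreal (t y) \<le> ennreal W * ennreal_rpow (M y / ennreal s) (p y)"
    using p(4)
  proof eventually_elim
    case (elim y)
    show ?case
    proof (cases "t y = 0")
      case False
      then have ty: "0 < t y" using t0[of y] by simp
      \<comment> \<open>The origin of the maximum in \<open>W\<close>: a base of at least 1 has its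
        largest power at the smallest exponent \<open>pm\<close>, a smaller base at the largest
        exponent \<open>pp\<close>.\<close>
      have "t y powr (1 - p y) \<le> W"
      proof (cases "1 \<le> t y")
        case True
        have "t y powr pm \<le> 1 / \<beta>"
        proof (rule test)
          show "AE x in lebesgue. t y powr pm \<le> t y powr p x"
            using p(4) by eventually_elim (use True in \<open>auto intro: powr_mono\<close>)
        qed
        then have "t y powr (1 - pm) \<le> W"
          using root[of y pm] p by (auto simp: W_def)
        moreover have "t y powr (1 - p y) \<le> t y powr (1 - pm)"
          using True elim by (intro powr_mono) auto
        ultimately show ?thesis by linarith
      next
        case False
        have "t y powr pp \<le> 1 / \<beta>"
        proof (rule test)
          show "AE x in lebesgue. t y powr pp \<le> t y powr p x"
            using p(4) by eventually_elim (use False ty in \<open>auto intro: powr_mono'\<close>)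
        qed
        then have "t y powr (1 - pp) \<le> W"
          using root[of y pp] p by (auto simp: W_def)
        moreover have "t y powr (1 - p y) \<le> t y powr (1 - pp)"
          using False elim ty by (intro powr_mono') auto
        ultimately show ?thesis by linarith
      qed
      moreover have "t y = t y powr (1 - p y) * t y powr p y"
        using ty by (simp add: powr_add[symmetric])
      ultimately have "t y \<le> W * t y powr p y"
        by (metis mult_right_mono powr_ge_zero)
      then have "ennreal (t y) \<le> ennreal W * ennreal (t y powr p y)"
        using W0 by (simp add: ennreal_mult[symmetric] ennreal_leI)
      \<comment> \<open>The point 0 of \<open>B\<close> compares \<open>t y\<close> with the maximal
        function at \<open>y\<close> itself, which is what the modular integrates.\<close>
      also have "\<dots> \<le> ennreal W * ennreal_rpow (M y / ennreal s) (p y)"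
        using tM[OF B(4), of y] t0[of y] elim p(1) by (intro mult_left_mono ennreal_rpow_lower) auto
      finally show ?thesis .
    qed simp
  qed
  then have "(\<integral>\<^sup>+y. ennreal (t y) \<partial>lebesgue)
      \<le> (\<integral>\<^sup>+y. ennreal W * ennreal_rpow (M y / ennreal s) (p y) \<partial>lebesgue)"
    by (rule nn_integral_mono_AE)
  also have "\<dots> = ennreal W * Lp_modular p (\<lambda>x. M x / ennreal s)"
    unfolding Lp_modular_def by (rule nn_integral_cmult) measurable
  also have "\<dots> \<le> ennreal W * 1"
    using s by (intro mult_left_mono) auto
  finally have *: "(\<integral>\<^sup>+y. ennreal (t y) \<partial>lebesgue) \<le> ennreal W"
    by simp
  have "(\<integral>\<^sup>+y. ennreal (g y) \<partial>lebesgue) = (\<integral>\<^sup>+y. ennreal s * ennreal (t y) \<partial>lebesgue)"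
    using s t0 by (intro nn_integral_cong) (simp add: t_def ennreal_mult[symmetric])
  also have "\<dots> = ennreal s * (\<integral>\<^sup>+y. ennreal (t y) \<partial>lebesgue)"
    unfolding t_def by (rule nn_integral_cmult) measurable
  also have "\<dots> \<le> ennreal s * ennreal W"
    by (intro mult_left_mono *) simp
  finally show ?thesis
    using s W0 by (simp add: W_def ennreal_mult[symmetric])
qed

section \<open>Schwartz functions\<close>

abbreviation partial :: "'n \<Rightarrow> (real^'n \<Rightarrow> complex) \<Rightarrow> real^'n \<Rightarrow> complex" where
  "partial i f \<equiv> \<lambda>x. frechet_derivative f (at x) (axis i 1)"

lemma partials_append: "partials is (partials js f) = partials (is @ js) f"
  by (induction "is") auto

lemma partial_eqI:
  assumes "\<And>x. (f has_derivative D x) (at x)"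
  shows "partial i f = (\<lambda>x. D x (axis i 1))"
  using frechet_derivative_at[OF assms] by metis

lemma has_derivative_partials:
  fixes f :: "real^'n \<Rightarrow> complex"
  assumes "f differentiable (at x)"
  shows "(f has_derivative (\<lambda>v. \<Sum>i\<in>UNIV. (v $ i) *\<^sub>R partial i f x)) (at x)"
proof -
  have d: "(f has_derivative frechet_derivative f (at x)) (at x)"
    using assms frechet_derivative_works by blast
  interpret bounded_linear "frechet_derivative f (at x)"
    using d by (rule has_derivative_bounded_linear)
  have "frechet_derivative f (at x) v = (\<Sum>i\<in>UNIV. (v $ i) *\<^sub>R partial i f x)" for v
  proof -
    have "(\<Sum>i\<in>UNIV. (v $ i) *\<^sub>R axis i 1) = v"
      using basis_expansion[of v] by (simp add: scalar_mult_eq_scaleR)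
    from arg_cong[OF this, of "frechet_derivative f (at x)"] show ?thesis
      by (simp add: sum scaleR)
  qed
  then have "frechet_derivative f (at x) = (\<lambda>v. \<Sum>i\<in>UNIV. (v $ i) *\<^sub>R partial i f x)"
    by (rule ext)
  with d show ?thesis by metis
qed

text \<open>Membership is shown by exhibiting a family closed under first partial derivatives, so
  that no formula for iterated derivatives is required and decay is checked without
  derivatives.\<close>

lemma schwartz_coinduct:
  fixes \<phi> :: "real^'n \<Rightarrow> complex"
  assumes "\<phi> \<in> F"
    and "\<And>f x. f \<in> F \<Longrightarrow> f differentiable (at x)"
    and "\<And>f i. f \<in> F \<Longrightarrow> partial i f \<in> F"
    and "\<And>f m. f \<in> F \<Longrightarrow> \<exists>C. \<forall>x. norm x ^ m * cmod (f x) \<le> C"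
  shows "\<phi> \<in> schwartz"
proof -
  have "partials is \<phi> \<in> F" for "is"
    by (induction "is") (auto intro: assms)
  then show ?thesis
    using assms(2,4) by (fastforce simp: schwartz_def smooth_fun_def bdd_above_def)
qed

lemma schwartz_differentiable: "\<phi> \<in> schwartz \<Longrightarrow> partials is \<phi> differentiable (at x)"
  by (simp add: schwartz_def smooth_fun_def)

lemma schwartz_partials: "\<phi> \<in> schwartz \<Longrightarrow> partials is \<phi> \<in> schwartz"
  by (simp add: schwartz_def smooth_fun_def partials_append)

lemma schwartz_partial: "\<phi> \<in> schwartz \<Longrightarrow> partial i \<phi> \<in> schwartz"
  using schwartz_partials[of \<phi> "[i]"] by simp

lemma schwartz_has_derivative:
  "\<phi> \<in> schwartz \<Longrightarrow> (\<phi> has_derivative (\<lambda>v. \<Sum>i\<in>UNIV. (v $ i) *\<^sub>R partial i \<phi> x)) (at x)"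
  using has_derivative_partials schwartz_differentiable[of \<phi> "[]"] by auto

lemma schwartz_continuous: "\<phi> \<in> schwartz \<Longrightarrow> continuous_on UNIV \<phi>"
  using schwartz_differentiable[of \<phi> "[]"]
  by (simp add: continuous_on_eq_continuous_within differentiable_imp_continuous_within)

lemma schwartz_measurable: "\<phi> \<in> schwartz \<Longrightarrow> \<phi> \<in> borel_measurable borel"
  by (intro borel_measurable_continuous_onI schwartz_continuous)

lemma schwartz_seminorm_upper:
  "\<phi> \<in> schwartz \<Longrightarrow> norm x ^ m * cmod (partials is \<phi> x) \<le> schwartz_seminorm m is \<phi>"
  unfolding schwartz_seminorm_def by (rule cSUP_upper) (auto simp: schwartz_def)

lemma schwartz_seminorm_nonneg: "\<phi> \<in> schwartz \<Longrightarrow> 0 \<le> schwartz_seminorm m is \<phi>"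
  by (rule order_trans[OF _ schwartz_seminorm_upper[where x=0]]) auto

lemma schwartz_seminorm_least:
  "(\<And>x. norm x ^ m * cmod (partials is \<phi> x) \<le> C) \<Longrightarrow> schwartz_seminorm m is \<phi> \<le> C"
  unfolding schwartz_seminorm_def by (rule cSUP_least) auto

text \<open>The weight \<open>1 + norm x\<close> never vanishes and is submultiplicative under
  translation (\<open>one_plus_norm_power_le\<close>), so it can be divided by and moved between
  \<open>x\<close> and \<open>x - y\<close>.\<close>

definition rapidly_decreasing :: "('a::real_normed_vector \<Rightarrow> 'b::real_normed_vector) \<Rightarrow> bool" where
  "rapidly_decreasing f \<longleftrightarrow> (\<forall>m. \<exists>C. \<forall>x. (1 + norm x) ^ m * norm (f x) \<le> C)"

lemma rapidly_decreasingE: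
  assumes "rapidly_decreasing f"
  obtains C where "0 < C" "\<And>x. (1 + norm x) ^ m * norm (f x) \<le> C"
proof -
  obtain C where "\<And>x. (1 + norm x) ^ m * norm (f x) \<le> C"
    using assms unfolding rapidly_decreasing_def by blast
  then show ?thesis
    using that[of "max C 1"] by (metis le_max_iff_disj max.strict_coboundedI2 zero_less_one)
qed

lemma rapidly_decreasingI:
  assumes "\<And>m. \<exists>C. \<forall>x. norm x ^ m * norm (f x) \<le> C"
  shows "rapidly_decreasing f"
  unfolding rapidly_decreasing_def
proof
  fix m
  obtain C where C: "\<And>x. norm x ^ m * norm (f x) \<le> C" using assms by blast
  obtain D where D: "\<And>x. norm (f x) \<le> D" using assms[of 0] by auto
  have "(1 + norm x) ^ m * norm (f x) \<le> 2 ^ m * (C + D)" for x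
  proof -
    have "(1 + norm x) ^ m \<le> 2 ^ m * (norm x ^ m + 1)"
    proof (cases "norm x \<le> 1")
      case True
      then have "(1 + norm x) ^ m \<le> 2 ^ m" by (intro power_mono) auto
      also have "\<dots> \<le> 2 ^ m * (norm x ^ m + 1)" by simp
      finally show ?thesis .
    next
      case False
      then have "(1 + norm x) ^ m \<le> (2 * norm x) ^ m" by (intro power_mono) auto
      also have "\<dots> = 2 ^ m * norm x ^ m" by (rule power_mult_distrib)
      also have "\<dots> \<le> 2 ^ m * (norm x ^ m + 1)" by simp
      finally show ?thesis .
    qed
    then have "(1 + norm x) ^ m * norm (f x) \<le> 2 ^ m * (norm x ^ m + 1) * norm (f x)"
      by (intro mult_right_mono) auto
    also have "\<dots> = 2 ^ m * (norm x ^ m * norm (f x) + norm (f x))"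
      by (simp add: algebra_simps)
    also have "\<dots> \<le> 2 ^ m * (C + D)"
      using C[of x] D[of x] by (intro mult_left_mono add_mono) auto
    finally show ?thesis .
  qed
  then show "\<exists>C. \<forall>x. (1 + norm x) ^ m * norm (f x) \<le> C" by blast
qed

lemma schwartz_rapidly_decreasing:
  assumes "\<phi> \<in> schwartz" shows "rapidly_decreasing (partials is \<phi>)"
proof (rule rapidly_decreasingI)
  fix m show "\<exists>C. \<forall>x. norm x ^ m * norm (partials is \<phi> x) \<le> C"
    using schwartz_seminorm_upper[OF assms] by blast
qed

lemma schwartz_rapidly_decreasing0: "\<phi> \<in> schwartz \<Longrightarrow> rapidly_decreasing \<phi>"
  using schwartz_rapidly_decreasing[of \<phi> "[]"] by simp

lemma rapidly_decreasing_power_mult: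
  assumes "rapidly_decreasing f"
  shows "\<exists>C. \<forall>x. norm x ^ m * norm (f x) \<le> C"
proof -
  obtain C where C: "\<And>x. (1 + norm x) ^ m * norm (f x) \<le> C"
    using assms unfolding rapidly_decreasing_def by blast
  have "norm x ^ m * norm (f x) \<le> C" for x
    by (rule order_trans[OF _ C[of x]]) (intro mult_right_mono power_mono, auto)
  then show ?thesis by blast
qed

lemma one_plus_norm_power_le:
  "(1 + norm x) ^ m \<le> (1 + norm (x - y)) ^ m * (1 + norm y) ^ m"
proof -
  have "norm x \<le> norm (x - y) + norm y"
    by (metis diff_add_cancel norm_triangle_ineq)
  moreover have "(1 + norm (x - y)) * (1 + norm y) = 1 + norm (x - y) + norm y + norm (x - y) * norm y"
    by (simp add: algebra_simps)
  ultimately have "1 + norm x \<le> (1 + norm (x - y)) * (1 + norm y)"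
    using mult_nonneg_nonneg[OF norm_ge_zero norm_ge_zero, of "x - y" y] by linarith
  then have "(1 + norm x) ^ m \<le> ((1 + norm (x - y)) * (1 + norm y)) ^ m"
    by (intro power_mono) auto
  then show ?thesis by (simp add: power_mult_distrib)
qed

subsection \<open>Linear combinations, translates and coordinate multiples\<close>

lemma partials_add:
  assumes "f \<in> schwartz" "g \<in> schwartz"
  shows "partials is (\<lambda>x. f x + g x) = (\<lambda>x. partials is f x + partials is g x)"
proof (induction "is")
  case (Cons i "is")
  have "((\<lambda>x. partials is f x + partials is g x) has_derivative
      (\<lambda>v. frechet_derivative (partials is f) (at x) v + frechet_derivative (partials is g) (at x) v)) (at x)" for x
    by (intro has_derivative_add; simp add: frechet_derivative_works[symmetric] schwartz_differentiable assms)
  from partial_eqI[OF this] show ?case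
    by (simp add: Cons)
qed simp

lemma partials_cmult:
  assumes "f \<in> schwartz"
  shows "partials is (\<lambda>x. c * f x) = (\<lambda>x. c * partials is f x)"
proof (induction "is")
  case (Cons i "is")
  have "((\<lambda>x. c * partials is f x) has_derivative
      (\<lambda>v. c * frechet_derivative (partials is f) (at x) v)) (at x)" for x
    by (intro has_derivative_mult_right; simp add: frechet_derivative_works[symmetric] schwartz_differentiable assms)
  from partial_eqI[OF this] show ?case
    by (simp add: Cons)
qed simp

lemma partials_translate:
  assumes "f \<in> schwartz"
  shows "partials is (\<lambda>x. f (x - y)) = (\<lambda>x. partials is f (x - y))"
proof (induction "is")
  case (Cons i "is")
  have "((\<lambda>x. partials is f (x - y)) has_derivative
      (\<lambda>v. frechet_derivative (partials is f) (at (x - y)) v)) (at x)" for x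
  proof (rule has_derivative_compose[of "\<lambda>x. x - y" "\<lambda>v. v"])
    show "((\<lambda>x. x - y) has_derivative (\<lambda>v. v)) (at x)"
      by (auto intro!: derivative_eq_intros)
    show "(partials is f has_derivative frechet_derivative (partials is f) (at (x - y))) (at (x - y))"
      by (simp add: frechet_derivative_works[symmetric] schwartz_differentiable assms)
  qed
  from partial_eqI[OF this] show ?case
    by (simp add: Cons)
qed simp

lemma schwartz_add:
  assumes "f \<in> schwartz" "g \<in> schwartz" shows "(\<lambda>x. f x + g x) \<in> schwartz"
proof -
  have "\<exists>C. \<forall>x. norm x ^ m * cmod (partials is f x + partials is g x) \<le> C" for m "is"
  proof (intro exI allI)
    fix x
    have "norm x ^ m * cmod (partials is f x + partials is g x)
        \<le> norm x ^ m * (cmod (partials is f x) + cmod (partials is g x))"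
      by (intro mult_left_mono norm_triangle_ineq) auto
    also have "\<dots> \<le> schwartz_seminorm m is f + schwartz_seminorm m is g"
      using schwartz_seminorm_upper[OF assms(1), of x m "is"] schwartz_seminorm_upper[OF assms(2), of x m "is"]
      by (simp add: algebra_simps)
    finally show "norm x ^ m * cmod (partials is f x + partials is g x)
        \<le> schwartz_seminorm m is f + schwartz_seminorm m is g" .
  qed
  moreover have "(\<lambda>x. partials is f x + partials is g x) differentiable at x" for "is" x
    using assms by (intro differentiable_add schwartz_differentiable)
  ultimately show ?thesis
    unfolding schwartz_def smooth_fun_def bdd_above_def by (auto simp: partials_add assms)
qed

lemma schwartz_cmult:
  assumes "f \<in> schwartz" shows "(\<lambda>x. c * f x) \<in> schwartz"
proof -
  have "norm x ^ m * cmod (c * partials is f x) \<le> cmod c * schwartz_seminorm m is f" for m "is" x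
    using mult_left_mono[OF schwartz_seminorm_upper[OF assms, of x m "is"], of "cmod c"]
    by (simp add: norm_mult algebra_simps)
  moreover have "(\<lambda>x. c * partials is f x) differentiable at x" for "is" x
    using assms by (intro differentiable_mult schwartz_differentiable differentiable_const)
  ultimately show ?thesis
    unfolding schwartz_def smooth_fun_def bdd_above_def by (auto simp: partials_cmult assms)
qed

lemma schwartz_diff:
  "f \<in> schwartz \<Longrightarrow> g \<in> schwartz \<Longrightarrow> (\<lambda>x. f x - g x) \<in> schwartz"
  using schwartz_add[of f "\<lambda>x. (- 1) * g x"] schwartz_cmult[of g "- 1"] by simp

lemma partials_diff:
  "f \<in> schwartz \<Longrightarrow> g \<in> schwartz \<Longrightarrow>
    partials is (\<lambda>x. f x - g x) = (\<lambda>x. partials is f x - partials is g x)"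
  using partials_add[of f "\<lambda>x. (- 1) * g x" "is"] schwartz_cmult[of g "- 1"]
    partials_cmult[of g "is" "- 1"] by simp

lemma schwartz_zero: "(\<lambda>x. 0) \<in> schwartz"
  by (rule schwartz_coinduct[of _ "{\<lambda>x. 0}"]) auto

lemma schwartz_sum:
  "finite I \<Longrightarrow> (\<And>i. i \<in> I \<Longrightarrow> f i \<in> schwartz) \<Longrightarrow> (\<lambda>x. \<Sum>i\<in>I. f i x) \<in> schwartz"
  by (induction I rule: finite_induct) (auto intro: schwartz_add schwartz_zero)

lemma schwartz_translate:
  assumes "f \<in> schwartz" shows "(\<lambda>x. f (x - y)) \<in> schwartz"
proof -
  have "\<exists>C. \<forall>x. norm x ^ m * cmod (partials is f (x - y)) \<le> C" for m "is"
  proof -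
    obtain C where C: "\<And>x. (1 + norm x) ^ m * norm (partials is f x) \<le> C"
      using rapidly_decreasingE[OF schwartz_rapidly_decreasing[OF assms]] by metis
    have "norm x ^ m * cmod (partials is f (x - y)) \<le> (1 + norm y) ^ m * C" for x
    proof -
      have "norm x ^ m * cmod (partials is f (x - y))
          \<le> ((1 + norm (x - y)) ^ m * (1 + norm y) ^ m) * cmod (partials is f (x - y))"
        by (intro mult_right_mono order_trans[OF _ one_plus_norm_power_le] power_mono) auto
      also have "\<dots> = (1 + norm y) ^ m * ((1 + norm (x - y)) ^ m * cmod (partials is f (x - y)))"
        by simp
      also have "\<dots> \<le> (1 + norm y) ^ m * C"
        by (intro mult_left_mono C) auto
      finally show ?thesis .
    qed
    then show ?thesis by blast
  qed
  moreover have "(\<lambda>x. partials is f (x - y)) differentiable at x" for "is" x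
    using schwartz_differentiable[OF assms]
    by (intro differentiable_compose[of "partials is f" "\<lambda>x. x - y"]) auto
  ultimately show ?thesis
    unfolding schwartz_def smooth_fun_def bdd_above_def by (auto simp: partials_translate assms)
qed

lemma schwartz_coord_mult:
  assumes "f \<in> schwartz" shows "(\<lambda>x. complex_of_real (x $ i) * f x) \<in> schwartz"
proof (rule schwartz_coinduct)
  \<comment> \<open>The summand \<open>g\<close> absorbs the term in which the derivative falls on
    the coordinate; this closes the family under partial derivatives.\<close>
  define F where "F = {(\<lambda>x. complex_of_real (x $ i) * f x + g x) | f g. f \<in> schwartz \<and> g \<in> schwartz}"
  show "(\<lambda>x. complex_of_real (x $ i) * f x) \<in> F"
    unfolding F_def using assms schwartz_zero by force
  fix h assume "h \<in> F"
  then obtain f g where fg: "f \<in> schwartz" "g \<in> schwartz"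
    and h: "h = (\<lambda>x. complex_of_real (x $ i) * f x + g x)"
    by (auto simp: F_def)
  have D: "(h has_derivative (\<lambda>v. complex_of_real (x $ i) * frechet_derivative f (at x) v
      + complex_of_real (v $ i) * f x + frechet_derivative g (at x) v)) (at x)" for x
    unfolding h
    using schwartz_differentiable[OF fg(1), of "[]"] schwartz_differentiable[OF fg(2), of "[]"]
    by (auto intro!: derivative_eq_intros bounded_linear.has_derivative[OF bounded_linear_of_real]
        bounded_linear.has_derivative[OF bounded_linear_vec_nth] simp: frechet_derivative_works)
  show "h differentiable (at x)" for x
    using D differentiable_def by blast
  show "partial j h \<in> F" for j
  proof -
    have "partial j h = (\<lambda>x. complex_of_real (x $ i) * partial j f x
        + (of_real (axis j 1 $ i) * f x + partial j g x))"
      using partial_eqI[OF D, of j] by (simp add: add.assoc)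
    then show ?thesis
      unfolding F_def using fg by (auto intro!: schwartz_add schwartz_cmult schwartz_partial)
  qed
  show "\<exists>C. \<forall>x. norm x ^ m * cmod (h x) \<le> C" for m
  proof (intro exI allI)
    fix x
    have "norm x ^ m * cmod (h x) \<le> norm x ^ m * (norm x * cmod (f x) + cmod (g x))"
      unfolding h
      by (intro mult_left_mono order_trans[OF norm_triangle_ineq] add_right_mono)
        (auto simp: norm_mult intro: mult_right_mono component_le_norm_cart)
    also have "\<dots> \<le> schwartz_seminorm (Suc m) [] f + schwartz_seminorm m [] g"
      using schwartz_seminorm_upper[OF fg(1), of x "Suc m" "[]"] schwartz_seminorm_upper[OF fg(2), of x m "[]"]
      by (simp add: algebra_simps)
    finally show "norm x ^ m * cmod (h x) \<le> schwartz_seminorm (Suc m) [] f + schwartz_seminorm m [] g" .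
  qed
qed

subsection \<open>Gaussians\<close>

text \<open>Polynomials times the Gaussian of the quadratic form given by \<open>M\<close>. The
  inductive form lets closure under derivatives and decay be proved by rule induction, without a
  representation of polynomials.\<close>

inductive_set gauss_span :: "real^'n^'n \<Rightarrow> (real^'n \<Rightarrow> complex) set" for M where
  base: "(\<lambda>x. of_real (exp (- ((M *v x) \<bullet> (M *v x))))) \<in> gauss_span M"
| coord: "f \<in> gauss_span M \<Longrightarrow> (\<lambda>x. of_real (x $ i) * f x) \<in> gauss_span M"
| scale: "f \<in> gauss_span M \<Longrightarrow> (\<lambda>x. c * f x) \<in> gauss_span M"
| add: "f \<in> gauss_span M \<Longrightarrow> g \<in> gauss_span M \<Longrightarrow> (\<lambda>x. f x + g x) \<in> gauss_span M"

lemma gauss_span_sum: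
  assumes "finite I" "\<And>i. i \<in> I \<Longrightarrow> f i \<in> gauss_span M"
  shows "(\<lambda>x. \<Sum>i\<in>I. f i x) \<in> gauss_span M"
  using assms
proof (induction I rule: finite_induct)
  case empty
  show ?case using scale[OF base, where c=0] by simp
qed (auto intro: add)

lemma gauss_span_partial:
  fixes M :: "real^'n^'n"
  assumes "f \<in> gauss_span M"
  shows "(\<forall>x. f differentiable (at x)) \<and> (\<forall>i. partial i f \<in> gauss_span M)"
  using assms
proof induction
  case base
  define e where "e = (\<lambda>x. complex_of_real (exp (- ((M *v x) \<bullet> (M *v x)))))"
  \<comment> \<open>The gradient of the exponent is -2 times the transpose of \<open>M\<close>
    applied to \<open>M *v x\<close>. Its components are linear in the coordinates, so the partial
    derivatives of \<open>e\<close> stay in the span.\<close>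
  have D: "(e has_derivative (\<lambda>v. of_real (- (2 * ((transpose M *v (M *v x)) \<bullet> v))) * e x)) (at x)" for x
  proof -
    have lin: "((*v) M has_derivative (*v) M) (at x)"
      by (rule bounded_linear_imp_has_derivative[OF matrix_vector_mul_bounded_linear])
    have "(e has_derivative (\<lambda>v. of_real (- ((M *v x) \<bullet> (M *v v) + (M *v v) \<bullet> (M *v x))
        * exp (- ((M *v x) \<bullet> (M *v x)))))) (at x)"
      unfolding e_def
      by (intro bounded_linear.has_derivative[OF bounded_linear_of_real] has_derivative_exp
          has_derivative_minus has_derivative_inner lin)
    moreover have a: "(M *v x) \<bullet> (M *v v) = (transpose M *v (M *v x)) \<bullet> v" for v
      by (simp add: dot_lmul_matrix)
    moreover have "(M *v v) \<bullet> (M *v x) = (transpose M *v (M *v x)) \<bullet> v" for v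
      by (subst inner_commute) (rule a)
    ultimately show ?thesis
      by (simp only: e_def of_real_mult[symmetric]) (simp only: mult_2 minus_add_distrib mult_minus_left)
  qed
  have "partial i e \<in> gauss_span M" for i
  proof -
    have "partial i e = (\<lambda>x. of_real (- (2 * ((transpose M ** M) *v x) $ i)) * e x)"
      by (subst partial_eqI[OF D]) (simp only: inner_axis matrix_vector_mul_assoc inner_real_def mult_1_right)
    moreover have "(\<lambda>x. of_real (- (2 * (G *v x) $ i)) * e x)
        = (\<lambda>x. \<Sum>j\<in>UNIV. (- 2 * of_real (G $ i $ j)) * (of_real (x $ j) * e x))" for G :: "real^'n^'n"
      by (simp add: fun_eq_iff matrix_vector_mult_def sum_distrib_left sum_distrib_right sum_negf
          mult.assoc mult.left_commute)
    ultimately have "partial i e = (\<lambda>x. \<Sum>j\<in>UNIV.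
        (- 2 * of_real ((transpose M ** M) $ i $ j)) * (of_real (x $ j) * e x))"
      by metis
    then show ?thesis
      using gauss_span.base[of M, folded e_def]
      by (simp only:) (intro gauss_span_sum gauss_span.scale gauss_span.coord finite)
  qed
  then show ?case
    using D differentiable_def unfolding e_def by blast
next
  case (coord f i)
  have D: "((\<lambda>x. complex_of_real (x $ i) * f x) has_derivative
      (\<lambda>v. complex_of_real (x $ i) * frechet_derivative f (at x) v + complex_of_real (v $ i) * f x)) (at x)" for x
    using coord
    by (auto intro!: derivative_eq_intros bounded_linear.has_derivative[OF bounded_linear_of_real]
        bounded_linear.has_derivative[OF bounded_linear_vec_nth] simp: frechet_derivative_works)
  show ?case
    using D differentiable_def coord
    by (auto simp: partial_eqI[OF D] intro!: gauss_span.intros)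
next
  case (scale f c)
  have D: "((\<lambda>x. c * f x) has_derivative (\<lambda>v. c * frechet_derivative f (at x) v)) (at x)" for x
    using scale by (auto intro!: derivative_eq_intros simp: frechet_derivative_works)
  show ?case
    using D differentiable_def scale
    by (auto simp: partial_eqI[OF D] intro!: gauss_span.intros)
next
  case (add f g)
  have D: "((\<lambda>x. f x + g x) has_derivative
      (\<lambda>v. frechet_derivative f (at x) v + frechet_derivative g (at x) v)) (at x)" for x
    using add by (auto intro!: derivative_eq_intros simp: frechet_derivative_works)
  show ?case
    using D differentiable_def add
    by (auto simp: partial_eqI[OF D] intro!: gauss_span.intros)
qed

text \<open>A single term of the exponential series bounds \<open>t ^ m\<close> by
  \<open>fact m * exp t\<close>, and \<open>t - t\<^sup>2\<close> never exceeds 1.\<close>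

lemma power_mult_exp_neg_square_bounded:
  fixes t :: real
  assumes "0 \<le> t"
  shows "t ^ m * exp (- t\<^sup>2) \<le> fact m * exp 1"
proof -
  have "t ^ m / fact m \<le> exp t"
  proof -
    have s: "summable (\<lambda>n. inverse (fact n) * t ^ n)" by (rule summable_exp)
    have "(\<Sum>n\<in>{m}. inverse (fact n) * t ^ n) \<le> (\<Sum>n. inverse (fact n) * t ^ n)"
      by (rule sum_le_suminf[OF s]) (use assms in auto)
    then show ?thesis by (simp add: exp_def field_simps)
  qed
  then have "t ^ m * exp (- t\<^sup>2) \<le> fact m * exp t * exp (- t\<^sup>2)"
    by (intro mult_right_mono) (auto simp: field_simps)
  also have "\<dots> = fact m * exp (t - t\<^sup>2)"
    by (simp add: exp_diff exp_minus field_simps)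
  also have "\<dots> \<le> fact m * exp 1"
  proof -
    have "0 \<le> (t - 1)\<^sup>2" by simp
    then have "t - t\<^sup>2 \<le> 1" using assms by (simp add: power2_eq_square algebra_simps)
    then show ?thesis by simp
  qed
  finally show ?thesis .
qed

lemma gauss_span_decay:
  assumes "f \<in> gauss_span M" and M: "invertible M"
  shows "\<exists>C. \<forall>x. norm x ^ m * cmod (f x) \<le> C"
  using assms(1)
\<comment> \<open>A coordinate factor costs one power of \<open>norm x\<close>, so its case calls
  the hypothesis at \<open>Suc m\<close>.\<close>
proof (induction arbitrary: m)
  case base
  obtain K where K: "0 < K" "\<And>x. norm (matrix_inv M *v x) \<le> norm x * K"
    using bounded_linear.pos_bounded[of "(*v) (matrix_inv M)"] by (auto simp: matrix_vector_mul_bounded_linear)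
  have "norm x ^ m * exp (- ((M *v x) \<bullet> (M *v x))) \<le> K ^ m * (fact m * exp 1)" for x
  proof -
    have "norm x \<le> norm (M *v x) * K"
      using K(2)[of "M *v x"] by (simp add: matrix_inv_vector_mult[OF M])
    then have "norm x ^ m * exp (- (norm (M *v x))\<^sup>2) \<le> (norm (M *v x) * K) ^ m * exp (- (norm (M *v x))\<^sup>2)"
      by (intro mult_right_mono power_mono) auto
    also have "\<dots> = K ^ m * (norm (M *v x) ^ m * exp (- (norm (M *v x))\<^sup>2))"
      by (simp add: power_mult_distrib)
    also have "\<dots> \<le> K ^ m * (fact m * exp 1)"
      using K(1) by (intro mult_left_mono power_mult_exp_neg_square_bounded) auto
    finally show ?thesis by (simp add: power2_norm_eq_inner)
  qed
  then show ?case by (auto simp: norm_of_real simp del: of_real_exp)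
next
  case (coord f i)
  obtain C where C: "\<And>x. norm x ^ Suc m * cmod (f x) \<le> C" using coord.IH by blast
  have "norm x ^ m * cmod (of_real (x $ i) * f x) \<le> C" for x
  proof -
    have "\<bar>x $ i\<bar> * (norm x ^ m * cmod (f x)) \<le> norm x * (norm x ^ m * cmod (f x))"
      by (intro mult_right_mono component_le_norm_cart) auto
    then show ?thesis using C[of x] by (simp add: norm_mult algebra_simps)
  qed
  then show ?case by blast
next
  case (scale f c)
  obtain C where C: "\<And>x. norm x ^ m * cmod (f x) \<le> C" using scale.IH by blast
  have "norm x ^ m * cmod (c * f x) \<le> cmod c * C" for x
    using mult_left_mono[OF C[of x], of "cmod c"] by (simp add: norm_mult algebra_simps)
  then show ?case by blast
next
  case (add f g)
  obtain C D where C: "\<And>x. norm x ^ m * cmod (f x) \<le> C" "\<And>x. norm x ^ m * cmod (g x) \<le> D"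
    using add.IH by metis
  have "norm x ^ m * cmod (f x + g x) \<le> C + D" for x
  proof -
    have "norm x ^ m * cmod (f x + g x) \<le> norm x ^ m * (cmod (f x) + cmod (g x))"
      by (intro mult_left_mono norm_triangle_ineq) auto
    then show ?thesis using C[of x] by (simp add: algebra_simps)
  qed
  then show ?case by blast
qed

lemma schwartz_gaussian:
  fixes M :: "real^'n^'n"
  assumes "invertible M"
  shows "(\<lambda>x. complex_of_real (exp (- ((M *v x) \<bullet> (M *v x))))) \<in> schwartz"
  by (rule schwartz_coinduct[of _ "gauss_span M"])
    (use gauss_span_partial gauss_span_decay[OF _ assms] in \<open>auto intro: gauss_span.base\<close>)

subsection \<open>Integrability\<close>

text \<open>A point with \<open>j \<le> norm x \<le> j + 1\<close> lies in the ball of radius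
  \<open>1 + j\<close>, whose volume grows like the \<open>CARD('n)\<close>-th power of the radius.
  The exponent \<open>CARD('n) + 2\<close> leaves the convergent sum of inverse squares.\<close>

lemma integrable_one_plus_norm_power:
  "integrable lborel (\<lambda>x::real^'n. 1 / (1 + norm x) ^ (CARD('n) + 2))"
proof (rule integrableI_nonneg)
  let ?d = "CARD('n)"
  let ?V = "unit_ball_vol (real ?d)"
  have V: "0 \<le> ?V" by simp
  have pt: "ennreal (1 / (1 + norm x) ^ (?d + 2))
      \<le> (\<Sum>j. ennreal (1 / (1 + real j) ^ (?d + 2)) * indicator (cball 0 (1 + real j)) x)" for x :: "real^'n"
  proof -
    define j where "j = nat \<lfloor>norm x\<rfloor>"
    have j: "real j \<le> norm x" "norm x \<le> 1 + real j"
      unfolding j_def by (auto simp: le_nat_floor) linarith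
    have "ennreal (1 / (1 + norm x) ^ (?d + 2)) \<le> ennreal (1 / (1 + real j) ^ (?d + 2)) * indicator (cball 0 (1 + real j)) x"
    proof -
      have "1 / (1 + norm x) ^ (?d + 2) \<le> 1 / (1 + real j) ^ (?d + 2)"
        using j by (intro divide_left_mono power_mono mult_pos_pos zero_less_power) auto
      moreover have "x \<in> cball 0 (1 + real j)"
        using j by simp
      ultimately show ?thesis
        by (simp only: indicator_simps mult_1_right ennreal_leI)
    qed
    also have "\<dots> \<le> (\<Sum>j. ennreal (1 / (1 + real j) ^ (?d + 2)) * indicator (cball 0 (1 + real j)) x)"
    proof -
      have "h j \<le> (\<Sum>j. h j)" for h :: "nat \<Rightarrow> ennreal"
        using sum_le_suminf[of h "{j}"] by simp
      then show ?thesis .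
    qed
    finally show ?thesis .
  qed
  have "(\<integral>\<^sup>+(x::real^'n). ennreal (1 / (1 + norm x) ^ (?d + 2)) \<partial>lborel)
      \<le> (\<integral>\<^sup>+(x::real^'n). (\<Sum>j. ennreal (1 / (1 + real j) ^ (?d + 2)) * indicator (cball 0 (1 + real j)) x) \<partial>lborel)"
    by (intro nn_integral_mono pt)
  also have "\<dots> = (\<Sum>j. \<integral>\<^sup>+(x::real^'n). ennreal (1 / (1 + real j) ^ (?d + 2)) * indicator (cball 0 (1 + real j)) x \<partial>lborel)"
    by (rule nn_integral_suminf) (simp add: borel_measurable_times_ennreal borel_measurable_indicator)
  also have "\<dots> = (\<Sum>j. ennreal (?V * (1 / (real (Suc j))\<^sup>2)))"
  proof (intro suminf_cong)
    fix j
    have "(\<integral>\<^sup>+(x::real^'n). ennreal (1 / (1 + real j) ^ (?d + 2)) * indicator (cball 0 (1 + real j)) x \<partial>lborel)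
        = ennreal (1 / (1 + real j) ^ (?d + 2)) * ennreal (?V * (1 + real j) ^ ?d)"
      by (simp add: nn_integral_cmult_indicator emeasure_cball)
    also have "\<dots> = ennreal (1 / (1 + real j) ^ (?d + 2) * (?V * (1 + real j) ^ ?d))"
      by (rule ennreal_mult[symmetric]) auto
    also have "1 / (1 + real j) ^ (?d + 2) * (?V * (1 + real j) ^ ?d) = ?V * (1 / (real (Suc j))\<^sup>2)"
    proof -
      have "1 / a ^ (?d + 2) * (?V * a ^ ?d) = ?V * (1 / a\<^sup>2)" if "0 < a" for a :: real
        using that by (simp add: power_add power2_eq_square)
      from this[of "1 + real j"] show ?thesis by (simp add: add.commute)
    qed
    finally show "(\<integral>\<^sup>+(x::real^'n). ennreal (1 / (1 + real j) ^ (?d + 2)) * indicator (cball 0 (1 + real j)) x \<partial>lborel)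
        = ennreal (?V * (1 / (real (Suc j))\<^sup>2))" .
  qed
  also have "\<dots> < \<infinity>"
  proof -
    have "summable (\<lambda>j. ?V * (1 / (real (Suc j))\<^sup>2))"
      using inverse_squares_sums by (intro summable_mult) (auto dest: sums_summable simp: add.commute)
    then show ?thesis
      by (subst suminf_ennreal2) (auto simp: ennreal_less_top)
  qed
  finally show "(\<integral>\<^sup>+(x::real^'n). ennreal (1 / (1 + norm x) ^ (?d + 2)) \<partial>lborel) < \<infinity>" .
qed auto

lemma integrable_if_decay:
  fixes f :: "real^'n \<Rightarrow> 'b::{banach, second_countable_topology}"
  assumes [measurable]: "f \<in> borel_measurable borel"
    and "\<And>x. (1 + norm x) ^ (CARD('n) + 2) * norm (f x) \<le> C"
  shows "integrable lborel f"
proof (rule Bochner_Integration.integrable_bound)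
  show "integrable lborel (\<lambda>x::real^'n. C * (1 / (1 + norm x) ^ (CARD('n) + 2)))"
    by (intro integrable_mult_right integrable_one_plus_norm_power)
  have "norm (f x) \<le> norm (C * (1 / (1 + norm x) ^ (CARD('n) + 2)))" for x
  proof -
    have "0 < (1 + norm x) ^ (CARD('n) + 2)"
      by (intro zero_less_power) (simp add: add_pos_nonneg)
    then have "norm (f x) \<le> C * (1 / (1 + norm x) ^ (CARD('n) + 2))"
      using assms(2)[of x] by (simp add: field_simps)
    then show ?thesis
      unfolding real_norm_def by (rule order_trans[OF _ abs_ge_self])
  qed
  then show "AE x in lborel. norm (f x) \<le> norm (C * (1 / (1 + norm x) ^ (CARD('n) + 2)))" by simp
qed simp

lemma integrable_rapidly_decreasing_mult:
  fixes f :: "real^'n \<Rightarrow> 'b::{banach, second_countable_topology, real_normed_algebra}"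
    and g :: "real^'n \<Rightarrow> 'b"
  assumes [measurable]: "f \<in> borel_measurable borel" "g \<in> borel_measurable borel"
    and f: "rapidly_decreasing f" and g: "\<And>x. norm (g x) \<le> D * (1 + norm x) ^ m"
  shows "integrable lborel (\<lambda>x. f x * g x)"
proof -
  obtain C where C: "0 < C" "\<And>x. (1 + norm x) ^ (CARD('n) + 2 + m) * norm (f x) \<le> C"
    using rapidly_decreasingE[OF f] by metis
  have D: "0 \<le> D" using order_trans[OF norm_ge_zero g[of 0]] by simp
  show ?thesis
  proof (rule integrable_if_decay)
    fix x
    have "(1 + norm x) ^ (CARD('n) + 2) * norm (f x * g x)
        \<le> (1 + norm x) ^ (CARD('n) + 2) * (norm (f x) * (D * (1 + norm x) ^ m))"
      by (intro mult_left_mono order_trans[OF norm_mult_ineq] mult_mono g) auto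
    also have "\<dots> = D * ((1 + norm x) ^ (CARD('n) + 2 + m) * norm (f x))"
      by (simp add: power_add algebra_simps)
    also have "\<dots> \<le> D * C" by (intro mult_left_mono C D)
    finally show "(1 + norm x) ^ (CARD('n) + 2) * norm (f x * g x) \<le> D * C" .
  qed measurable
qed

lemma schwartz_integrable: "\<phi> \<in> schwartz \<Longrightarrow> integrable lborel \<phi>"
  using integrable_rapidly_decreasing_mult[of \<phi> "\<lambda>_. 1" 1 0]
  by (simp add: schwartz_measurable schwartz_rapidly_decreasing0)

text \<open>Dominated convergence of the remainders divided by the increment. On the unit ball,
  which is convex, the mean value inequality bounds the difference quotient by \<open>g\<close>;
  together with the linear term this gives the dominating function \<open>2 * g\<close>.\<close>

lemma has_derivative_integral:
  fixes K :: "'a::euclidean_space \<Rightarrow> 'b \<Rightarrow> 'c::{banach, second_countable_topology}"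
  assumes K: "\<And>z. z \<in> ball x 1 \<Longrightarrow> integrable M (K z)"
    and D: "\<And>z y. z \<in> ball x 1 \<Longrightarrow> ((\<lambda>z. K z y) has_derivative D z y) (at z)"
    and bound: "\<And>z y v. z \<in> ball x 1 \<Longrightarrow> norm (D z y v) \<le> g y * norm v"
    and g: "integrable M g"
    and meas: "\<And>v. (\<lambda>y. D x y v) \<in> borel_measurable M"
  shows "((\<lambda>z. \<integral>y. K z y \<partial>M) has_derivative (\<lambda>v. \<integral>y. D x y v \<partial>M)) (at x)"
proof -
  have x: "x \<in> ball x 1" by simp
  have lin: "bounded_linear (D x y)" for y
    using has_derivative_bounded_linear[OF D[OF x]] .
  have intD: "integrable M (\<lambda>y. D x y v)" for v
  proof (rule Bochner_Integration.integrable_bound)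
    show "integrable M (\<lambda>y. g y * norm v)" using g by simp
    show "AE y in M. norm (D x y v) \<le> norm (g y * norm v)"
      using bound[OF x] by (intro AE_I2) (metis abs_ge_self order_trans real_norm_def)
  qed (rule meas)
  have bl: "bounded_linear (\<lambda>v. \<integral>y. D x y v \<partial>M)"
  proof (rule bounded_linear_intro[where K="\<integral>y. g y \<partial>M"])
    fix v w
    show "(\<integral>y. D x y (v + w) \<partial>M) = (\<integral>y. D x y v \<partial>M) + (\<integral>y. D x y w \<partial>M)"
      by (simp add: linear_add[OF bounded_linear.linear[OF lin]] intD)
    show "(\<integral>y. D x y (c *\<^sub>R v) \<partial>M) = c *\<^sub>R (\<integral>y. D x y v \<partial>M)" for c
      by (simp add: linear_scale[OF bounded_linear.linear[OF lin]])
    have "norm (\<integral>y. D x y v \<partial>M) \<le> (\<integral>y. g y * norm v \<partial>M)"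
      by (rule order_trans[OF integral_norm_bound], rule integral_mono)
        (use intD[of v] g bound[OF x] in auto)
    then show "norm (\<integral>y. D x y v \<partial>M) \<le> norm v * (\<integral>y. g y \<partial>M)"
      by (simp add: mult.commute)
  qed
  \<comment> \<open>Restricting to the ball keeps every test sequence where the hypotheses hold; the
    ball is open, so the restriction is dropped at the end.\<close>
  have "((\<lambda>z. \<integral>y. K z y \<partial>M) has_derivative (\<lambda>v. \<integral>y. D x y v \<partial>M)) (at x within ball x 1)"
    unfolding has_derivative_iff_norm
  proof (intro conjI bl, unfold tendsto_at_iff_sequentially, intro allI impI)
    fix X :: "nat \<Rightarrow> 'a"
    assume X: "\<forall>i. X i \<in> ball x 1 - {x}" "X \<longlonglongrightarrow> x"
    define s where "s n y = (K (X n) y - K x y - D x y (X n - x)) /\<^sub>R norm (X n - x)" for n y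
    have Xb: "X n \<in> ball x 1" "X n \<noteq> x" for n using X by auto
    have int_s: "(\<integral>y. s n y \<partial>M)
        = ((\<integral>y. K (X n) y \<partial>M) - (\<integral>y. K x y \<partial>M) - (\<integral>y. D x y (X n - x) \<partial>M)) /\<^sub>R norm (X n - x)" for n
      unfolding s_def using K[OF Xb(1)[of n]] K[OF x] intD[of "X n - x"] by simp
    have "(\<lambda>n. \<integral>y. s n y \<partial>M) \<longlonglongrightarrow> (\<integral>y. 0 \<partial>M)"
    proof (rule integral_dominated_convergence[where w="\<lambda>y. 2 * g y"])
      show "s n \<in> borel_measurable M" for n
        unfolding s_def using K[OF Xb(1)[of n]] K[OF x] intD[of "X n - x"] by simp
      show "integrable M (\<lambda>y. 2 * g y)" using g by simp
      show "AE y in M. (\<lambda>n. s n y) \<longlonglongrightarrow> 0"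
      proof (rule AE_I2)
        fix y
        have "((\<lambda>z. K z y) has_derivative D x y) (at x)" by (rule D[OF x])
        then have "((\<lambda>z. norm (K z y - K x y - D x y (z - x)) / norm (z - x)) \<longlongrightarrow> 0) (at x)"
          by (simp add: has_derivative_iff_norm)
        then have "(\<lambda>n. norm (K (X n) y - K x y - D x y (X n - x)) / norm (X n - x)) \<longlonglongrightarrow> 0"
          using X by (auto simp: tendsto_at_iff_sequentially o_def)
        then have "(\<lambda>n. norm (s n y)) \<longlonglongrightarrow> 0"
          by (simp add: s_def divide_inverse mult.commute)
        then show "(\<lambda>n. s n y) \<longlonglongrightarrow> 0" by (rule tendsto_norm_zero_cancel)
      qed
      show "AE y in M. norm (s n y) \<le> 2 * g y" for n
      proof (rule AE_I2)
        fix y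
        have "norm (K (X n) y - K x y) \<le> g y * norm (X n - x)"
        proof (rule differentiable_bound[of "ball x 1" "\<lambda>z. K z y" "\<lambda>z. D z y"])
          show "((\<lambda>z. K z y) has_derivative D z y) (at z within ball x 1)" if "z \<in> ball x 1" for z
            using D[OF that] by (rule has_derivative_at_withinI)
          show "onorm (D z y) \<le> g y" if "z \<in> ball x 1" for z
            by (rule onorm_le) (use bound[OF that] in auto)
        qed (use Xb in auto)
        moreover have "norm (D x y (X n - x)) \<le> g y * norm (X n - x)"
          by (rule bound[OF x])
        ultimately have "norm (K (X n) y - K x y - D x y (X n - x)) \<le> 2 * g y * norm (X n - x)"
          using norm_triangle_ineq4[of "K (X n) y - K x y" "D x y (X n - x)"] by linarith
        then show "norm (s n y) \<le> 2 * g y"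
        proof -
          assume "norm (K (X n) y - K x y - D x y (X n - x)) \<le> 2 * g y * norm (X n - x)"
          moreover have "norm (s n y) = norm (K (X n) y - K x y - D x y (X n - x)) / norm (X n - x)"
            unfolding s_def norm_scaleR by (simp add: divide_inverse mult.commute)
          ultimately show ?thesis
            using Xb(2)[of n] pos_divide_le_eq[of "norm (X n - x)"]
            by (metis zero_less_norm_iff right_minus_eq)
        qed
      qed
    qed simp
    then have "(\<lambda>n. norm (\<integral>y. s n y \<partial>M)) \<longlonglongrightarrow> 0"
      by (simp add: tendsto_norm_zero)
    then show "((\<lambda>z. norm ((\<integral>y. K z y \<partial>M) - (\<integral>y. K x y \<partial>M) - (\<integral>y. D x y (z - x) \<partial>M)) / norm (z - x)) \<circ> X) \<longlonglongrightarrow> 0"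
      by (simp add: int_s o_def divide_inverse mult.commute)
  qed
  then show ?thesis
    by (simp add: at_within_open[OF x])
qed

subsection \<open>Convolution with a rapidly decreasing weight\<close>

text \<open>For \<open>F\<close> the identity this is the convolution of \<open>h\<close> and \<open>w\<close>; simple functions \<open>F\<close> near the
  identity turn it into a finite linear combination of translates of \<open>w\<close>.\<close>

definition conv_along :: "(real^'n \<Rightarrow> complex) \<Rightarrow> (real^'n \<Rightarrow> real^'n) \<Rightarrow> (real^'n \<Rightarrow> complex) \<Rightarrow>
    real^'n \<Rightarrow> complex" where
  "conv_along h F w z = (LINT y|lborel. h y * w (z - F y))"

lemma norm_sum_component_scaleR_le:
  fixes a :: "'n::finite \<Rightarrow> complex"
  shows "norm (\<Sum>i\<in>UNIV. (v $ i) *\<^sub>R a i) \<le> (\<Sum>i\<in>UNIV. norm (a i)) * norm (v :: real^'n)"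
proof -
  have "norm (\<Sum>i\<in>UNIV. (v $ i) *\<^sub>R a i) \<le> (\<Sum>i\<in>UNIV. norm v * norm (a i))"
    by (intro order_trans[OF norm_sum] sum_mono)
      (auto intro: mult_right_mono component_le_norm_cart)
  then show ?thesis
    by (simp add: sum_distrib_left mult.commute)
qed

text \<open>The bound on \<open>F\<close> holds for the identity and for the simple functions that
  \<open>borel_measurable_implies_sequence_metric\<close> supplies around 0. It makes the decay
  estimates uniform along that approximation.\<close>

locale conv_weight =
  fixes h :: "real^'n \<Rightarrow> complex" and F :: "real^'n \<Rightarrow> real^'n"
  assumes h [measurable]: "h \<in> borel_measurable borel" and h_decay: "rapidly_decreasing h"
    and F [measurable]: "F \<in> borel_measurable borel" and F_le: "\<And>y. norm (F y) \<le> 2 * norm y"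
begin

lemma integrable_conv_along:
  assumes "w \<in> schwartz" shows "integrable lborel (\<lambda>y. h y * w (z - F y))"
proof -
  have [measurable]: "w \<in> borel_measurable borel" by (rule schwartz_measurable[OF assms])
  obtain C where "\<And>x. norm (w x) \<le> C"
    using rapidly_decreasing_power_mult[OF schwartz_rapidly_decreasing0[OF assms], of 0] by auto
  then show ?thesis
    by (intro integrable_rapidly_decreasing_mult[where D=C and m=0] h_decay) auto
qed

lemma has_derivative_conv_along:
  assumes w: "w \<in> schwartz"
  shows "(conv_along h F w has_derivative
    (\<lambda>v. LINT y|lborel. h y * (\<Sum>i\<in>UNIV. (v $ i) *\<^sub>R partial i w (z - F y)))) (at z)"
proof -
  have "\<exists>C. \<forall>x. norm (partial i w x) \<le> C" for i
    using rapidly_decreasing_power_mult[OF schwartz_rapidly_decreasing0[OF schwartz_partial[OF w]], of 0] by simp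
  then obtain C where C: "\<And>i x. norm (partial i w x) \<le> C i" by metis
  show ?thesis
    unfolding conv_along_def
  proof (rule has_derivative_integral)
  show "integrable lborel (\<lambda>y. h y * w (z - F y))" for z
    by (rule integrable_conv_along[OF w])
  show "((\<lambda>z. h y * w (z - F y)) has_derivative
      (\<lambda>v. h y * (\<Sum>i\<in>UNIV. (v $ i) *\<^sub>R partial i w (z - F y)))) (at z)" for z y
    by (intro has_derivative_mult_right has_derivative_compose[of "\<lambda>x. x - F y" "\<lambda>v. v" z, OF _ schwartz_has_derivative[OF w]])
      (auto intro!: derivative_eq_intros)
  show "norm (h y * (\<Sum>i\<in>UNIV. (v $ i) *\<^sub>R partial i w (z - F y))) \<le> (norm (h y) * (\<Sum>i\<in>UNIV. C i)) * norm v"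
    for z y v
  proof -
    have "norm (\<Sum>i\<in>UNIV. (v $ i) *\<^sub>R partial i w (z - F y)) \<le> (\<Sum>i\<in>UNIV. C i) * norm v"
      by (rule order_trans[OF norm_sum_component_scaleR_le]) (intro mult_right_mono sum_mono C, simp)
    then show ?thesis
      by (simp add: norm_mult mult.assoc mult_left_mono)
  qed
  show "integrable lborel (\<lambda>y. norm (h y) * (\<Sum>i\<in>UNIV. C i))"
    using integrable_rapidly_decreasing_mult[OF h, of "\<lambda>_. 1" 1 0] h_decay by simp
  show "(\<lambda>y. h y * (\<Sum>i\<in>UNIV. (v $ i) *\<^sub>R partial i w (z - F y))) \<in> borel_measurable lborel" for v
  proof -
    have [measurable]: "partial i w \<in> borel_measurable borel" for i
      by (rule schwartz_measurable[OF schwartz_partial[OF w]])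
    show ?thesis by measurable
  qed
  qed
qed

lemma partial_conv_along:
  assumes "w \<in> schwartz"
  shows "partial i (conv_along h F w) = conv_along h F (partial i w)"
proof -
  have "(\<Sum>j\<in>UNIV. (axis i 1 $ j) *\<^sub>R a j) = a i" for a :: "'n \<Rightarrow> complex"
    by (simp add: axis_def if_distrib[where f="\<lambda>c. c *\<^sub>R _"] cong: if_cong)
  then show ?thesis
    using partial_eqI[OF has_derivative_conv_along[OF assms], of i]
    by (simp add: conv_along_def[abs_def])
qed

lemma partials_conv_along:
  "w \<in> schwartz \<Longrightarrow> partials is (conv_along h F w) = conv_along h F (partials is w)"
  by (induction "is") (simp_all add: partial_conv_along schwartz_partials)

text \<open>Derivatives fall on \<open>w\<close> alone, so the image of the Schwartz space is a
  closed family. For decay, the weight at \<open>z\<close> splits into one at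
  \<open>z - F y\<close>, absorbed by the Schwartz factor, and one at \<open>F y\<close>, absorbed
  by \<open>h\<close>.\<close>

lemma schwartz_conv_along:
  assumes "w \<in> schwartz" shows "conv_along h F w \<in> schwartz"
proof (rule schwartz_coinduct[of _ "conv_along h F ` schwartz"])
  show "conv_along h F w \<in> conv_along h F ` schwartz" using assms by simp
  fix g assume "g \<in> conv_along h F ` schwartz"
  then obtain u where u: "u \<in> schwartz" and g: "g = conv_along h F u" by auto
  show "g differentiable (at x)" for x
    unfolding g using has_derivative_conv_along[OF u] differentiable_def by blast
  show "partial i g \<in> conv_along h F ` schwartz" for i
    unfolding g partial_conv_along[OF u] using schwartz_partial[OF u] by simp
  show "\<exists>C. \<forall>x. norm x ^ m * cmod (g x) \<le> C" for m
  proof -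
    obtain C where C: "0 < C" "\<And>x. (1 + norm x) ^ m * norm (u x) \<le> C"
      using rapidly_decreasingE[OF schwartz_rapidly_decreasing0[OF u]] by metis
    have int: "integrable lborel (\<lambda>y. norm (h y) * (2 ^ m * (1 + norm y) ^ m * C))"
    proof -
      have "integrable lborel (\<lambda>y. h y * complex_of_real (2 ^ m * (1 + norm y) ^ m * C))"
      proof (rule integrable_rapidly_decreasing_mult[OF _ _ h_decay])
        show "norm (complex_of_real (2 ^ m * (1 + norm y) ^ m * C)) \<le> (2 ^ m * C) * (1 + norm y) ^ m" for y
          unfolding norm_of_real using C(1) by (simp add: abs_mult)
      qed measurable
      from integrable_norm[OF this] show ?thesis
        unfolding norm_mult[of "h _"] norm_of_real using C(1) by (simp add: abs_mult)
    qed
    have "norm z ^ m * cmod (g z) \<le> (LINT y|lborel. norm (h y) * (2 ^ m * (1 + norm y) ^ m * C))" for z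
    proof -
      have pt: "norm z ^ m * norm (h y * u (z - F y)) \<le> norm (h y) * (2 ^ m * (1 + norm y) ^ m * C)" for y
      proof -
        have "(1 + norm (F y)) ^ m \<le> (2 * (1 + norm y)) ^ m"
          using F_le[of y] by (intro power_mono) auto
        then have F2: "(1 + norm (F y)) ^ m \<le> 2 ^ m * (1 + norm y) ^ m"
          by (simp only: power_mult_distrib)
        have "norm z ^ m \<le> (1 + norm (z - F y)) ^ m * (1 + norm (F y)) ^ m"
          by (rule order_trans[OF _ one_plus_norm_power_le]) (intro power_mono, auto)
        then have "norm z ^ m * norm (u (z - F y)) \<le> ((1 + norm (z - F y)) ^ m * (1 + norm (F y)) ^ m) * norm (u (z - F y))"
          by (rule mult_right_mono) simp
        also have "\<dots> = (1 + norm (F y)) ^ m * ((1 + norm (z - F y)) ^ m * norm (u (z - F y)))" by simp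
        also have "\<dots> \<le> (2 ^ m * (1 + norm y) ^ m) * C"
          by (intro mult_mono C F2) auto
        finally have "norm (h y) * (norm z ^ m * norm (u (z - F y))) \<le> norm (h y) * (2 ^ m * (1 + norm y) ^ m * C)"
          by (intro mult_left_mono) auto
        then show ?thesis by (simp add: norm_mult mult.left_commute)
      qed
      have "norm z ^ m * cmod (g z) \<le> norm z ^ m * (LINT y|lborel. norm (h y * u (z - F y)))"
        unfolding g conv_along_def by (intro mult_left_mono integral_norm_bound) auto
      also have "\<dots> = (LINT y|lborel. norm z ^ m * norm (h y * u (z - F y)))"
        by simp
      also have "\<dots> \<le> (LINT y|lborel. norm (h y) * (2 ^ m * (1 + norm y) ^ m * C))"
        using integrable_conv_along[OF u] by (intro integral_mono int pt) auto
      finally show ?thesis .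
    qed
    then show ?thesis by blast
  qed
qed

end

subsection \<open>Translation is Lipschitz in the Schwartz seminorms\<close>

text \<open>Mean value inequality along the segment from \<open>u\<close> to \<open>v\<close>.
  Points \<open>t\<close> of the segment satisfy \<open>norm t \<le> norm u + norm v\<close>, so the
  decay of the gradient at \<open>z - t\<close> passes to \<open>z\<close> at the price of a power
  of \<open>1 + norm u + norm v\<close>.\<close>

lemma schwartz_translate_diff_bound:
  assumes w: "w \<in> schwartz"
  obtains C where "0 \<le> C"
    "\<And>u v z. norm z ^ m * cmod (partials is w (z - u) - partials is w (z - v))
      \<le> C * norm (u - v) * (1 + norm u + norm v) ^ m"
proof -
  define g where "g = partials is w"
  have g: "g \<in> schwartz" unfolding g_def by (rule schwartz_partials[OF w])
  have "\<exists>C. \<forall>x. (1 + norm x) ^ m * norm (partial i g x) \<le> C" for i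
    using schwartz_rapidly_decreasing0[OF schwartz_partial[OF g]] unfolding rapidly_decreasing_def by blast
  then obtain C where C: "\<And>i x. (1 + norm x) ^ m * norm (partial i g x) \<le> C i" by metis
  have C0: "0 \<le> (\<Sum>i\<in>UNIV. C i)"
    by (intro sum_nonneg order_trans[OF _ C[where x=0]]) auto
  have "norm z ^ m * cmod (g (z - u) - g (z - v)) \<le> (\<Sum>i\<in>UNIV. C i) * norm (u - v) * (1 + norm u + norm v) ^ m"
    for u v z
  proof -
    \<comment> \<open>A bound for the gradient along the segment; its denominator cancels the weight
      in \<open>z\<close> at the end.\<close>
    define B where "B = (\<Sum>i\<in>UNIV. C i) * (1 + norm u + norm v) ^ m / (1 + norm z) ^ m"
    have zp: "0 < (1 + norm z) ^ m" by (intro zero_less_power) (simp add: add_pos_nonneg)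
    have "cmod (g (z - u) - g (z - v)) \<le> B * norm (u - v)"
    proof (rule differentiable_bound[of "closed_segment u v" "\<lambda>t. g (z - t)"
          "\<lambda>t x. \<Sum>i\<in>UNIV. ((- x) $ i) *\<^sub>R partial i g (z - t)"])
      fix t assume t: "t \<in> closed_segment u v"
      show "((\<lambda>t. g (z - t)) has_derivative (\<lambda>x. \<Sum>i\<in>UNIV. ((- x) $ i) *\<^sub>R partial i g (z - t))) (at t within closed_segment u v)"
      proof (rule has_derivative_at_withinI)
        have "((\<lambda>t. z - t) has_derivative (\<lambda>x. - x)) (at t)"
          by (auto intro!: derivative_eq_intros)
        from has_derivative_compose[OF this schwartz_has_derivative[OF g]]
        show "((\<lambda>t. g (z - t)) has_derivative (\<lambda>x. \<Sum>i\<in>UNIV. ((- x) $ i) *\<^sub>R partial i g (z - t))) (at t)" .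
      qed
      have tn: "norm t \<le> norm u + norm v"
      proof -
        have "closed_segment u v \<subseteq> cball 0 (norm u + norm v)"
          by (intro closed_segment_subset convex_cball) simp_all
        then show ?thesis using t by auto
      qed
      have "(\<Sum>i\<in>UNIV. norm (partial i g (z - t))) \<le> B"
      proof -
        have "(1 + norm z) ^ m * (\<Sum>i\<in>UNIV. norm (partial i g (z - t)))
            \<le> ((1 + norm (z - t)) ^ m * (1 + norm t) ^ m) * (\<Sum>i\<in>UNIV. norm (partial i g (z - t)))"
          by (intro mult_right_mono one_plus_norm_power_le sum_nonneg) auto
        also have "\<dots> = (1 + norm t) ^ m * (\<Sum>i\<in>UNIV. (1 + norm (z - t)) ^ m * norm (partial i g (z - t)))"
          by (simp only: sum_distrib_left[symmetric, of "(1 + norm (z - t)) ^ m"] mult_ac)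
        also have "\<dots> \<le> (1 + norm u + norm v) ^ m * (\<Sum>i\<in>UNIV. C i)"
          using tn by (intro mult_mono power_mono sum_mono C sum_nonneg) auto
        finally show ?thesis
          unfolding B_def using zp by (simp add: pos_le_divide_eq mult.commute)
      qed
      note B = this
      have "norm (\<Sum>i\<in>UNIV. ((- x) $ i) *\<^sub>R partial i g (z - t)) \<le> B * norm x" for x
        using norm_sum_component_scaleR_le[of "- x" "\<lambda>i. partial i g (z - t)"]
          mult_right_mono[OF B norm_ge_zero[of "- x"]] by (simp only: norm_minus_cancel)
      then show "onorm (\<lambda>x. \<Sum>i\<in>UNIV. ((- x) $ i) *\<^sub>R partial i g (z - t)) \<le> B"
        by (rule onorm_le)
    qed auto
    then have "norm z ^ m * cmod (g (z - u) - g (z - v)) \<le> (1 + norm z) ^ m * (B * norm (u - v))"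
      by (intro mult_mono power_mono) auto
    also have "\<dots> = (\<Sum>i\<in>UNIV. C i) * norm (u - v) * (1 + norm u + norm v) ^ m"
    proof -
      have "X * (S * Y / X * d) = S * d * Y" if "0 < X" for X S Y d :: real
        using that by simp
      from this[OF zp] show ?thesis unfolding B_def .
    qed
    finally show ?thesis .
  qed
  from that[OF C0 this[unfolded g_def]] show ?thesis .
qed

subsection \<open>Tempered distributions\<close>

lemma tempered_add:
  "f \<in> tempered \<Longrightarrow> \<phi> \<in> schwartz \<Longrightarrow> \<psi> \<in> schwartz \<Longrightarrow> f (\<lambda>x. \<phi> x + \<psi> x) = f \<phi> + f \<psi>"
  and tempered_cmult: "f \<in> tempered \<Longrightarrow> \<phi> \<in> schwartz \<Longrightarrow> f (\<lambda>x. c * \<phi> x) = c * f \<phi>"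
  by (auto simp: tempered_def)

lemma tempered_diff:
  assumes "f \<in> tempered" "\<phi> \<in> schwartz" "\<psi> \<in> schwartz"
  shows "f (\<lambda>x. \<phi> x - \<psi> x) = f \<phi> - f \<psi>"
  using tempered_add[OF assms(1,2) schwartz_cmult[OF assms(3), of "- 1"]]
    tempered_cmult[OF assms(1,3), of "- 1"] by simp

lemma tempered_sum:
  assumes "f \<in> tempered"
  shows "finite I \<Longrightarrow> (\<And>i. i \<in> I \<Longrightarrow> \<phi> i \<in> schwartz) \<Longrightarrow> f (\<lambda>x. \<Sum>i\<in>I. \<phi> i x) = (\<Sum>i\<in>I. f (\<phi> i))"
proof (induction I rule: finite_induct)
  case empty
  show ?case using tempered_cmult[OF assms schwartz_zero, of 0] by simp
next
  case (insert i I)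
  then show ?case
    using tempered_add[OF assms, of "\<phi> i" "\<lambda>x. \<Sum>i\<in>I. \<phi> i x"] schwartz_sum[of I \<phi>] by simp
qed

lemma schwartz_seminorm_triangle:
  assumes "f \<in> schwartz" "g \<in> schwartz"
  shows "schwartz_seminorm m is (\<lambda>x. f x + g x) \<le> schwartz_seminorm m is f + schwartz_seminorm m is g"
proof (rule schwartz_seminorm_least)
  fix x
  have "norm x ^ m * cmod (partials is f x + partials is g x)
      \<le> norm x ^ m * (cmod (partials is f x) + cmod (partials is g x))"
    by (intro mult_left_mono norm_triangle_ineq) auto
  then show "norm x ^ m * cmod (partials is (\<lambda>x. f x + g x) x)
      \<le> schwartz_seminorm m is f + schwartz_seminorm m is g"
    using schwartz_seminorm_upper[OF assms(1), of x m "is"] schwartz_seminorm_upper[OF assms(2), of x m "is"]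
    by (simp add: partials_add[OF assms] distrib_left)
qed

text \<open>The generating balls have arbitrary centres. Induction on how an open set is generated
  finds in it a ball around \<phi> for finitely many seminorms: a generator is recentred by the
  triangle inequality, an intersection unites the index sets and takes the smaller radius.\<close>

lemma schwartz_topology_nbhd:
  fixes S :: "(real^'n \<Rightarrow> complex) set set"
  defines "S \<equiv> {{\<psi> \<in> schwartz. schwartz_seminorm m is (\<lambda>x. \<psi> x - \<phi> x) < \<epsilon>} | m is \<phi> \<epsilon>. \<phi> \<in> schwartz \<and> 0 < \<epsilon>}"
  assumes "generate_topology_on S U" "\<phi> \<in> U" and \<phi>: "\<phi> \<in> schwartz"
  shows "\<exists>J \<delta>. finite J \<and> 0 < \<delta> \<and>
    (\<forall>\<psi>\<in>schwartz. (\<forall>(m, is)\<in>J. schwartz_seminorm m is (\<lambda>x. \<psi> x - \<phi> x) < \<delta>) \<longrightarrow> \<psi> \<in> U)"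
  using assms(2,3)
proof induction
  case Empty then show ?case by simp
next
  case (Int a b)
  then obtain J \<delta> J' \<delta>' where *: "finite J" "0 < \<delta>" "finite J'" "0 < \<delta>'"
    "\<forall>\<psi>\<in>schwartz. (\<forall>(m, is)\<in>J. schwartz_seminorm m is (\<lambda>x. \<psi> x - \<phi> x) < \<delta>) \<longrightarrow> \<psi> \<in> a"
    "\<forall>\<psi>\<in>schwartz. (\<forall>(m, is)\<in>J'. schwartz_seminorm m is (\<lambda>x. \<psi> x - \<phi> x) < \<delta>') \<longrightarrow> \<psi> \<in> b"
    by (auto 0 3)
  show ?case
    by (rule exI[of _ "J \<union> J'"], rule exI[of _ "min \<delta> \<delta>'"])
      (use * in \<open>simp add: ball_Un split_beta\<close>)
next
  case (UN K)
  then obtain k where "k \<in> K" "\<phi> \<in> k" by auto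
  with UN.IH[of k] show ?case by (meson Union_iff)
next
  case (Basis U)
  then obtain m "is" \<phi>' \<epsilon> where U: "U = {\<psi> \<in> schwartz. schwartz_seminorm m is (\<lambda>x. \<psi> x - \<phi>' x) < \<epsilon>}"
    and \<phi>': "\<phi>' \<in> schwartz" by (auto simp: S_def)
  define \<delta> where "\<delta> = \<epsilon> - schwartz_seminorm m is (\<lambda>x. \<phi> x - \<phi>' x)"
  have "0 < \<delta>" using Basis U by (simp add: \<delta>_def)
  moreover have "\<psi> \<in> U" if "\<psi> \<in> schwartz" "schwartz_seminorm m is (\<lambda>x. \<psi> x - \<phi> x) < \<delta>" for \<psi>
    using schwartz_seminorm_triangle[OF schwartz_diff[OF that(1) \<phi>] schwartz_diff[OF \<phi> \<phi>'], of m "is"] that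
    by (simp add: U \<delta>_def)
  ultimately show ?case
    by (intro exI[of _ "{(m, is)}"] exI[of _ \<delta>]) auto
qed

text \<open>Continuity at 0 makes \<open>f\<close> less than 1 in modulus on a ball for finitely
  many seminorms, and homogeneity turns this into an estimate. This is the quantitative form in
  which continuity of \<open>f\<close> is used from here on.\<close>

lemma tempered_bound:
  fixes f :: "(real^'n \<Rightarrow> complex) \<Rightarrow> complex"
  assumes f: "f \<in> tempered"
  obtains J :: "(nat \<times> 'n list) set" and C where "finite J" "0 < C"
    "\<And>\<phi>. \<phi> \<in> schwartz \<Longrightarrow> cmod (f \<phi>) \<le> C * (\<Sum>(m, is)\<in>J. schwartz_seminorm m is \<phi>)"
proof -
  let ?T = "schwartz_topology :: (real^'n \<Rightarrow> complex) topology"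
  let ?S = "{{\<psi> \<in> schwartz. schwartz_seminorm m is (\<lambda>x. \<psi> x - \<phi> x) < \<epsilon>} | m is \<phi> \<epsilon>.
    \<phi> \<in> (schwartz :: (real^'n \<Rightarrow> complex) set) \<and> 0 < \<epsilon>}"
  define U where "U = {\<psi> \<in> topspace ?T. f \<psi> \<in> ball 0 1}"
  have "openin ?T U"
    unfolding U_def
    by (rule openin_continuous_map_preimage[of _ euclidean]) (use f in \<open>auto simp: tempered_def\<close>)
  then have gU: "generate_topology_on ?S U"
    by (simp add: schwartz_topology_def openin_topology_generated_by_iff)
  have "schwartz_seminorm 0 [] (\<lambda>x::real^'n. 0 - 0) < 1"
    by (simp add: schwartz_seminorm_def)
  then have "(\<lambda>x. 0) \<in> \<Union>?S"
    using schwartz_zero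
    by (intro UnionI[of "{\<psi> \<in> schwartz. schwartz_seminorm 0 [] (\<lambda>x. \<psi> x - 0) < 1}"] CollectI
        exI[of _ "0::nat"] exI[of _ "[] :: 'n list"] exI[of _ "\<lambda>x::real^'n. 0::complex"] exI[of _ "1::real"]) simp_all
  then have "(\<lambda>x. 0) \<in> topspace ?T"
    by (simp add: schwartz_topology_def)
  moreover have "f (\<lambda>x. 0) = 0"
    using tempered_cmult[OF f schwartz_zero, of 0] by simp
  ultimately have "(\<lambda>x. 0) \<in> U" by (simp add: U_def)
  from schwartz_topology_nbhd[OF gU this schwartz_zero]
  obtain J :: "(nat \<times> 'n list) set" and \<delta> where J: "finite J" "0 < \<delta>"
    "\<forall>\<psi>\<in>schwartz. (\<forall>(m, is)\<in>J. schwartz_seminorm m is (\<lambda>x. \<psi> x - 0) < \<delta>) \<longrightarrow> \<psi> \<in> U"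
    by blast
  have "cmod (f \<phi>) \<le> 2 / \<delta> * (\<Sum>(m, is)\<in>J. schwartz_seminorm m is \<phi>)" if \<phi>: "\<phi> \<in> schwartz" for \<phi>
  proof -
    define \<Sigma> where "\<Sigma> = (\<Sum>(m, is)\<in>J. schwartz_seminorm m is \<phi>)"
    have \<Sigma>0: "0 \<le> \<Sigma>"
      unfolding \<Sigma>_def by (intro sum_nonneg) (auto simp: schwartz_seminorm_nonneg[OF \<phi>])
    have le: "cmod (f \<phi>) \<le> 2 / \<delta> * (\<Sigma> + e)" if e: "0 < e" for e
    proof -
      \<comment> \<open>Scaling by \<open>c\<close> puts \<phi> into the ball: the factor 2 gives
        strict inequality, and \<open>e\<close> keeps the denominator positive when all the
        seminorms vanish.\<close>
      define c where "c = \<delta> / (2 * (\<Sigma> + e))"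
      have c: "0 < c" using J(2) \<Sigma>0 e by (simp add: c_def)
      have "schwartz_seminorm m is (\<lambda>x. of_real c * \<phi> x - 0) < \<delta>" if mi: "(m, is) \<in> J" for m "is"
      proof -
        have "schwartz_seminorm m is \<phi> = (\<Sum>(m, is)\<in>{(m, is)}. schwartz_seminorm m is \<phi>)" by simp
        also have "\<dots> \<le> \<Sigma>"
          unfolding \<Sigma>_def using mi J(1) by (intro sum_mono2) (auto simp: schwartz_seminorm_nonneg[OF \<phi>])
        finally have s: "schwartz_seminorm m is \<phi> \<le> \<Sigma>" .
        have "schwartz_seminorm m is (\<lambda>x. of_real c * \<phi> x) \<le> c * schwartz_seminorm m is \<phi>"
        proof (rule schwartz_seminorm_least)
          fix x
          show "norm x ^ m * cmod (partials is (\<lambda>x. of_real c * \<phi> x) x) \<le> c * schwartz_seminorm m is \<phi>"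
            using mult_left_mono[OF schwartz_seminorm_upper[OF \<phi>, of x m "is"], of c] c
            by (simp add: partials_cmult[OF \<phi>] norm_mult mult.left_commute)
        qed
        also have "\<dots> \<le> c * \<Sigma>" using s c by simp
        also have "\<dots> < \<delta>"
          using J(2) \<Sigma>0 e by (simp add: c_def field_simps add_nonneg_pos)
        finally show ?thesis by simp
      qed
      then have "(\<lambda>x. of_real c * \<phi> x) \<in> U"
        using J(3) schwartz_cmult[OF \<phi>, of "of_real c"] by fastforce
      then have "c * cmod (f \<phi>) < 1"
        using c by (simp add: U_def tempered_cmult[OF f \<phi>] norm_mult)
      then have "cmod (f \<phi>) \<le> 1 / c" using c by (simp add: field_simps)
      then show ?thesis by (simp add: c_def)
    qed
    have "cmod (f \<phi>) \<le> 2 / \<delta> * \<Sigma> + e" if e: "0 < e" for e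
      using le[of "e * \<delta> / 2"] e J(2) by (simp add: field_simps)
    then show ?thesis
      unfolding \<Sigma>_def[symmetric] by (rule field_le_epsilon)
  qed
  then show ?thesis
    using that[of J "2 / \<delta>"] J by simp
qed

text \<open>The translate has argument \<open>z - y\<close>, that of \<open>dist_conv\<close> has
  \<open>y - z\<close>. For even \<open>w\<close>, such as the dilated Gaussians, this is the
  convolution of \<open>f\<close> with \<open>w\<close>.\<close>

definition pairing :: "((real^'n \<Rightarrow> complex) \<Rightarrow> complex) \<Rightarrow> (real^'n \<Rightarrow> complex) \<Rightarrow> real^'n \<Rightarrow> complex" where
  "pairing f w y = f (\<lambda>z. w (z - y))"

text \<open>Source of both the continuity and the polynomial growth of
  \<open>pairing f w\<close>.\<close>

lemma tempered_translate_diff_bound: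
  assumes f: "f \<in> tempered" and w: "w \<in> schwartz"
  obtains C m where "0 \<le> C"
    "\<And>u v. cmod (pairing f w u - pairing f w v) \<le> C * norm (u - v) * (1 + norm u + norm v) ^ m"
proof -
  obtain J C where J: "finite J" "0 < C"
    "\<And>\<phi>. \<phi> \<in> schwartz \<Longrightarrow> cmod (f \<phi>) \<le> C * (\<Sum>(m, is)\<in>J. schwartz_seminorm m is \<phi>)"
    using tempered_bound[OF f] by metis
  have "\<exists>D\<ge>0. \<forall>u v z. norm z ^ m * cmod (partials is w (z - u) - partials is w (z - v))
      \<le> D * norm (u - v) * (1 + norm u + norm v) ^ m" for m "is"
    using schwartz_translate_diff_bound[OF w] by metis
  then obtain D where D: "\<And>m is. 0 \<le> D m is"
    "\<And>m is u v z. norm z ^ m * cmod (partials is w (z - u) - partials is w (z - v))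
      \<le> D m is * norm (u - v) * (1 + norm u + norm v) ^ m"
    by metis
  \<comment> \<open>The highest power of the norm among the seminorms in \<open>J\<close>, so that
    one polynomial factor serves all of them.\<close>
  define k where "k = Max (insert 0 (fst ` J))"
  have k: "m \<le> k" if "(m, is) \<in> J" for m "is"
    unfolding k_def using that J(1) by (intro Max_ge) (auto simp: image_iff intro!: bexI[of _ "(m, is)"])
  have sn: "schwartz_seminorm m is (\<lambda>z. w (z - u) - w (z - v)) \<le> D m is * norm (u - v) * (1 + norm u + norm v) ^ k"
    if "(m, is) \<in> J" for m "is" u v
  proof (rule schwartz_seminorm_least)
    fix z
    have "norm z ^ m * cmod (partials is (\<lambda>z. w (z - u) - w (z - v)) z) \<le> D m is * norm (u - v) * (1 + norm u + norm v) ^ m"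
      using D(2) by (simp add: partials_diff schwartz_translate w partials_translate)
    also have "\<dots> \<le> D m is * norm (u - v) * (1 + norm u + norm v) ^ k"
      using D(1) k[OF that] by (intro mult_left_mono power_increasing) auto
    finally show "norm z ^ m * cmod (partials is (\<lambda>z. w (z - u) - w (z - v)) z) \<le> D m is * norm (u - v) * (1 + norm u + norm v) ^ k" .
  qed
  have "cmod (pairing f w u - pairing f w v)
      \<le> (C * (\<Sum>(m, is)\<in>J. D m is)) * norm (u - v) * (1 + norm u + norm v) ^ k" for u v
  proof -
    have "cmod (pairing f w u - pairing f w v) = cmod (f (\<lambda>z. w (z - u) - w (z - v)))"
      unfolding pairing_def by (simp add: tempered_diff[OF f] schwartz_translate w)
    also have "\<dots> \<le> C * (\<Sum>(m, is)\<in>J. schwartz_seminorm m is (\<lambda>z. w (z - u) - w (z - v)))"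
      by (intro J(3) schwartz_diff schwartz_translate w)
    also have "\<dots> \<le> C * (\<Sum>(m, is)\<in>J. D m is * norm (u - v) * (1 + norm u + norm v) ^ k)"
      using J(2) by (intro mult_left_mono sum_mono) (auto intro: sn)
    also have "\<dots> = (C * (\<Sum>(m, is)\<in>J. D m is)) * norm (u - v) * (1 + norm u + norm v) ^ k"
      by (simp add: sum_distrib_left sum_distrib_right split_beta mult.assoc)
    finally show ?thesis .
  qed
  then show ?thesis
    using that[of "C * (\<Sum>(m, is)\<in>J. D m is)" k] J(2) D(1) by (simp add: sum_nonneg split_beta)
qed

lemma continuous_pairing:
  assumes "f \<in> tempered" "w \<in> schwartz"
  shows "continuous_on UNIV (pairing f w)"
proof -
  obtain C m where C: "0 \<le> C"
    "\<And>u v. cmod (pairing f w u - pairing f w v) \<le> C * norm (u - v) * (1 + norm u + norm v) ^ m"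
    using tempered_translate_diff_bound[OF assms] by metis
  have "(pairing f w \<longlongrightarrow> pairing f w v) (at v)" for v
  proof -
    have "((\<lambda>u. C * norm (u - v) * (1 + norm u + norm v) ^ m) \<longlongrightarrow> C * norm (v - v) * (1 + norm v + norm v) ^ m) (at v)"
      by (intro tendsto_intros)
    then have "((\<lambda>u. pairing f w u - pairing f w v) \<longlongrightarrow> 0) (at v)"
      by (intro Lim_null_comparison[OF always_eventually[OF allI[OF C(2)]]]) simp
    then show ?thesis by (simp add: LIM_zero_iff)
  qed
  then show ?thesis by (simp add: continuous_on_def)
qed

lemma measurable_pairing:
  "f \<in> tempered \<Longrightarrow> w \<in> schwartz \<Longrightarrow> pairing f w \<in> borel_measurable borel"
  by (intro borel_measurable_continuous_onI continuous_pairing)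

text \<open>Comparison with the value at 0; the factor \<open>norm (u - v)\<close> costs one more
  power.\<close>

lemma pairing_growth:
  assumes "f \<in> tempered" "w \<in> schwartz"
  obtains C m where "0 \<le> C" "\<And>y. cmod (pairing f w y) \<le> C * (1 + norm y) ^ m"
proof -
  obtain C m where C: "0 \<le> C"
    "\<And>u v. cmod (pairing f w u - pairing f w v) \<le> C * norm (u - v) * (1 + norm u + norm v) ^ m"
    using tempered_translate_diff_bound[OF assms] by metis
  let ?a = "cmod (pairing f w 0)"
  have "cmod (pairing f w y) \<le> (?a + C) * (1 + norm y) ^ Suc m" for y
  proof -
    have "cmod (pairing f w y) \<le> ?a + C * norm y * (1 + norm y) ^ m"
      using C(2)[of y 0] norm_triangle_sub[of "pairing f w y" "pairing f w 0"] by simp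
    also have "\<dots> \<le> ?a * (1 + norm y) ^ Suc m + C * ((1 + norm y) * (1 + norm y) ^ m)"
      unfolding mult.assoc
      using C(1) one_le_power[of "1 + norm y" "Suc m"]
      by (intro add_mono mult_left_mono mult_right_mono mult_right_le_one_le mult_le_cancel_left1[THEN iffD2]) auto
    finally show ?thesis by (simp add: algebra_simps)
  qed
  then show ?thesis using that[of "?a + C" "Suc m"] C(1) by simp
qed

subsection \<open>Interchanging a tempered distribution with an integral\<close>

lemma integrable_norm_mult_power:
  fixes h :: "real^'n \<Rightarrow> complex"
  assumes [measurable]: "h \<in> borel_measurable borel" and h: "rapidly_decreasing h"
  shows "integrable lborel (\<lambda>y. norm (h y) * (1 + norm y) ^ m)"
proof (rule integrable_rapidly_decreasing_mult)
  show "rapidly_decreasing (\<lambda>y. norm (h y))"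
    using h by (simp add: rapidly_decreasing_def)
  show "norm ((1 + norm y) ^ m) \<le> 1 * (1 + norm y) ^ m" for y :: "real^'n"
    by simp
qed measurable

lemma rapidly_decreasing_integrable:
  fixes h :: "real^'n \<Rightarrow> complex"
  assumes "h \<in> borel_measurable borel" "rapidly_decreasing h"
  shows "integrable lborel h"
  using integrable_norm_mult_power[OF assms, of 0] assms(1) by (simp add: integrable_norm_iff)

text \<open>The function \<open>k\<close> is arbitrary because the formula is applied on both sides
  of \<open>f\<close>: with translates of \<open>w\<close> as values before \<open>f\<close> is
  applied, and with \<open>pairing f w\<close> afterwards.\<close>

lemma integral_simple_pullback:
  fixes h :: "real^'n \<Rightarrow> complex" and F :: "real^'n \<Rightarrow> real^'n" and k :: "real^'n \<Rightarrow> complex"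
  assumes h: "integrable lborel h" and F: "simple_function lborel F"
  shows "(LINT y|lborel. h y * k (F y))
    = (\<Sum>c\<in>range F. (LINT y|lborel. indicator (F -` {c}) y *\<^sub>R h y) * k c)"
proof -
  have fin: "finite (range F)" using simple_functionD(1)[OF F] by simp
  have sets: "F -` {c} \<in> sets lborel" for c using simple_functionD(2)[OF F, of "{c}"] by simp
  have int: "integrable lborel (\<lambda>y. indicator (F -` {c}) y *\<^sub>R h y)" for c
    by (rule integrable_mult_indicator[OF sets h])
  have "h y * k (F y) = (\<Sum>c\<in>range F. (indicator (F -` {c}) y *\<^sub>R h y) * k c)" for y
  proof -
    have "(\<Sum>c\<in>range F. (indicator (F -` {c}) y *\<^sub>R h y) * k c)
        = (\<Sum>c\<in>range F. if c = F y then h y * k c else 0)"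
      by (intro sum.cong) (auto simp: indicator_def)
    then show ?thesis using fin by simp
  qed
  then have "(LINT y|lborel. h y * k (F y))
      = (LINT y|lborel. (\<Sum>c\<in>range F. (indicator (F -` {c}) y *\<^sub>R h y) * k c))"
    by presburger
  also have "\<dots> = (\<Sum>c\<in>range F. (LINT y|lborel. (indicator (F -` {c}) y *\<^sub>R h y) * k c))"
    by (rule Bochner_Integration.integral_sum) (intro integrable_mult_left int)
  also have "\<dots> = (\<Sum>c\<in>range F. (LINT y|lborel. indicator (F -` {c}) y *\<^sub>R h y) * k c)"
    by (simp only: integral_mult_left_zero)
  finally show ?thesis .
qed

lemma tempered_conv_along_simple:
  assumes f: "f \<in> tempered" and w: "w \<in> schwartz" and h: "integrable lborel h"
    and F: "simple_function lborel F"
  shows "f (conv_along h F w) = (LINT y|lborel. h y * pairing f w (F y))"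
proof -
  let ?I = "\<lambda>c. LINT y|lborel. indicator (F -` {c}) y *\<^sub>R h y"
  have fin: "finite (range F)" using simple_functionD(1)[OF F] by simp
  have "conv_along h F w = (\<lambda>z. \<Sum>c\<in>range F. ?I c * w (z - c))"
    unfolding conv_along_def using integral_simple_pullback[OF h F] by (intro ext)
  then have "f (conv_along h F w) = (\<Sum>c\<in>range F. f (\<lambda>z. ?I c * w (z - c)))"
    by (simp only:) (intro tempered_sum[OF f fin] schwartz_cmult schwartz_translate w)
  also have "\<dots> = (\<Sum>c\<in>range F. ?I c * pairing f w c)"
    unfolding pairing_def by (intro sum.cong refl tempered_cmult f schwartz_translate w)
  also have "\<dots> = (LINT y|lborel. h y * pairing f w (F y))"
    by (rule integral_simple_pullback[OF h F, symmetric])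
  finally show ?thesis .
qed

text \<open>The seminorm of the difference is at most the integral of \<open>norm (h y)\<close>
  times the Lipschitz bound for translating \<open>w\<close> by \<open>F i y\<close> instead of
  \<open>y\<close>. That integral tends to 0 by dominated convergence.\<close>

lemma schwartz_seminorm_conv_along_diff_tendsto:
  fixes h :: "real^'n \<Rightarrow> complex" and F :: "nat \<Rightarrow> real^'n \<Rightarrow> real^'n"
  assumes w: "w \<in> schwartz"
    and h [measurable]: "h \<in> borel_measurable borel" and hd: "rapidly_decreasing h"
    and F: "\<And>i. F i \<in> borel_measurable borel" "\<And>i y. norm (F i y) \<le> 2 * norm y"
      "\<And>y. (\<lambda>i. F i y) \<longlonglongrightarrow> y"
  shows "(\<lambda>i::nat. schwartz_seminorm m is (\<lambda>z. conv_along h (F i) w z - conv_along h (\<lambda>y. y) w z)) \<longlonglongrightarrow> 0"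
proof -
  let ?d = "\<lambda>(i::nat) z. conv_along h (F i) w z - conv_along h (\<lambda>y. y) w z"
  interpret Fi: conv_weight h "F i" for i
    by unfold_locales (use F hd in auto)
  interpret I: conv_weight h "\<lambda>y. y"
    by unfold_locales (use hd in auto)
  obtain D where D: "0 \<le> D"
    "\<And>u v z. norm z ^ m * cmod (partials is w (z - u) - partials is w (z - v)) \<le> D * norm (u - v) * (1 + norm u + norm v) ^ m"
    using schwartz_translate_diff_bound[OF w] by metis
  \<comment> \<open>The Lipschitz bound at \<open>y\<close>. Both factors that involve
    \<open>F i y\<close> are controlled by \<open>3 * (1 + norm y)\<close>, hence the constants 3 in
    the dominating function.\<close>
  define q where "q i y = D * norm (F i y - y) * (1 + norm (F i y) + norm y) ^ m" for i y
  have q0: "0 \<le> q i y" for i y using D(1) by (simp add: q_def)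
  have qb: "norm (h y) * q i y \<le> (D * (3 * 3 ^ m)) * (norm (h y) * (1 + norm y) ^ Suc m)" for i y
  proof -
    have "norm (F i y - y) \<le> 3 * (1 + norm y)"
    proof -
      have "norm (F i y - y) \<le> norm (F i y) + norm y" by (rule norm_triangle_ineq4)
      also have "\<dots> \<le> 3 * (1 + norm y)" using F(2)[of i y] by simp
      finally show ?thesis .
    qed
    moreover have "(1 + norm (F i y) + norm y) ^ m \<le> (3 * (1 + norm y)) ^ m"
      using F(2)[of i y] by (intro power_mono) auto
    ultimately have "norm (F i y - y) * (1 + norm (F i y) + norm y) ^ m \<le> 3 * (1 + norm y) * (3 * (1 + norm y)) ^ m"
      by (intro mult_mono) auto
    then have "q i y \<le> D * (3 * (1 + norm y) * (3 * (1 + norm y)) ^ m)"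
      unfolding q_def mult.assoc[of D] using D(1) by (intro mult_left_mono) auto
    then have "norm (h y) * q i y \<le> norm (h y) * (D * (3 * (1 + norm y) * (3 * (1 + norm y)) ^ m))"
      by (rule mult_left_mono) simp
    also have "\<dots> = (D * (3 * 3 ^ m)) * (norm (h y) * (1 + norm y) ^ Suc m)"
      by (simp only: power_mult_distrib power_Suc mult_ac)
    finally show ?thesis .
  qed
  have dom: "integrable lborel (\<lambda>y. (D * (3 * 3 ^ m)) * (norm (h y) * (1 + norm y) ^ Suc m))"
    by (intro integrable_mult_right integrable_norm_mult_power h hd)
  have qm: "(\<lambda>y. norm (h y) * q i y) \<in> borel_measurable lborel" for i
    unfolding q_def
    by (intro borel_measurable_times borel_measurable_norm borel_measurable_power borel_measurable_add
        borel_measurable_diff borel_measurable_const measurable_ident)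
      (use h F(1) in simp_all)
  have intq: "integrable lborel (\<lambda>y. norm (h y) * q i y)" for i
  proof (rule Bochner_Integration.integrable_bound[OF dom qm], rule AE_I2)
    fix y
    have "norm (norm (h y) * q i y) = norm (h y) * q i y"
      using q0 by simp
    also have "\<dots> \<le> (D * (3 * 3 ^ m)) * (norm (h y) * (1 + norm y) ^ Suc m)"
      by (rule qb)
    also have "\<dots> \<le> norm ((D * (3 * 3 ^ m)) * (norm (h y) * (1 + norm y) ^ Suc m))"
      unfolding real_norm_def by (rule abs_ge_self)
    finally show "norm (norm (h y) * q i y) \<le> norm ((D * (3 * 3 ^ m)) * (norm (h y) * (1 + norm y) ^ Suc m))" .
  qed
  have "(\<lambda>i. LINT y|lborel. norm (h y) * q i y) \<longlonglongrightarrow> (LINT y|(lborel :: (real^'n) measure). 0)"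
  proof (rule integral_dominated_convergence[OF _ qm dom])
    show "AE y in lborel. (\<lambda>i. norm (h y) * q i y) \<longlonglongrightarrow> 0"
    proof (rule AE_I2)
      fix y
      have "(\<lambda>i. norm (h y) * q i y) \<longlonglongrightarrow> norm (h y) * (D * norm (y - y) * (1 + norm y + norm y) ^ m)"
        unfolding q_def by (intro tendsto_intros F(3))
      then show "(\<lambda>i. norm (h y) * q i y) \<longlonglongrightarrow> 0" by simp
    qed
    show "AE y in lborel. norm (norm (h y) * q i y) \<le> (D * (3 * 3 ^ m)) * (norm (h y) * (1 + norm y) ^ Suc m)" for i
    proof (rule AE_I2)
      fix y
      have "norm (norm (h y) * q i y) = norm (h y) * q i y"
        using q0 by simp
      then show "norm (norm (h y) * q i y) \<le> (D * (3 * 3 ^ m)) * (norm (h y) * (1 + norm y) ^ Suc m)"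
        using qb[of y i] by metis
    qed
  qed simp
  then have lim: "(\<lambda>i. LINT y|lborel. norm (h y) * q i y) \<longlonglongrightarrow> 0" by simp
  have le: "schwartz_seminorm m is (?d i) \<le> (LINT y|lborel. norm (h y) * q i y)" for i
  proof (rule schwartz_seminorm_least)
    fix z
    let ?p = "partials is w"
    have p: "?p \<in> schwartz" by (rule schwartz_partials[OF w])
    have int: "integrable lborel (\<lambda>y. h y * ?p (z - F i y) - h y * ?p (z - y))"
      by (intro Bochner_Integration.integrable_diff Fi.integrable_conv_along I.integrable_conv_along p)
    have "partials is (?d i) z = conv_along h (F i) ?p z - conv_along h (\<lambda>y. y) ?p z"
      by (simp add: partials_diff Fi.schwartz_conv_along I.schwartz_conv_along w Fi.partials_conv_along I.partials_conv_along)
    also have "\<dots> = (LINT y|lborel. h y * ?p (z - F i y) - h y * ?p (z - y))"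
      unfolding conv_along_def
      by (intro Bochner_Integration.integral_diff[symmetric] Fi.integrable_conv_along I.integrable_conv_along p)
    finally have "norm z ^ m * cmod (partials is (?d i) z)
        \<le> norm z ^ m * (LINT y|lborel. norm (h y * ?p (z - F i y) - h y * ?p (z - y)))"
      by (simp only:) (intro mult_left_mono integral_norm_bound, simp)
    also have "\<dots> = (LINT y|lborel. norm z ^ m * norm (h y * ?p (z - F i y) - h y * ?p (z - y)))"
      by simp
    also have "\<dots> \<le> (LINT y|lborel. norm (h y) * q i y)"
    proof (rule integral_mono[OF _ intq])
      show "integrable lborel (\<lambda>y. norm z ^ m * norm (h y * ?p (z - F i y) - h y * ?p (z - y)))"
        using int by (intro integrable_mult_right integrable_norm)
      fix y
      have "norm (h y * ?p (z - F i y) - h y * ?p (z - y)) = norm (h y) * norm (?p (z - F i y) - ?p (z - y))"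
        by (simp only: right_diff_distrib[symmetric] norm_mult)
      then show "norm z ^ m * norm (h y * ?p (z - F i y) - h y * ?p (z - y)) \<le> norm (h y) * q i y"
        using mult_left_mono[OF D(2)[of z "F i y" y], of "norm (h y)"]
        by (simp only: q_def mult.left_commute norm_ge_zero)
    qed
    finally show "norm z ^ m * cmod (partials is (?d i) z)
        \<le> (LINT y|lborel. norm (h y) * q i y)" .
  qed
  show ?thesis
  proof (rule tendsto_sandwich[OF _ _ tendsto_const lim])
    show "\<forall>\<^sub>F i in sequentially. 0 \<le> schwartz_seminorm m is (?d i)"
      by (intro always_eventually allI schwartz_seminorm_nonneg schwartz_diff Fi.schwartz_conv_along I.schwartz_conv_along w)
    show "\<forall>\<^sub>F i in sequentially. schwartz_seminorm m is (?d i)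
        \<le> (LINT y|lborel. norm (h y) * q i y)"
      by (intro always_eventually allI le)
  qed
qed

text \<open>Both sides are limits along simple functions \<open>F i\<close> tending to the identity,
  for which the formula is linearity. On the left the limit follows from
  \<open>tempered_bound\<close>, on the right from continuity and growth of
  \<open>pairing f w\<close>.\<close>

theorem tempered_convolution:
  fixes h :: "real^'n \<Rightarrow> complex"
  assumes f: "f \<in> tempered" and w: "w \<in> schwartz"
    and h [measurable]: "h \<in> borel_measurable borel" and hd: "rapidly_decreasing h"
  shows "f (conv_along h (\<lambda>y. y) w) = (LINT y|lborel. h y * pairing f w y)"
proof -
  obtain F :: "nat \<Rightarrow> real^'n \<Rightarrow> real^'n" where
    simp: "\<And>i. simple_function lborel (F i)" and
    lim: "\<And>y. (\<lambda>i. F i y) \<longlonglongrightarrow> y" and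
    le: "\<And>i y. norm (F i y) \<le> 2 * norm y"
    using borel_measurable_implies_sequence_metric[of "\<lambda>y. y" "lborel :: (real^'n) measure" 0]
    by (auto simp: dist_norm)
  let ?d = "\<lambda>(i::nat) z. conv_along h (F i) w z - conv_along h (\<lambda>y. y) w z"
  have Fm: "F i \<in> borel_measurable borel" for i
    using borel_measurable_simple_function[OF simp[of i]] by simp
  interpret Fi: conv_weight h "F i" for i
    by unfold_locales (use le hd Fm in auto)
  interpret I: conv_weight h "\<lambda>y. y"
    by unfold_locales (use hd in auto)
  obtain J C where J: "finite J" "0 < C"
    "\<And>\<phi>. \<phi> \<in> schwartz \<Longrightarrow> cmod (f \<phi>) \<le> C * (\<Sum>(m, is)\<in>J. schwartz_seminorm m is \<phi>)"
    using tempered_bound[OF f] by metis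
  have "(\<lambda>i. C * (\<Sum>(m, is)\<in>J. schwartz_seminorm m is (?d i)))
      \<longlonglongrightarrow> C * (\<Sum>(m, is)\<in>J. 0)"
    unfolding split_beta
    by (intro tendsto_intros schwartz_seminorm_conv_along_diff_tendsto w h hd Fm le lim)
  then have "(\<lambda>i. C * (\<Sum>(m, is)\<in>J. schwartz_seminorm m is (?d i))) \<longlonglongrightarrow> 0"
    by simp
  then have "(\<lambda>i. f (conv_along h (F i) w) - f (conv_along h (\<lambda>y. y) w)) \<longlonglongrightarrow> 0"
  proof (rule Lim_null_comparison[rotated], intro always_eventually allI)
    fix i
    have "f (conv_along h (F i) w) - f (conv_along h (\<lambda>y. y) w) = f (?d i)"
      by (rule tempered_diff[OF f Fi.schwartz_conv_along[OF w] I.schwartz_conv_along[OF w], symmetric])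
    then show "norm (f (conv_along h (F i) w) - f (conv_along h (\<lambda>y. y) w))
        \<le> C * (\<Sum>(m, is)\<in>J. schwartz_seminorm m is (?d i))"
      using J(3)[OF schwartz_diff[OF Fi.schwartz_conv_along[OF w] I.schwartz_conv_along[OF w]]] by simp
  qed
  then have lim1: "(\<lambda>i. f (conv_along h (F i) w)) \<longlonglongrightarrow> f (conv_along h (\<lambda>y. y) w)"
    by (simp add: LIM_zero_iff)
  obtain D m where D: "0 \<le> D" "\<And>y. cmod (pairing f w y) \<le> D * (1 + norm y) ^ m"
    using pairing_growth[OF f w] by metis
  note tpm = measurable_pairing[OF f w]
  have "(\<lambda>i. LINT y|lborel. h y * pairing f w (F i y)) \<longlonglongrightarrow> (LINT y|lborel. h y * pairing f w y)"
  proof (rule integral_dominated_convergence[where w="\<lambda>y. (D * 2 ^ m) * (norm (h y) * (1 + norm y) ^ m)"])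
    show "integrable lborel (\<lambda>y. (D * 2 ^ m) * (norm (h y) * (1 + norm y) ^ m))"
      by (intro integrable_mult_right integrable_norm_mult_power h hd)
    show "AE y in lborel. (\<lambda>i. h y * pairing f w (F i y)) \<longlonglongrightarrow> h y * pairing f w y"
    proof (rule AE_I2)
      fix y
      have "isCont (pairing f w) y"
        using continuous_pairing[OF f w] by (simp add: continuous_on_eq_continuous_at)
      then show "(\<lambda>i. h y * pairing f w (F i y)) \<longlonglongrightarrow> h y * pairing f w y"
        by (intro tendsto_mult tendsto_const isCont_tendsto_compose[of y "pairing f w"] lim)
    qed
    show "AE y in lborel. norm (h y * pairing f w (F i y)) \<le> (D * 2 ^ m) * (norm (h y) * (1 + norm y) ^ m)" for i
    proof (rule AE_I2)
      fix y
      have "(1 + norm (F i y)) ^ m \<le> (2 * (1 + norm y)) ^ m"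
        using le[of i y] by (intro power_mono) auto
      then have "D * (1 + norm (F i y)) ^ m \<le> D * (2 ^ m * (1 + norm y) ^ m)"
        using D(1) unfolding power_mult_distrib by (rule mult_left_mono)
      then have "cmod (pairing f w (F i y)) \<le> D * (2 ^ m * (1 + norm y) ^ m)"
        using D(2)[of "F i y"] by linarith
      then show "norm (h y * pairing f w (F i y)) \<le> (D * 2 ^ m) * (norm (h y) * (1 + norm y) ^ m)"
        using mult_left_mono[of "cmod (pairing f w (F i y))" "D * (2 ^ m * (1 + norm y) ^ m)" "norm (h y)"]
        by (simp add: norm_mult mult.assoc mult.left_commute)
    qed
    show "(\<lambda>y. h y * pairing f w y) \<in> borel_measurable lborel"
      using h tpm by simp
    show "(\<lambda>y. h y * pairing f w (F i y)) \<in> borel_measurable lborel" for i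
      using h measurable_compose[OF Fm tpm] by (intro borel_measurable_times) simp_all
  qed
  then have "(\<lambda>i. f (conv_along h (F i) w)) \<longlonglongrightarrow> (LINT y|lborel. h y * pairing f w y)"
    using tempered_conv_along_simple[OF f w rapidly_decreasing_integrable[OF h hd] simp] by simp
  with lim1 show ?thesis by (rule LIMSEQ_unique)
qed

subsection \<open>The Fourier transform of Schwartz functions\<close>

definition fourier_kernel :: "real^'n \<Rightarrow> real^'n \<Rightarrow> complex" where
  "fourier_kernel x \<xi> = exp (- 2 * of_real pi * \<i> * of_real (x \<bullet> \<xi>))"

lemma norm_fourier_kernel [simp]: "norm (fourier_kernel x \<xi>) = 1"
  by (simp add: fourier_kernel_def)

lemma measurable_fourier_kernel [measurable (raw)]:
  assumes [measurable]: "f \<in> borel_measurable M" "g \<in> borel_measurable M"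
  shows "(\<lambda>z. fourier_kernel (f z) (g z)) \<in> borel_measurable M"
  unfolding fourier_kernel_def by measurable

lemma fourier_kernel_commute: "fourier_kernel x \<xi> = fourier_kernel \<xi> x"
  by (simp add: fourier_kernel_def inner_commute)

lemma fourier_kernel_add: "fourier_kernel x (\<xi> + \<eta>) = fourier_kernel x \<xi> * fourier_kernel x \<eta>"
  by (simp add: fourier_kernel_def inner_add_right algebra_simps flip: exp_add)

lemma fourier_lborel:
  assumes [measurable]: "g \<in> borel_measurable borel"
  shows "fourier g x = (LINT \<xi>|lborel. g \<xi> * fourier_kernel x \<xi>)"
  unfolding fourier_def fourier_kernel_def by (rule integral_completion) measurable

lemma integrable_mult_fourier_kernel:
  assumes "integrable lborel g"
  shows "integrable lborel (\<lambda>\<xi>. g \<xi> * fourier_kernel x \<xi>)"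
proof (rule Bochner_Integration.integrable_bound[OF assms])
  have [measurable]: "g \<in> borel_measurable borel" using assms by simp
  show "(\<lambda>\<xi>. g \<xi> * fourier_kernel x \<xi>) \<in> borel_measurable lborel" by measurable
qed (simp add: norm_mult)

lemma norm_fourier_le:
  assumes "integrable lborel g"
  shows "norm (fourier g x) \<le> (LINT \<xi>|lborel. norm (g \<xi>))"
proof -
  have "g \<in> borel_measurable borel" using assms by simp
  then show ?thesis
    using integral_norm_bound[of lborel "\<lambda>\<xi>. g \<xi> * fourier_kernel x \<xi>"]
    by (simp add: fourier_lborel norm_mult)
qed

lemma lborel_integral_translate:
  fixes g :: "'a::euclidean_space \<Rightarrow> 'b::{banach, second_countable_topology}"
  assumes [measurable]: "g \<in> borel_measurable borel"
  shows "(LINT x|lborel. g (x + c)) = (LINT x|lborel. g x)"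
    and "integrable lborel (\<lambda>x. g (x + c)) \<longleftrightarrow> integrable lborel g"
  by (subst (2) lborel_distr_plus[of c, symmetric], simp add: integral_distr integrable_distr_eq add.commute)+

lemma has_derivative_fourier_kernel:
  "((\<lambda>x. fourier_kernel x \<xi>) has_derivative
    (\<lambda>v. - 2 * of_real pi * \<i> * of_real (v \<bullet> \<xi>) * fourier_kernel x \<xi>)) (at x)"
proof -
  have "bounded_linear (\<lambda>x. (- 2 * of_real pi * \<i>) * of_real (x \<bullet> \<xi>))"
    by (intro bounded_linear_const_mult bounded_linear_compose[OF bounded_linear_of_real bounded_linear_inner_left])
  from has_derivative_compose[OF bounded_linear_imp_has_derivative[OF this]
      DERIV_exp[unfolded has_field_derivative_def]]
  show ?thesis
    unfolding fourier_kernel_def by (simp only: mult.commute[of "exp _"])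
qed

lemma has_derivative_fourier:
  assumes g: "g \<in> schwartz"
  shows "(fourier g has_derivative
    (\<lambda>v. LINT \<xi>|lborel. g \<xi> * (- 2 * of_real pi * \<i> * of_real (v \<bullet> \<xi>) * fourier_kernel x \<xi>))) (at x)"
proof -
  have gm [measurable]: "g \<in> borel_measurable borel" by (rule schwartz_measurable[OF g])
  have "((\<lambda>x. LINT \<xi>|lborel. g \<xi> * fourier_kernel x \<xi>) has_derivative
    (\<lambda>v. LINT \<xi>|lborel. g \<xi> * (- 2 * of_real pi * \<i> * of_real (v \<bullet> \<xi>) * fourier_kernel x \<xi>))) (at x)"
  proof (rule has_derivative_integral)
    show "integrable lborel (\<lambda>\<xi>. g \<xi> * fourier_kernel z \<xi>)" for z
      by (intro integrable_mult_fourier_kernel schwartz_integrable g)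
    show "((\<lambda>z. g \<xi> * fourier_kernel z \<xi>) has_derivative
        (\<lambda>v. g \<xi> * (- 2 * of_real pi * \<i> * of_real (v \<bullet> \<xi>) * fourier_kernel z \<xi>))) (at z)" for z \<xi>
      by (intro has_derivative_mult_right has_derivative_fourier_kernel)
    show "integrable lborel (\<lambda>\<xi>. (2 * pi) * (norm (g \<xi>) * (1 + norm \<xi>) ^ 1))"
      by (intro integrable_mult_right integrable_norm_mult_power gm schwartz_rapidly_decreasing0 g)
    show "norm (g \<xi> * (- 2 * of_real pi * \<i> * of_real (v \<bullet> \<xi>) * fourier_kernel z \<xi>))
        \<le> (2 * pi) * (norm (g \<xi>) * (1 + norm \<xi>) ^ 1) * norm v" for z \<xi> v
    proof -
      have "\<bar>v \<bullet> \<xi>\<bar> \<le> (1 + norm \<xi>) * norm v"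
        using Cauchy_Schwarz_ineq2[of v \<xi>] by (simp add: algebra_simps add_increasing)
      then have "(2 * pi * norm (g \<xi>)) * \<bar>v \<bullet> \<xi>\<bar> \<le> (2 * pi * norm (g \<xi>)) * ((1 + norm \<xi>) * norm v)"
        by (intro mult_left_mono) auto
      moreover have "norm (g \<xi> * (- 2 * of_real pi * \<i> * of_real (v \<bullet> \<xi>) * fourier_kernel z \<xi>))
          = (2 * pi * norm (g \<xi>)) * \<bar>v \<bullet> \<xi>\<bar>"
        by (simp add: norm_mult)
      ultimately show ?thesis by (simp only: power_one_right mult.assoc)
    qed
  qed measurable
  then show ?thesis by (simp add: fourier_lborel[OF gm, abs_def])
qed

lemma partial_fourier:
  assumes g: "g \<in> schwartz"
  shows "partial i (fourier g) = fourier (\<lambda>\<xi>. (- 2 * of_real pi * \<i>) * (of_real (\<xi> $ i) * g \<xi>))"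
proof -
  have [measurable]: "g \<in> borel_measurable borel" by (rule schwartz_measurable[OF g])
  have m: "(\<lambda>\<xi>. (- 2 * of_real pi * \<i>) * (of_real (\<xi> $ i) * g \<xi>)) \<in> borel_measurable borel"
    by measurable
  show ?thesis
    by (subst partial_eqI[OF has_derivative_fourier[OF g]], rule ext, subst fourier_lborel[OF m])
      (simp add: inner_axis' mult_ac)
qed

text \<open>Instead of integrating by parts, the transform of \<open>g\<close> shifted by
  \<open>s *\<^sub>R a\<close> is differentiated at \<open>s = 0\<close> in two ways: under the
  integral, and after a translation that turns the shift into an exponential factor. Uniqueness of
  derivatives gives the identity.\<close>

lemma fourier_partial:
  fixes g :: "real^'n \<Rightarrow> complex"
  assumes g: "g \<in> schwartz"
  shows "fourier (partial i g) x = 2 * of_real pi * \<i> * of_real (x $ i) * fourier g x"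
proof -
  define a where "a = (axis i 1 :: real^'n)"
  have na: "norm a = 1" by (simp add: a_def)
  have gm [measurable]: "g \<in> borel_measurable borel" by (rule schwartz_measurable[OF g])
  have pm [measurable]: "partial i g \<in> borel_measurable borel"
    by (rule schwartz_measurable[OF schwartz_partial[OF g]])
  let ?m = "CARD('n) + 2"
  obtain C where C: "0 < C" "\<And>x. (1 + norm x) ^ ?m * norm (partial i g x) \<le> C"
    using rapidly_decreasingE[OF schwartz_rapidly_decreasing0[OF schwartz_partial[OF g, of i]]] by metis
  have D: "((\<lambda>s::real. LINT \<xi>|lborel. g (\<xi> + s *\<^sub>R a) * fourier_kernel x \<xi>) has_derivative
      (\<lambda>t. LINT \<xi>|lborel. (t *\<^sub>R partial i g (\<xi> + 0 *\<^sub>R a)) * fourier_kernel x \<xi>)) (at 0)"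
  proof (rule has_derivative_integral)
    show "integrable lborel (\<lambda>\<xi>. g (\<xi> + s *\<^sub>R a) * fourier_kernel x \<xi>)" for s
      by (intro integrable_mult_fourier_kernel) (simp add: lborel_integral_translate schwartz_integrable g)
    show "((\<lambda>s. g (\<xi> + s *\<^sub>R a) * fourier_kernel x \<xi>) has_derivative
        (\<lambda>t. (t *\<^sub>R partial i g (\<xi> + s *\<^sub>R a)) * fourier_kernel x \<xi>)) (at s)" for s \<xi>
    proof (rule has_derivative_mult_left)
      have "((\<lambda>s. \<xi> + s *\<^sub>R a) has_derivative (\<lambda>t. t *\<^sub>R a)) (at s)"
        by (auto intro!: derivative_eq_intros)
      from has_derivative_compose[OF this schwartz_has_derivative[OF g]]
      have "((\<lambda>s. g (\<xi> + s *\<^sub>R a)) has_derivative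
          (\<lambda>t. \<Sum>j\<in>UNIV. ((t *\<^sub>R a) $ j) *\<^sub>R partial j g (\<xi> + s *\<^sub>R a))) (at s)" .
      moreover have "(\<Sum>j\<in>UNIV. ((t *\<^sub>R a) $ j) *\<^sub>R b j) = t *\<^sub>R b i" for t and b :: "'n \<Rightarrow> complex"
        by (simp add: a_def axis_def if_distrib[where f="\<lambda>c. _ * c"] if_distrib[where f="\<lambda>c. c *\<^sub>R _"] cong: if_cong)
      ultimately show "((\<lambda>s. g (\<xi> + s *\<^sub>R a)) has_derivative (\<lambda>t. t *\<^sub>R partial i g (\<xi> + s *\<^sub>R a))) (at s)"
        by (simp only:)
    qed
    show "integrable lborel (\<lambda>\<xi>::real^'n. (2 ^ ?m * C) * (1 / (1 + norm \<xi>) ^ ?m))"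
      by (intro integrable_mult_right integrable_one_plus_norm_power)
    show "norm ((t *\<^sub>R partial i g (\<xi> + s *\<^sub>R a)) * fourier_kernel x \<xi>)
        \<le> (2 ^ ?m * C) * (1 / (1 + norm \<xi>) ^ ?m) * norm t" if "s \<in> ball 0 1" for s \<xi> t
    proof -
      have p: "0 < (1 + norm \<xi>) ^ ?m" by (intro zero_less_power) (simp add: add_pos_nonneg)
      \<comment> \<open>Shifts of norm below 1 change the weight by at most \<open>2 ^ ?m\<close>,
        so one dominating function serves all \<open>s\<close> in the unit ball.\<close>
      have "(1 + norm (- (s *\<^sub>R a))) ^ ?m \<le> 2 ^ ?m"
        using that na by (intro power_mono) auto
      then have "(1 + norm (\<xi> - - (s *\<^sub>R a))) ^ ?m * (1 + norm (- (s *\<^sub>R a))) ^ ?m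
          \<le> (1 + norm (\<xi> - - (s *\<^sub>R a))) ^ ?m * 2 ^ ?m"
        by (rule mult_left_mono) simp
      from order_trans[OF one_plus_norm_power_le this]
      have "(1 + norm \<xi>) ^ ?m \<le> (1 + norm (\<xi> + s *\<^sub>R a)) ^ ?m * 2 ^ ?m"
        by (simp only: diff_minus_eq_add)
      then have "(1 + norm \<xi>) ^ ?m * norm (partial i g (\<xi> + s *\<^sub>R a))
          \<le> (1 + norm (\<xi> + s *\<^sub>R a)) ^ ?m * 2 ^ ?m * norm (partial i g (\<xi> + s *\<^sub>R a))"
        by (rule mult_right_mono) simp
      also have "\<dots> = 2 ^ ?m * ((1 + norm (\<xi> + s *\<^sub>R a)) ^ ?m * norm (partial i g (\<xi> + s *\<^sub>R a)))"
        by (simp only: mult_ac)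
      also have "\<dots> \<le> 2 ^ ?m * C" by (intro mult_left_mono C) simp
      finally have "norm (partial i g (\<xi> + s *\<^sub>R a)) \<le> (2 ^ ?m * C) * (1 / (1 + norm \<xi>) ^ ?m)"
        using p by (simp only: times_divide_eq_right mult_1_right pos_le_divide_eq mult.commute)
      from mult_right_mono[OF this, of "norm t"] show ?thesis
        by (simp only: norm_mult norm_scaleR norm_fourier_kernel mult_1_right real_norm_def abs_ge_zero mult_1_left mult.commute)
    qed
    show "(\<lambda>\<xi>. (t *\<^sub>R partial i g (\<xi> + 0 *\<^sub>R a)) * fourier_kernel x \<xi>) \<in> borel_measurable lborel" for t
      by measurable
  qed
  have "(LINT \<xi>|lborel. g (\<xi> + s *\<^sub>R a) * fourier_kernel x \<xi>) = exp (2 * of_real pi * \<i> * of_real (x $ i) * of_real s) * fourier g x" for s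
  proof -
    have "(LINT \<xi>|lborel. g (\<xi> + s *\<^sub>R a) * fourier_kernel x \<xi>)
        = (LINT \<xi>|lborel. (\<lambda>\<xi>. g \<xi> * fourier_kernel x (\<xi> - s *\<^sub>R a)) (\<xi> + s *\<^sub>R a))"
      by simp
    also have "\<dots> = (LINT \<xi>|lborel. g \<xi> * fourier_kernel x (\<xi> - s *\<^sub>R a))"
      by (rule lborel_integral_translate) measurable
    also have "\<dots> = (LINT \<xi>|lborel. exp (2 * of_real pi * \<i> * of_real (x $ i) * of_real s) * (g \<xi> * fourier_kernel x \<xi>))"
    proof (rule Bochner_Integration.integral_cong[OF refl])
      fix \<xi>
      have "fourier_kernel x (\<xi> - s *\<^sub>R a) = fourier_kernel x \<xi> * fourier_kernel x (- (s *\<^sub>R a))"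
        by (simp add: fourier_kernel_add[symmetric])
      moreover have "fourier_kernel x (- (s *\<^sub>R a)) = exp (2 * of_real pi * \<i> * of_real (x $ i) * of_real s)"
        by (simp add: fourier_kernel_def a_def inner_axis mult_ac)
      ultimately show "g \<xi> * fourier_kernel x (\<xi> - s *\<^sub>R a)
          = exp (2 * of_real pi * \<i> * of_real (x $ i) * of_real s) * (g \<xi> * fourier_kernel x \<xi>)"
        by simp
    qed
    also have "\<dots> = exp (2 * of_real pi * \<i> * of_real (x $ i) * of_real s) * fourier g x"
      by (simp add: fourier_lborel[OF gm])
    finally show ?thesis .
  qed
  with D have "((\<lambda>s::real. exp (2 * of_real pi * \<i> * of_real (x $ i) * of_real s) * fourier g x) has_derivative
      (\<lambda>t. LINT \<xi>|lborel. (t *\<^sub>R partial i g (\<xi> + 0 *\<^sub>R a)) * fourier_kernel x \<xi>)) (at 0)"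
    by (simp only:)
  moreover have "((\<lambda>s::real. exp (2 * of_real pi * \<i> * of_real (x $ i) * of_real s) * fourier g x) has_derivative
      (\<lambda>t. (2 * of_real pi * \<i> * of_real (x $ i) * of_real t) * fourier g x)) (at 0)"
  proof -
    let ?c = "2 * of_real pi * \<i> * complex_of_real (x $ i)"
    have "bounded_linear (\<lambda>s. ?c * of_real s)"
      by (intro bounded_linear_const_mult bounded_linear_of_real)
    from has_derivative_compose[OF bounded_linear_imp_has_derivative[OF this]
        DERIV_exp[unfolded has_field_derivative_def]]
    have "((\<lambda>s. exp (?c * of_real s)) has_derivative (\<lambda>t. exp (?c * of_real 0) * (?c * of_real t))) (at (0::real))" .
    then have "((\<lambda>s. exp (?c * of_real s) * fourier g x) has_derivative
        (\<lambda>t. (exp (?c * of_real 0) * (?c * of_real t)) * fourier g x)) (at (0::real))"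
      by (rule has_derivative_mult_left)
    then show ?thesis by simp
  qed
  ultimately have "(\<lambda>t::real. LINT \<xi>|lborel. (t *\<^sub>R partial i g (\<xi> + 0 *\<^sub>R a)) * fourier_kernel x \<xi>)
      = (\<lambda>t. (2 * of_real pi * \<i> * of_real (x $ i) * of_real t) * fourier g x)"
    by (rule has_derivative_unique)
  from fun_cong[OF this, of 1] show ?thesis
    by (simp add: fourier_lborel[OF pm])
qed

text \<open>One power of \<open>norm x\<close> is bounded by the sum of the moduli of the
  coordinates, and each coordinate is traded for a partial derivative of \<open>g\<close>; hence the
  induction generalizes over \<open>g\<close>.\<close>

lemma fourier_decay:
  fixes g :: "real^'n \<Rightarrow> complex"
  assumes "g \<in> schwartz"
  shows "\<exists>C. \<forall>x. norm x ^ m * cmod (fourier g x) \<le> C"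
  using assms
proof (induction m arbitrary: g)
  case 0
  then show ?case using norm_fourier_le[OF schwartz_integrable] by auto
next
  case (Suc m)
  have "\<exists>C. \<forall>x. norm x ^ m * cmod (fourier (partial i g) x) \<le> C" for i
    by (rule Suc.IH[OF schwartz_partial[OF Suc.prems]])
  then obtain C where C: "\<And>i x. norm x ^ m * cmod (fourier (partial i g) x) \<le> C i" by metis
  have "norm x ^ Suc m * cmod (fourier g x) \<le> (\<Sum>i\<in>UNIV. C i / (2 * pi))" for x
  proof -
    have "norm x ^ Suc m * cmod (fourier g x) = norm x * (norm x ^ m * cmod (fourier g x))" by simp
    also have "\<dots> \<le> (\<Sum>i\<in>UNIV. \<bar>x $ i\<bar>) * (norm x ^ m * cmod (fourier g x))"
      by (intro mult_right_mono norm_le_l1_cart) auto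
    also have "\<dots> = (\<Sum>i\<in>UNIV. norm x ^ m * cmod (fourier (partial i g) x) / (2 * pi))"
      by (simp add: fourier_partial[OF Suc.prems] norm_mult sum_distrib_left sum_distrib_right mult_ac)
    also have "\<dots> \<le> (\<Sum>i\<in>UNIV. C i / (2 * pi))"
      by (intro sum_mono divide_right_mono C) simp
    finally show ?thesis .
  qed
  then show ?case by blast
qed

text \<open>Differentiating a transform multiplies \<open>g\<close> by a coordinate, so the
  transforms of Schwartz functions form a closed family.\<close>

theorem schwartz_fourier:
  assumes "g \<in> schwartz" shows "fourier g \<in> schwartz"
proof (rule schwartz_coinduct[of _ "fourier ` schwartz"])
  fix h assume "h \<in> fourier ` schwartz"
  then obtain g where g: "g \<in> schwartz" and h: "h = fourier g" by auto
  show "h differentiable (at x)" for x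
    unfolding h using has_derivative_fourier[OF g] differentiable_def by blast
  show "partial i h \<in> fourier ` schwartz" for i
    unfolding h partial_fourier[OF g] using schwartz_cmult[OF schwartz_coord_mult[OF g]] by (rule imageI)
  show "\<exists>C. \<forall>x. norm x ^ m * cmod (h x) \<le> C" for m
    unfolding h by (rule fourier_decay[OF g])
qed (use assms in auto)

subsection \<open>Fourier transforms of integrable functions\<close>

lemma continuous_fourier:
  fixes g :: "real^'n \<Rightarrow> complex"
  assumes g: "integrable lborel g"
  shows "continuous_on UNIV (fourier g)"
proof (rule continuous_on_sequentiallyI)
  have [measurable]: "g \<in> borel_measurable borel" using g by simp
  fix u :: "nat \<Rightarrow> real^'n" and a assume u: "u \<longlonglongrightarrow> a"
  have "(\<lambda>n. LINT \<xi>|lborel. g \<xi> * fourier_kernel (u n) \<xi>) \<longlonglongrightarrow> (LINT \<xi>|lborel. g \<xi> * fourier_kernel a \<xi>)"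
  proof (rule integral_dominated_convergence[where w="\<lambda>\<xi>. norm (g \<xi>)"])
    show "AE \<xi> in lborel. (\<lambda>n. g \<xi> * fourier_kernel (u n) \<xi>) \<longlonglongrightarrow> g \<xi> * fourier_kernel a \<xi>"
      unfolding fourier_kernel_def by (intro AE_I2 tendsto_intros u)
  qed (use g in \<open>auto simp: norm_mult\<close>)
  then show "(\<lambda>n. fourier g (u n)) \<longlonglongrightarrow> fourier g a"
    by (simp add: fourier_lborel)
qed

lemma fourier_duality:
  fixes g \<psi> :: "real^'n \<Rightarrow> complex"
  assumes g: "integrable lborel g" and \<psi>: "integrable lborel \<psi>"
  shows "(LINT y|lborel. g y * fourier \<psi> y) = (LINT x|lborel. fourier g x * \<psi> x)"
proof -
  have gm [measurable]: "g \<in> borel_measurable borel" and pm [measurable]: "\<psi> \<in> borel_measurable borel"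
    using g \<psi> by simp_all
  let ?f = "\<lambda>y x. g y * (\<psi> x * fourier_kernel y x)"
  have "integrable (lborel \<Otimes>\<^sub>M lborel) (case_prod ?f)"
  proof (rule lborel_pair.Fubini_integrable)
    show "integrable lborel (\<lambda>y. LINT x|lborel. norm (case (y, x) of (y, x) \<Rightarrow> ?f y x))"
      using integrable_norm[OF g] by (simp add: norm_mult)
    show "AE y in lborel. integrable lborel (\<lambda>x. case (y, x) of (y, x) \<Rightarrow> ?f y x)"
      using integrable_mult_fourier_kernel[OF \<psi>] by simp
  qed measurable
  from lborel_pair.Fubini_integral[OF this]
  have "(LINT x|lborel. LINT y|lborel. ?f y x) = (LINT y|lborel. LINT x|lborel. ?f y x)" .
  moreover have "(LINT x|lborel. ?f y x) = g y * fourier \<psi> y" for y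
    by (simp add: fourier_lborel[OF pm])
  moreover have "(LINT y|lborel. ?f y x) = fourier g x * \<psi> x" for x
  proof -
    have "(LINT y|lborel. ?f y x) = (LINT y|lborel. g y * fourier_kernel x y * \<psi> x)"
      by (simp add: fourier_kernel_commute[of _ x] mult_ac)
    then show ?thesis by (simp add: fourier_lborel[OF gm])
  qed
  ultimately show ?thesis by (simp only:)
qed

lemma fourier_convolution:
  fixes g \<phi> :: "real^'n \<Rightarrow> complex"
  assumes g: "integrable lborel g" and \<phi>: "integrable lborel \<phi>"
  shows "fourier (\<lambda>x. LINT y|lborel. g y * \<phi> (x - y)) \<xi> = fourier g \<xi> * fourier \<phi> \<xi>"
proof -
  have gm [measurable]: "g \<in> borel_measurable borel" and pm [measurable]: "\<phi> \<in> borel_measurable borel"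
    using g \<phi> by simp_all
  let ?f = "\<lambda>y x. g y * (\<phi> (x - y) * fourier_kernel \<xi> x)"
  have int: "integrable lborel (\<lambda>x. \<phi> (x - y))" for y
    using lborel_integral_translate(2)[OF pm, of "- y"] \<phi> by simp
  have "integrable (lborel \<Otimes>\<^sub>M lborel) (case_prod ?f)"
  proof (rule lborel_pair.Fubini_integrable)
    have "(LINT x|lborel. norm (\<phi> (x - y))) = (LINT x|lborel. norm (\<phi> x))" for y
      using lborel_integral_translate(1)[of "\<lambda>x. norm (\<phi> x)" "- y"] by simp
    then show "integrable lborel (\<lambda>y. LINT x|lborel. norm (case (y, x) of (y, x) \<Rightarrow> ?f y x))"
      using integrable_norm[OF g] by (simp add: norm_mult)
    show "AE y in lborel. integrable lborel (\<lambda>x. case (y, x) of (y, x) \<Rightarrow> ?f y x)"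
      using integrable_mult_fourier_kernel[OF int] by simp
  qed measurable
  from lborel_pair.Fubini_integral[OF this]
  have "(LINT x|lborel. LINT y|lborel. ?f y x) = (LINT y|lborel. LINT x|lborel. ?f y x)" .
  moreover have "(LINT y|lborel. ?f y x) = (LINT y|lborel. g y * \<phi> (x - y)) * fourier_kernel \<xi> x" for x
    by (simp add: mult.assoc[symmetric])
  moreover have "(LINT x|lborel. ?f y x) = g y * fourier_kernel \<xi> y * fourier \<phi> \<xi>" for y
  proof -
    have "(LINT x|lborel. \<phi> (x - y) * fourier_kernel \<xi> x)
        = (LINT x|lborel. (\<lambda>x. \<phi> (x - y) * fourier_kernel \<xi> x) (x + y))"
      by (rule lborel_integral_translate(1)[symmetric]) measurable
    also have "\<dots> = (LINT x|lborel. fourier_kernel \<xi> y * (\<phi> x * fourier_kernel \<xi> x))"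
      by (simp add: fourier_kernel_add mult_ac)
    also have "\<dots> = fourier_kernel \<xi> y * fourier \<phi> \<xi>"
      by (simp add: fourier_lborel[OF pm])
    finally show ?thesis by (simp add: mult.assoc)
  qed
  ultimately have "(LINT x|lborel. (LINT y|lborel. g y * \<phi> (x - y)) * fourier_kernel \<xi> x)
      = (LINT y|lborel. g y * fourier_kernel \<xi> y * fourier \<phi> \<xi>)"
    by (simp only:)
  then show ?thesis
    by (subst fourier_lborel) (simp_all add: fourier_lborel[OF gm])
qed

lemma lborel_integral_reflect:
  fixes g :: "'a::euclidean_space \<Rightarrow> 'b::{banach, second_countable_topology}"
  assumes [measurable]: "g \<in> borel_measurable borel"
  shows "(LINT x|lborel. g (c - x)) = (LINT x|lborel. g x)"
  by (subst (2) lborel_affine[of "-1" c]) (simp_all add: density_1 integral_distr)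

lemma conv_along_commute:
  fixes h w :: "real^'n \<Rightarrow> complex"
  assumes [measurable]: "h \<in> borel_measurable borel" "w \<in> borel_measurable borel"
  shows "conv_along h (\<lambda>y. y) w = conv_along w (\<lambda>y. y) h"
proof
  fix z
  have "(LINT y|lborel. (\<lambda>y. h y * w (z - y)) (z - y)) = (LINT y|lborel. h y * w (z - y))"
    by (rule lborel_integral_reflect) measurable
  then show "conv_along h (\<lambda>y. y) w z = conv_along w (\<lambda>y. y) h z"
    by (simp add: conv_along_def mult.commute)
qed

section \<open>Dilated Gaussians\<close>

text \<open>The normalizing constant stays an integral; integrability and positivity of the weight
  give total mass 1 without evaluating it.\<close>

definition gaussian :: "real^'n \<Rightarrow> complex" where
  "gaussian x = of_real (exp (- (x \<bullet> x)) / (LINT y|lborel. exp (- ((y::real^'n) \<bullet> y))))"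

lemma integrable_gaussian_weight: "integrable lborel (\<lambda>y::real^'n. exp (- (y \<bullet> y)))"
proof -
  have "(\<lambda>x::real^'n. complex_of_real (exp (- (x \<bullet> x)))) \<in> schwartz"
    using schwartz_gaussian[of "mat 1 :: real^'n^'n"] by (simp add: invertible_det_nz)
  from integrable_norm[OF schwartz_integrable[OF this]] show ?thesis
    by (simp only: norm_of_real abs_exp_cancel)
qed

lemma gaussian_mass_pos: "0 < (LINT y|lborel. exp (- ((y::real^'n) \<bullet> y)))"
proof -
  have "(LINT y|lborel. exp (- ((y::real^'n) \<bullet> y))) \<noteq> 0"
  proof
    assume "(LINT y|lborel. exp (- ((y::real^'n) \<bullet> y))) = 0"
    then have "AE y in (lborel :: (real^'n) measure). exp (- (y \<bullet> y)) = 0"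
      using integral_nonneg_eq_0_iff_AE[OF integrable_gaussian_weight[where 'n='n]] by simp
    then have "AE y in (lborel :: (real^'n) measure). False"
      by simp
    then have "emeasure lborel (space (lborel :: (real^'n) measure)) = 0"
      using ae_filter_eq_bot_iff trivial_limit_def by metis
    then show False by simp
  qed
  moreover have "0 \<le> (LINT y|lborel. exp (- ((y::real^'n) \<bullet> y)))"
    by (intro Bochner_Integration.integral_nonneg) simp
  ultimately show ?thesis by (metis order_le_less)
qed

lemma gaussian_uminus [simp]: "gaussian (- x) = gaussian x"
  by (simp add: gaussian_def)

lemma schwartz_gaussian_linear:
  fixes M :: "real^'n^'n"
  assumes "invertible M"
  shows "(\<lambda>x. gaussian (M *v x)) \<in> schwartz"
proof -
  have "(\<lambda>x. gaussian (M *v x)) = (\<lambda>x. of_real (1 / (LINT y|lborel. exp (- ((y::real^'n) \<bullet> y))))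
      * complex_of_real (exp (- ((M *v x) \<bullet> (M *v x)))))"
    by (simp add: gaussian_def fun_eq_iff)
  then show ?thesis
    using schwartz_cmult[OF schwartz_gaussian[OF assms]] by presburger
qed

lemma schwartz_normalized_gaussian: "gaussian \<in> schwartz"
  using schwartz_gaussian_linear[of "mat 1"] by (simp add: invertible_det_nz)

lemma integral_gaussian: "(LINT x|lborel. gaussian (x :: real^'n)) = 1"
  and integral_norm_gaussian: "(LINT x|lborel. norm (gaussian (x :: real^'n))) = 1"
proof -
  let ?I = "LINT y|lborel. exp (- ((y::real^'n) \<bullet> y))"
  have "0 < ?I" by (rule gaussian_mass_pos)
  then have I: "?I \<noteq> 0" "0 < ?I" by (metis less_irrefl)+
  have "(LINT x|lborel. gaussian (x :: real^'n)) = of_real (LINT x|lborel. exp (- ((x::real^'n) \<bullet> x)) / ?I)"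
    unfolding gaussian_def by (rule integral_complex_of_real)
  then show "(LINT x|lborel. gaussian (x :: real^'n)) = 1"
    using I by simp
  have "norm (gaussian (x::real^'n)) = exp (- (x \<bullet> x)) / ?I" for x
    unfolding gaussian_def norm_of_real using I by simp
  then show "(LINT x|lborel. norm (gaussian (x :: real^'n))) = 1"
    using I by simp
qed

lemma fourier_gaussian_0: "fourier gaussian 0 = 1"
  by (simp add: fourier_lborel schwartz_measurable schwartz_normalized_gaussian integral_gaussian fourier_kernel_def)

lemma norm_fourier_gaussian_le: "norm (fourier gaussian x) \<le> 1"
  using norm_fourier_le[OF schwartz_integrable[OF schwartz_normalized_gaussian], of x]
  by (simp add: integral_norm_gaussian)

context dilation
begin

abbreviation "bump k \<equiv> dilate A k gaussian"

lemma bump_eq: "bump k = (\<lambda>x. of_real (dil_b A powi (- k)) * gaussian (matrix_powi A (- k) *v x))"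
  by (simp add: dilate_def fun_eq_iff)

lemma schwartz_bump: "bump k \<in> schwartz"
  unfolding bump_eq
  by (intro schwartz_cmult schwartz_gaussian_linear invertible_matrix_powi invertible_A)

lemma bump_uminus: "bump k (- x) = bump k x"
proof -
  have "matrix_powi A (- k) *v (- x) = - (matrix_powi A (- k) *v x)"
    using matrix_vector_mult_scaleR[of "matrix_powi A (- k)" "- 1" x] by simp
  then show ?thesis by (simp add: bump_eq)
qed

lemma bump_diff_commute: "bump k (x - y) = bump k (y - x)"
  using bump_uminus[of k "x - y"] by simp

text \<open>The Jacobian of the substitution cancels the normalization of the bump. The rule serves
  both for the transform of a bump and for averages around the origin.\<close>

lemma integral_bump:
  fixes G :: "real^'n \<Rightarrow> complex"
  assumes [measurable]: "G \<in> borel_measurable borel"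
  shows "(LINT y|lborel. bump k y * G y) = (LINT y|lborel. gaussian y * G (matrix_powi A k *v y))"
proof -
  have [measurable]: "bump k \<in> borel_measurable borel"
    by (rule schwartz_measurable[OF schwartz_bump])
  have b: "0 < dil_b A" using dil_b_gt_1 by simp
  have d: "\<bar>det (matrix_powi A k)\<bar> = dil_b A powi k"
    by (simp add: det_matrix_powi invertible_A dil_b_def power_int_abs)
  have "(LINT y|lborel. bump k y * G y)
      = (dil_b A powi k) *\<^sub>R (LINT y|lborel. bump k (matrix_powi A k *v y) * G (matrix_powi A k *v y))"
    unfolding d[symmetric]
    by (rule lborel_integral_linear(1)[OF invertible_matrix_powi[OF invertible_A]]) measurable
  also have "\<dots> = (LINT y|lborel. (dil_b A powi k) *\<^sub>R (bump k (matrix_powi A k *v y) * G (matrix_powi A k *v y)))"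
    by simp
  also have "\<dots> = (LINT y|lborel. gaussian y * G (matrix_powi A k *v y))"
  proof (rule Bochner_Integration.integral_cong[OF refl])
    fix y
    have "dil_b A powi k * dil_b A powi (- k) = 1"
      using b by (simp add: power_int_minus)
    then have "complex_of_real (dil_b A powi k) * complex_of_real (dil_b A powi (- k)) = 1"
      by (simp only: of_real_mult[symmetric] of_real_1)
    then show "(dil_b A powi k) *\<^sub>R (bump k (matrix_powi A k *v y) * G (matrix_powi A k *v y))
        = gaussian y * G (matrix_powi A k *v y)"
      unfolding bump_eq matrix_powi_vector_uminus[OF invertible_A] scaleR_conv_of_real
      by (simp only: mult.assoc[symmetric] mult_1_left)
  qed
  finally show ?thesis .
qed

lemma fourier_bump: "fourier (bump k) x = fourier gaussian (matrix_powi (transpose A) k *v x)"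
proof -
  have "fourier_kernel x (M *v y) = fourier_kernel (transpose M *v x) y" for M :: "real^'n^'n" and y
    by (simp add: fourier_kernel_def dot_lmul_matrix)
  then show ?thesis
    using integral_bump[of "fourier_kernel x" k]
    by (simp add: fourier_lborel schwartz_measurable schwartz_bump schwartz_normalized_gaussian
        transpose_matrix_powi[OF invertible_A, symmetric])
qed

lemma norm_fourier_bump_le: "norm (fourier (bump k) x) \<le> 1"
  by (simp add: fourier_bump norm_fourier_gaussian_le)

section \<open>Contraction by negative powers and mollification\<close>

lemma norm_le_gauge:
  obtains K where "0 < K" "\<And>x. norm x \<le> K * norm (P *v x)"
proof -
  obtain K where K: "0 < K" "\<And>x. norm (matrix_inv P *v x) \<le> norm x * K"
    using bounded_linear.pos_bounded[of "(*v) (matrix_inv P)"] by (auto simp: matrix_vector_mul_bounded_linear)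
  have "norm x \<le> K * norm (P *v x)" for x
    using K(2)[of "P *v x"] by (simp add: matrix_inv_vector_mult[OF invertible_P] mult.commute)
  with K(1) that show ?thesis by blast
qed

lemma matrix_powi_tendsto_0: "(\<lambda>n. matrix_powi A (- int n) *v x) \<longlonglongrightarrow> 0"
proof -
  obtain K where K: "0 < K" "\<And>x. norm x \<le> K * norm (P *v x)" using norm_le_gauge by metis
  have "norm (matrix_powi A (- int n) *v x) \<le> K * norm (P *v x) * (1 / r) ^ n" for n
  proof -
    have "dil_gauge A P (int n) x * r ^ n \<le> norm (P *v x)"
      using dil_gauge_add[of 0 n x] by (simp add: dil_gauge_def)
    then have "dil_gauge A P (int n) x \<le> norm (P *v x) * (1 / r) ^ n"
      using r_gt_1 by (simp add: field_simps)
    then have "K * dil_gauge A P (int n) x \<le> K * (norm (P *v x) * (1 / r) ^ n)"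
      using K(1) by (intro mult_left_mono) auto
    then show ?thesis
      using K(2)[of "matrix_powi A (- int n) *v x"] by (simp only: dil_gauge_def mult.assoc)
  qed
  note le = this
  have "(\<lambda>n. K * norm (P *v x) * (1 / r) ^ n) \<longlonglongrightarrow> K * norm (P *v x) * 0"
    using r_gt_1 by (intro tendsto_mult_left LIMSEQ_power_zero) simp
  then have "(\<lambda>n. K * norm (P *v x) * (1 / r) ^ n) \<longlonglongrightarrow> 0"
    by simp
  then show ?thesis
    by (rule Lim_null_comparison[OF always_eventually[OF allI[OF le]]])
qed

text \<open>Uniformity in \<open>n\<close> supplies the dominating function in
  \<open>integral_pairing_bump_tendsto\<close>; \<open>1 \<le> K\<close> allows the constant to be
  pulled out of \<open>1 + norm x\<close> as well.\<close>

lemma matrix_powi_nonpos_bounded: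
  obtains K where "1 \<le> K" "\<And>n x. norm (matrix_powi A (- int n) *v x) \<le> K * norm x"
proof -
  obtain K where K: "0 < K" "\<And>x. norm x \<le> K * norm (P *v x)" using norm_le_gauge by metis
  obtain L where L: "0 < L" "\<And>x. norm (P *v x) \<le> norm x * L"
    using bounded_linear.pos_bounded[of "(*v) P"] by (auto simp: matrix_vector_mul_bounded_linear)
  have "norm (matrix_powi A (- int n) *v x) \<le> max 1 (K * L) * norm x" for n x
  proof -
    have "norm (matrix_powi A (- int n) *v x) \<le> K * dil_gauge A P (int n) x"
      using K(2) by (simp add: dil_gauge_def)
    also have "\<dots> \<le> K * dil_gauge A P 0 x"
      using K(1) by (intro mult_left_mono dil_gauge_antimono) auto
    also have "\<dots> \<le> K * (norm x * L)"
      using K(1) L(2) by (intro mult_left_mono) (auto simp: dil_gauge_def)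
    also have "\<dots> = K * L * norm x" by simp
    also have "\<dots> \<le> max 1 (K * L) * norm x" by (intro mult_right_mono) auto
    finally show ?thesis .
  qed
  then show ?thesis using that[of "max 1 (K * L)"] by simp
qed

text \<open>Exchanging the roles of \<open>w\<close> and the bump turns \<open>f\<close> tested against a mollified \<open>w\<close> into an
  average of the continuous function \<open>pairing f w\<close> around the origin, so that convergence
  of mollifications in the Schwartz topology is not needed.\<close>

lemma integral_pairing_bump_tendsto:
  assumes f: "f \<in> tempered" and w: "w \<in> schwartz"
  shows "(\<lambda>n. LINT y|lborel. pairing f (bump (- int n)) y * w y) \<longlonglongrightarrow> f w"
proof -
  let ?G = "pairing f w"
  have Gm [measurable]: "?G \<in> borel_measurable borel" by (rule measurable_pairing[OF f w])
  have gm [measurable]: "(gaussian :: real^'n \<Rightarrow> complex) \<in> borel_measurable borel"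
    by (rule schwartz_measurable[OF schwartz_normalized_gaussian])
  have eq: "(LINT y|lborel. pairing f (bump k) y * w y)
      = (LINT y|lborel. gaussian y * ?G (matrix_powi A k *v y))" for k
  proof -
    have "(LINT y|lborel. pairing f (bump k) y * w y) = f (conv_along w (\<lambda>y. y) (bump k))"
      by (subst tempered_convolution[OF f schwartz_bump])
        (simp_all add: mult.commute schwartz_measurable schwartz_rapidly_decreasing0 w)
    also have "\<dots> = f (conv_along (bump k) (\<lambda>y. y) w)"
      by (simp add: conv_along_commute schwartz_measurable schwartz_bump w)
    also have "\<dots> = (LINT y|lborel. bump k y * ?G y)"
      by (rule tempered_convolution[OF f w]) (simp_all add: schwartz_measurable schwartz_rapidly_decreasing0 schwartz_bump)
    also have "\<dots> = (LINT y|lborel. gaussian y * ?G (matrix_powi A k *v y))"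
      by (rule integral_bump[OF Gm])
    finally show ?thesis .
  qed
  obtain C m where C: "0 \<le> C" "\<And>y. cmod (?G y) \<le> C * (1 + norm y) ^ m"
    using pairing_growth[OF f w] by metis
  obtain K where K: "1 \<le> K" "\<And>n x. norm (matrix_powi A (- int n) *v x) \<le> K * norm x"
    using matrix_powi_nonpos_bounded by metis
  have "(\<lambda>n. LINT y|lborel. gaussian y * ?G (matrix_powi A (- int n) *v y)) \<longlonglongrightarrow> (LINT y|lborel. gaussian (y :: real^'n) * ?G 0)"
  proof (rule integral_dominated_convergence[where w="\<lambda>y::real^'n. (C * K ^ m) * (norm (gaussian y) * (1 + norm y) ^ m)"])
    show "integrable lborel (\<lambda>y::real^'n. (C * K ^ m) * (norm (gaussian y) * (1 + norm y) ^ m))"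
      by (intro integrable_mult_right integrable_norm_mult_power gm schwartz_rapidly_decreasing0 schwartz_normalized_gaussian)
    show "(\<lambda>y. gaussian y * ?G (matrix_powi A (- int n) *v y)) \<in> borel_measurable lborel" for n
      using gm measurable_compose[OF borel_measurable_matrix_vector_mult Gm]
      by (intro borel_measurable_times) simp_all
    show "(\<lambda>y :: real^'n. gaussian y * ?G 0) \<in> borel_measurable lborel"
      using gm by simp
    show "AE y :: real^'n in lborel. (\<lambda>n. gaussian y * ?G (matrix_powi A (- int n) *v y)) \<longlonglongrightarrow> gaussian y * ?G 0"
    proof (rule AE_I2)
      fix y :: "real^'n"
      have "isCont ?G 0"
        using continuous_pairing[OF f w] by (simp add: continuous_on_eq_continuous_at)
      then show "(\<lambda>n. gaussian y * ?G (matrix_powi A (- int n) *v y)) \<longlonglongrightarrow> gaussian y * ?G 0"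
        by (intro tendsto_mult tendsto_const isCont_tendsto_compose[of 0 ?G] matrix_powi_tendsto_0)
    qed
    show "AE y :: real^'n in lborel. norm (gaussian y * ?G (matrix_powi A (- int n) *v y))
        \<le> (C * K ^ m) * (norm (gaussian y) * (1 + norm y) ^ m)" for n
    proof (rule AE_I2)
      fix y
      have "1 + norm (matrix_powi A (- int n) *v y) \<le> K * (1 + norm y)"
        using K(2)[of n y] K(1) by (simp add: distrib_left)
      then have "(1 + norm (matrix_powi A (- int n) *v y)) ^ m \<le> (K * (1 + norm y)) ^ m"
        by (intro power_mono) auto
      then have "C * (1 + norm (matrix_powi A (- int n) *v y)) ^ m \<le> C * (K ^ m * (1 + norm y) ^ m)"
        using C(1) unfolding power_mult_distrib by (rule mult_left_mono)
      then have "cmod (?G (matrix_powi A (- int n) *v y)) \<le> C * (K ^ m * (1 + norm y) ^ m)"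
        using C(2)[of "matrix_powi A (- int n) *v y"] by linarith
      from mult_left_mono[OF this norm_ge_zero[of "gaussian y"]]
      show "norm (gaussian y * ?G (matrix_powi A (- int n) *v y)) \<le> (C * K ^ m) * (norm (gaussian y) * (1 + norm y) ^ m)"
        by (simp only: norm_mult mult_ac)
    qed
  qed
  moreover have "(LINT y|lborel. gaussian (y :: real^'n) * ?G 0) = ?G 0"
    by (simp add: integral_gaussian)
  moreover have "?G 0 = f w" by (simp add: pairing_def)
  ultimately show ?thesis by (simp only: eq)
qed

lemma fourier_pairing_bump_commute:
  assumes f: "f \<in> tempered" and int: "\<And>k. integrable lborel (pairing f (bump k))"
  shows "fourier (pairing f (bump k)) x * fourier (bump j) x
    = fourier (pairing f (bump j)) x * fourier (bump k) x"
proof -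
  have m [measurable]: "bump k \<in> borel_measurable borel" for k
    by (rule schwartz_measurable[OF schwartz_bump])
  have conv: "(LINT y|lborel. pairing f (bump k) y * bump j (x - y))
      = f (\<lambda>z. LINT y|lborel. bump j (y - x) * bump k (z - y))" for j k x
  proof -
    have s: "(\<lambda>y. bump j (y - x)) \<in> schwartz" by (rule schwartz_translate[OF schwartz_bump])
    have "f (conv_along (\<lambda>y. bump j (y - x)) (\<lambda>y. y) (bump k))
        = (LINT y|lborel. bump j (y - x) * pairing f (bump k) y)"
      by (rule tempered_convolution[OF f schwartz_bump])
        (use s in \<open>simp_all add: schwartz_measurable schwartz_rapidly_decreasing0\<close>)
    then show ?thesis
      by (simp add: conv_along_def[abs_def] bump_diff_commute[of j x] mult.commute)
  qed
  \<comment> \<open>The reflection of \<open>y\<close> to \<open>x + z - y\<close> exchanges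
    \<open>y - x\<close> with \<open>z - y\<close>, hence the roles of the two bumps.\<close>
  have "(LINT y|lborel. bump j (y - x) * bump k (z - y)) = (LINT y|lborel. bump k (y - x) * bump j (z - y))" for x z
  proof -
    have "(LINT y|lborel. (\<lambda>y. bump j (y - x) * bump k (z - y)) ((x + z) - y)) = (LINT y|lborel. bump j (y - x) * bump k (z - y))"
      by (rule lborel_integral_reflect) measurable
    then show ?thesis by (simp add: mult.commute)
  qed
  then have "(LINT y|lborel. pairing f (bump k) y * bump j (x - y))
      = (LINT y|lborel. pairing f (bump j) y * bump k (x - y))" for x
    by (simp add: conv)
  then show ?thesis
    using fourier_convolution[OF int schwartz_integrable[OF schwartz_bump], of k j x]
      fourier_convolution[OF int schwartz_integrable[OF schwartz_bump], of j k x]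
    by simp
qed

end

section \<open>The grand maximal function controls the mollifications\<close>

context dilation
begin

text \<open>Only finitely many bounds define \<open>schwartz_N\<close>, and each of the quantities
  is bounded because the quasi-norm grows at most polynomially.\<close>

lemma schwartz_N_scaled:
  assumes \<phi>: "\<phi> \<in> schwartz"
  obtains c where "0 < c" "(\<lambda>x. of_real c * \<phi> x) \<in> schwartz_N A P N"
proof -
  obtain C q where C: "0 < C" "\<And>x. step_norm A P x \<le> C * (1 + norm x) ^ q"
    using step_norm_le_power by metis
  have "\<exists>B. \<forall>x. step_norm A P x ^ l * cmod (partials is \<phi> x) \<le> B" for l "is"
  proof -
    obtain D where D: "\<And>x. (1 + norm x) ^ (q * l) * norm (partials is \<phi> x) \<le> D"
      using rapidly_decreasingE[OF schwartz_rapidly_decreasing[OF \<phi>]] by metis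
    have "step_norm A P x ^ l * cmod (partials is \<phi> x) \<le> C ^ l * D" for x
    proof -
      have "step_norm A P x ^ l \<le> (C * (1 + norm x) ^ q) ^ l"
        by (intro power_mono C step_norm_nonneg)
      then have "step_norm A P x ^ l * cmod (partials is \<phi> x) \<le> (C * (1 + norm x) ^ q) ^ l * cmod (partials is \<phi> x)"
        by (rule mult_right_mono) simp
      also have "\<dots> = C ^ l * ((1 + norm x) ^ (q * l) * norm (partials is \<phi> x))"
        by (simp add: power_mult_distrib power_mult)
      also have "\<dots> \<le> C ^ l * D"
        using C(1) by (intro mult_left_mono D) auto
      finally show ?thesis .
    qed
    then show ?thesis by blast
  qed
  then obtain B where B: "\<And>l is x. step_norm A P x ^ l * cmod (partials is \<phi> x) \<le> B l is"
    by metis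
  let ?L = "{is :: 'n list. length is \<le> N}"
  have fin: "finite ?L"
    using finite_lists_length_le[of "UNIV :: 'n set" N] by simp
  \<comment> \<open>A common bound for all these quantities. Dividing by \<open>1 + T\<close> rather
    than \<open>T\<close> avoids a zero denominator.\<close>
  define T where "T = (\<Sum>is\<in>?L. \<Sum>l\<le>N. \<bar>B l is\<bar>)"
  have T0: "0 \<le> T" unfolding T_def by (intro sum_nonneg) auto
  have BT: "B l is \<le> T" if "length is \<le> N" "l \<le> N" for l "is"
  proof -
    have "B l is \<le> \<bar>B l is\<bar>" by simp
    also have "\<dots> \<le> (\<Sum>l\<le>N. \<bar>B l is\<bar>)"
      using that by (intro member_le_sum) auto
    also have "\<dots> \<le> T"
      unfolding T_def using that fin
      by (intro member_le_sum[where f="\<lambda>is. \<Sum>l\<le>N. \<bar>B l is\<bar>"] sum_nonneg) auto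
    finally show ?thesis .
  qed
  have "(\<lambda>x. of_real (1 / (1 + T)) * \<phi> x) \<in> schwartz_N A P N"
    unfolding schwartz_N_def
  proof (intro CollectI conjI schwartz_cmult \<phi> allI impI)
    fix "is" :: "'n list" and l x
    assume "length is \<le> N" "l \<le> N"
    then have "step_norm A P x ^ l * cmod (partials is \<phi> x) \<le> 1 + T"
      using B[of x l "is"] BT[of "is" l] by linarith
    moreover have "cmod (partials is (\<lambda>x. of_real (1 / (1 + T)) * \<phi> x) x) = cmod (partials is \<phi> x) / (1 + T)"
      unfolding partials_cmult[OF \<phi>] norm_mult norm_of_real using T0 by simp
    ultimately show "step_norm A P x ^ l * cmod (partials is (\<lambda>x. of_real (1 / (1 + T)) * \<phi> x) x) \<le> 1"
      using T0 by simp
  qed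
  then show ?thesis
    using that[of "1 / (1 + T)"] T0 by simp
qed

text \<open>The balls are symmetric, so \<open>y\<close> belongs to the ball around
  \<open>y + z\<close> and is one of the points over which the maximal function at
  \<open>y + z\<close> takes its supremum.\<close>

lemma pairing_bump_le_grand_maximal:
  assumes f: "f \<in> tempered" and c: "0 < c" "(\<lambda>x. of_real c * gaussian x) \<in> schwartz_N A P N"
    and z: "z \<in> dil_ball A P k"
  shows "ennreal (c * cmod (pairing f (bump k) y)) \<le> grand_maximal A P N f (y + z)"
proof -
  have "dilate A k (\<lambda>x. of_real c * gaussian x) = (\<lambda>x. of_real c * bump k x)"
    by (simp add: dilate_def fun_eq_iff)
  then have "dist_conv f (dilate A k (\<lambda>x. of_real c * gaussian x)) y = f (\<lambda>z. of_real c * bump k (z - y))"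
    by (simp add: dist_conv_def bump_diff_commute[of k y])
  also have "\<dots> = of_real c * pairing f (bump k) y"
    unfolding pairing_def by (intro tempered_cmult f schwartz_translate schwartz_bump)
  finally have eq: "cmod (dist_conv f (dilate A k (\<lambda>x. of_real c * gaussian x)) y)
      = c * cmod (pairing f (bump k) y)"
    using c by (simp add: norm_mult)
  have "- z \<in> dil_ball A P k"
    using z by (simp add: mem_dil_ball dil_gauge_uminus)
  then have y: "y \<in> (\<lambda>v. (y + z) + v) ` dil_ball A P k"
    by (intro image_eqI[of _ _ "- z"]) simp_all
  show ?thesis
    unfolding grand_maximal_def eq[symmetric]
    by (rule SUP_upper2[OF c(2)], rule SUP_upper2[OF UNIV_I[of k]], rule SUP_upper[OF y])
qed

text \<open>The factor from \<open>nn_integral_le_if_le_maximal\<close> for the ball of scale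
  \<open>k\<close>, whose volume is \<open>dil_b A powi k\<close>.\<close>

definition exponent_weight :: "real \<Rightarrow> real \<Rightarrow> int \<Rightarrow> real" where
  "exponent_weight pm pp k = max ((dil_b A powi k) powr (1 - 1 / pm)) ((dil_b A powi k) powr (1 - 1 / pp))"

text \<open>The bound is stated for every admissible \<open>s\<close>, so that the passage to the
  infimum can wait until the final estimate. The constant \<open>c\<close> enters because only a
  multiple of the Gaussian is normalized for the maximal function.\<close>

lemma integrable_pairing_bump:
  assumes f: "f \<in> hardy A P N p" and p: "p \<in> variable_exponents" "p_plus p \<le> 1"
    and c: "0 < c" "(\<lambda>x. of_real c * gaussian x) \<in> schwartz_N A P N"
    and s: "0 < s" "Lp_modular p (\<lambda>x. grand_maximal A P N f x / ennreal s) \<le> 1"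
  defines "pm \<equiv> real_of_ereal (p_minus p)" and "pp \<equiv> real_of_ereal (p_plus p)"
  shows "integrable lborel (pairing f (bump k))"
    and "(LINT y|lborel. norm (pairing f (bump k) y)) \<le> s * exponent_weight pm pp k / c"
proof -
  let ?g = "pairing f (bump k)"
  let ?W = "exponent_weight pm pp k"
  have ft: "f \<in> tempered" and M: "grand_maximal A P N f \<in> borel_measurable lebesgue"
    using f by (auto simp: hardy_def variable_Lp_def)
  have gm [measurable]: "?g \<in> borel_measurable borel"
    by (rule measurable_pairing[OF ft schwartz_bump])
  have W0: "0 \<le> ?W" by (simp add: exponent_weight_def le_max_iff_disj)
  have "(\<integral>\<^sup>+y. ennreal (c * cmod (?g y)) \<partial>lebesgue) \<le> ennreal (s * ?W)"
    unfolding exponent_weight_def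
  proof (rule nn_integral_le_if_le_maximal)
    show "p \<in> borel_measurable lebesgue" using p by (simp add: variable_exponents_def)
    show "grand_maximal A P N f \<in> borel_measurable lebesgue" by (rule M)
    show "(\<lambda>y. c * cmod (?g y)) \<in> borel_measurable lebesgue"
      by (rule measurable_completion) measurable
    show "0 < pm" "pm \<le> pp" "pp \<le> 1" "AE x in lebesgue. pm \<le> p x \<and> p x \<le> pp"
      unfolding pm_def pp_def using p_minus_p_plus_bounds[OF p] by auto
    show "dil_ball A P k \<in> lmeasurable" by (rule dil_ball_lmeasurable)
    show "measure lebesgue (dil_ball A P k) = dil_b A powi k" by (rule measure_dil_ball)
    show "0 < dil_b A powi k" using dil_b_gt_1 by simp
    show "0 \<in> dil_ball A P k" by (simp add: mem_dil_ball dil_gauge_def)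
    show "0 \<le> c * cmod (?g y)" for y using c by simp
    show "ennreal (c * cmod (?g y)) \<le> grand_maximal A P N f (y + z)" if "z \<in> dil_ball A P k" for y z
      by (rule pairing_bump_le_grand_maximal[OF ft c that])
  qed (rule s)+
  then have le: "(\<integral>\<^sup>+y. ennreal (c * cmod (?g y)) \<partial>lborel) \<le> ennreal (s * ?W)"
    by (simp add: nn_integral_completion)
  have int: "integrable lborel (\<lambda>y. c * cmod (?g y))"
    by (rule integrableI_nonneg) (use c le in \<open>auto intro: le_less_trans\<close>)
  then have "integrable lborel (\<lambda>y. (1 / c) * (c * cmod (?g y)))"
    by (rule integrable_mult_right)
  then show "integrable lborel ?g"
    using c by (simp add: integrable_norm_iff)
  have "ennreal (LINT y|lborel. c * cmod (?g y)) \<le> ennreal (s * ?W)"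
    using nn_integral_eq_integral[OF int] c le by simp
  then have "(LINT y|lborel. c * cmod (?g y)) \<le> s * ?W"
    using s W0 by (simp add: ennreal_le_iff)
  then show "(LINT y|lborel. norm (?g y)) \<le> s * ?W / c"
    using c by (simp add: field_simps)
qed

lemma Lp_modular_grand_maximal_scaled:
  assumes f: "f \<in> hardy A P N p" and p: "p \<in> variable_exponents" "p_plus p \<le> 1"
  obtains s where "0 < s" "Lp_modular p (\<lambda>x. grand_maximal A P N f x / ennreal s) \<le> 1"
proof (rule Lp_modular_scaled_le_1)
  show "grand_maximal A P N f \<in> variable_Lp p" using f by (simp add: hardy_def)
  show "p \<in> borel_measurable lebesgue" using p by (simp add: variable_exponents_def)
  show "0 < real_of_ereal (p_minus p)" by (rule p_minus_p_plus_bounds(1)[OF p])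
  show "AE x in lebesgue. real_of_ereal (p_minus p) \<le> p x"
    using p_minus_p_plus_bounds(4)[OF p] by eventually_elim simp
qed (rule that)

end

section \<open>The Fourier transform as a function\<close>

text \<open>The frequency side has an ellipsoid and a ratio of its own. The two sides meet only in
  \<open>fourier_bump\<close>, where powers of \<open>A\<close> become powers of its
  transpose.\<close>

locale dual_dilation = dilation A P r + dual: dilation "transpose A" P' r'
  for A P P' :: "real^'n^'n" and r r' :: real
begin

lemma isCont_fourier_gaussian_0: "isCont (fourier gaussian) (0 :: real^'n)"
proof -
  have "continuous_on UNIV (fourier gaussian :: real^'n \<Rightarrow> complex)"
    by (intro continuous_fourier schwartz_integrable schwartz_normalized_gaussian)
  then show ?thesis by (simp add: continuous_on_eq_continuous_at)
qed

text \<open>The shift \<open>m0\<close> is uniform in \<open>j\<close> and \<open>x\<close>. The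
  transform of the Gaussian is within 1/2 of 1 on a ball of radius \<delta>; a dual gauge below 1
  confines the rescaled point to norm below \<open>K\<close>, and \<open>m0\<close> further
  contractions bring \<open>K\<close> below \<delta>.\<close>

lemma norm_fourier_bump_ge_half:
  obtains m0 :: nat where
    "\<And>j x. dil_gauge (transpose A) P' j x < 1 \<Longrightarrow> 1 / 2 \<le> norm (fourier (bump (- (j + int m0))) x)"
proof -
  obtain K where K: "0 < K" "\<And>x. norm x \<le> K * norm (P' *v x)"
    using dual.norm_le_gauge by metis
  obtain \<delta> where \<delta>: "0 < \<delta>" "\<And>x::real^'n. norm x < \<delta> \<Longrightarrow> norm (fourier gaussian x - 1) < 1 / 2"
    using isCont_fourier_gaussian_0[unfolded continuous_at_eps_delta, rule_format, of "1 / 2"]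
    by (auto simp: dist_norm fourier_gaussian_0)
  obtain m0 where m0: "K / \<delta> < r' ^ m0"
    using real_arch_pow[OF dual.r_gt_1] by blast
  have "1 / 2 \<le> norm (fourier (bump (- (j + int m0))) x)" if g: "dil_gauge (transpose A) P' j x < 1" for j x
  proof -
    let ?y = "matrix_powi (transpose A) (- (j + int m0)) *v x"
    have rp: "0 < r' ^ m0" using dual.r_gt_1 by simp
    have "norm ?y * r' ^ m0 \<le> K * (dil_gauge (transpose A) P' (j + int m0) x * r' ^ m0)"
      using K(2)[of ?y] rp by (simp add: dil_gauge_def mult.assoc[symmetric])
    also have "\<dots> \<le> K * dil_gauge (transpose A) P' j x"
      using K(1) dual.dil_gauge_add[of j m0 x] by simp
    also have "\<dots> < K" using g K(1) by simp
    also have "\<dots> < \<delta> * r' ^ m0" using m0 \<delta>(1) by (simp add: field_simps)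
    finally have "norm ?y < \<delta>" using rp by simp
    from \<delta>(2)[OF this] have "norm (fourier gaussian ?y - 1) < 1 / 2" .
    then have "1 / 2 \<le> norm (fourier gaussian ?y)"
      using norm_triangle_ineq2[of 1 "1 - fourier gaussian ?y"] by (simp add: norm_minus_commute)
    then show ?thesis by (simp add: fourier_bump)
  qed
  then show ?thesis using that by blast
qed

lemma dual_gauge_lt_1: "\<exists>j. dil_gauge (transpose A) P' j x < 1"
proof (cases "x = 0")
  case True
  then show ?thesis by (simp add: dil_gauge_def)
next
  case False
  then show ?thesis using dual.step_norm_eq by metis
qed

text \<open>The scale is chosen separately at each \<open>x\<close>. By
  \<open>fourier_pairing_bump\<close> every admissible scale yields the same value.\<close>

definition fourier_quotient :: "((real^'n \<Rightarrow> complex) \<Rightarrow> complex) \<Rightarrow> real^'n \<Rightarrow> complex" where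
  "fourier_quotient f x = (let k = SOME k. fourier (bump k) x \<noteq> 0
    in fourier (pairing f (bump k)) x / fourier (bump k) x)"

context
  fixes f :: "(real^'n \<Rightarrow> complex) \<Rightarrow> complex"
  assumes f: "f \<in> tempered" and int: "\<And>k. integrable lborel (pairing f (bump k))"
begin

text \<open>Multiplied out, the relation also covers scales at which the transform of the bump
  vanishes at \<open>x\<close>: it is \<open>fourier_pairing_bump_commute\<close> against the chosen
  scale.\<close>

lemma fourier_pairing_bump:
  "fourier (pairing f (bump k)) x = fourier_quotient f x * fourier (bump k) x"
proof -
  obtain m0 :: nat where
    "\<And>j x. dil_gauge (transpose A) P' j x < 1 \<Longrightarrow> 1 / 2 \<le> norm (fourier (bump (- (j + int m0))) x)"
    using norm_fourier_bump_ge_half by metis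
  then have "\<exists>k. fourier (bump k) x \<noteq> 0"
    using dual_gauge_lt_1[of x] by (metis norm_zero not_one_le_zero divide_le_0_1_iff zero_less_numeral not_le half_gt_zero_iff zero_less_one)
  then have "fourier (bump (SOME k. fourier (bump k) x \<noteq> 0)) x \<noteq> 0"
    by (rule someI_ex)
  then show ?thesis
    using fourier_pairing_bump_commute[OF f int, of "SOME k. fourier (bump k) x \<noteq> 0" x k]
    by (simp add: fourier_quotient_def Let_def field_simps)
qed

text \<open>Near a given point one scale suffices: the set where the transform of that bump does not
  vanish is open, and there the function is a quotient of continuous transforms.\<close>

lemma continuous_fourier_quotient: "continuous_on UNIV (fourier_quotient f)"
proof -
  obtain m0 :: nat where m0:
    "\<And>j x. dil_gauge (transpose A) P' j x < 1 \<Longrightarrow> 1 / 2 \<le> norm (fourier (bump (- (j + int m0))) x)"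
    using norm_fourier_bump_ge_half by metis
  have "isCont (fourier_quotient f) x" for x
  proof -
    obtain j where "dil_gauge (transpose A) P' j x < 1" using dual_gauge_lt_1 by blast
    define k where "k = - (j + int m0)"
    have nz: "fourier (bump k) x \<noteq> 0"
      using m0[OF \<open>dil_gauge (transpose A) P' j x < 1\<close>] by (auto simp: k_def)
    have c: "continuous_on UNIV (fourier (bump k))" "continuous_on UNIV (fourier (pairing f (bump k)))"
      by (intro continuous_fourier schwartz_integrable schwartz_bump int)+
    let ?U = "{x. fourier (bump k) x \<noteq> 0}"
    have U: "open ?U"
      using c(1) by (intro open_Collect_neq continuous_on_const)
    have "continuous_on ?U (\<lambda>x. fourier (pairing f (bump k)) x / fourier (bump k) x)"
      using c by (intro continuous_on_divide) (auto intro: continuous_on_subset)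
    moreover have "fourier (pairing f (bump k)) y / fourier (bump k) y = fourier_quotient f y" if "y \<in> ?U" for y
      using that by (simp add: fourier_pairing_bump)
    ultimately have "continuous_on ?U (fourier_quotient f)"
      by (rule continuous_on_eq)
    then show ?thesis
      using U nz by (simp add: continuous_on_eq_continuous_at)
  qed
  then show ?thesis by (simp add: continuous_on_eq_continuous_at)
qed

text \<open>By duality, testing a mollification against \<open>fourier \<psi>\<close> inserts the
  transform of the bump into the integral of the quotient against \<psi>. That factor is bounded by
  1 and tends to 1; the growth assumption supplies the integrable majorant.\<close>

lemma tempered_fourier_eq_fourier_quotient:
  assumes growth: "\<And>x. norm (fourier_quotient f x) \<le> D * (1 + norm x) ^ q"
  shows "dist_eq_fun (dist_fourier f) (fourier_quotient f)"
  unfolding dist_eq_fun_def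
proof (intro ballI conjI)
  fix \<psi> :: "real^'n \<Rightarrow> complex" assume \<psi>: "\<psi> \<in> schwartz"
  let ?F = "fourier_quotient f"
  have Fm [measurable]: "?F \<in> borel_measurable borel"
    by (intro borel_measurable_continuous_onI continuous_fourier_quotient)
  have pm [measurable]: "\<psi> \<in> borel_measurable borel" by (rule schwartz_measurable[OF \<psi>])
  have bm [measurable]: "fourier (bump k) \<in> borel_measurable borel" for k
    by (intro borel_measurable_continuous_onI continuous_fourier schwartz_integrable schwartz_bump)
  have "integrable lborel (\<lambda>x. \<psi> x * ?F x)"
    by (rule integrable_rapidly_decreasing_mult[OF pm Fm schwartz_rapidly_decreasing0[OF \<psi>] growth])
  then have intF: "integrable lborel (\<lambda>x. ?F x * \<psi> x)" by (simp add: mult.commute)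
  then show "integrable lebesgue (\<lambda>x. ?F x * \<psi> x)"
    by (subst integrable_completion) simp_all
  have "(\<lambda>n. LINT y|lborel. pairing f (bump (- int n)) y * fourier \<psi> y) \<longlonglongrightarrow> f (fourier \<psi>)"
    by (rule integral_pairing_bump_tendsto[OF f schwartz_fourier[OF \<psi>]])
  moreover have "(LINT y|lborel. pairing f (bump k) y * fourier \<psi> y)
      = (LINT x|lborel. ?F x * fourier (bump k) x * \<psi> x)" for k
    by (simp add: fourier_duality[OF int schwartz_integrable[OF \<psi>]] fourier_pairing_bump)
  moreover have "(\<lambda>n. LINT x|lborel. ?F x * fourier (bump (- int n)) x * \<psi> x) \<longlonglongrightarrow> (LINT x|lborel. ?F x * \<psi> x)"
  proof (rule integral_dominated_convergence[where w="\<lambda>x. norm (?F x * \<psi> x)"])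
    show "AE x in lborel. (\<lambda>n. ?F x * fourier (bump (- int n)) x * \<psi> x) \<longlonglongrightarrow> ?F x * \<psi> x"
    proof (rule AE_I2)
      fix x
      have "(\<lambda>n. fourier gaussian (matrix_powi (transpose A) (- int n) *v x)) \<longlonglongrightarrow> fourier gaussian (0 :: real^'n)"
        by (rule isCont_tendsto_compose[OF isCont_fourier_gaussian_0 dual.matrix_powi_tendsto_0])
      then have "(\<lambda>n. fourier (bump (- int n)) x) \<longlonglongrightarrow> 1"
        by (simp add: fourier_bump fourier_gaussian_0)
      then have "(\<lambda>n. ?F x * fourier (bump (- int n)) x * \<psi> x) \<longlonglongrightarrow> ?F x * 1 * \<psi> x"
        by (intro tendsto_intros)
      then show "(\<lambda>n. ?F x * fourier (bump (- int n)) x * \<psi> x) \<longlonglongrightarrow> ?F x * \<psi> x" by simp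
    qed
    show "AE x in lborel. norm (?F x * fourier (bump (- int n)) x * \<psi> x) \<le> norm (?F x * \<psi> x)" for n
    proof (rule AE_I2)
      fix x
      have "norm (?F x) * norm (fourier (bump (- int n)) x) * norm (\<psi> x) \<le> norm (?F x) * 1 * norm (\<psi> x)"
        by (intro mult_right_mono mult_left_mono norm_fourier_bump_le) auto
      then show "norm (?F x * fourier (bump (- int n)) x * \<psi> x) \<le> norm (?F x * \<psi> x)"
        by (simp add: norm_mult)
    qed
    show "integrable lborel (\<lambda>x. norm (?F x * \<psi> x))" by (rule integrable_norm[OF intF])
    show "(\<lambda>x. ?F x * \<psi> x) \<in> borel_measurable lborel" by measurable
    show "(\<lambda>x. ?F x * fourier (bump (- int n)) x * \<psi> x) \<in> borel_measurable lborel" for n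
      using Fm bm[of "- int n"] pm by (intro borel_measurable_times) simp_all
  qed
  ultimately have "f (fourier \<psi>) = (LINT x|lborel. ?F x * \<psi> x)"
    by (metis (no_types, lifting) LIMSEQ_unique ext)
  also have "\<dots> = (LINT x|lebesgue. ?F x * \<psi> x)"
    by (rule integral_completion[symmetric]) measurable
  finally show "dist_fourier f \<psi> = (LINT x|lebesgue. ?F x * \<psi> x)"
    by (simp add: dist_fourier_def)
qed

lemma norm_fourier_quotient_le:
  assumes "1 / 2 \<le> norm (fourier (bump k) x)"
  shows "norm (fourier_quotient f x) \<le> 2 * (LINT y|lborel. norm (pairing f (bump k) y))"
proof -
  have "norm (fourier_quotient f x) * (1 / 2) \<le> norm (fourier_quotient f x) * norm (fourier (bump k) x)"
    using assms by (intro mult_left_mono) auto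
  also have "\<dots> \<le> (LINT y|lborel. norm (pairing f (bump k) y))"
    using norm_fourier_le[OF int, of k x] by (simp add: fourier_pairing_bump norm_mult)
  finally show ?thesis by simp
qed

end

section \<open>Exponent weights against the dual quasi-norm\<close>

lemma exponent_weight_uminus:
  "exponent_weight pm pp (- i) = max (dil_b A powr (of_int i * (1 / pm - 1))) (dil_b A powr (of_int i * (1 / pp - 1)))"
proof -
  have b: "0 < dil_b A" using dil_b_gt_1 by simp
  have "dil_b A powi (- i) = dil_b A powr (of_int (- i))"
    using b powr_real_of_int'[of "dil_b A" "- i"] by simp
  moreover have "of_int (- i) * (1 - 1 / q) = of_int i * (1 / q - 1)" for q :: real
    by (simp add: algebra_simps)
  ultimately show ?thesis
    by (simp only: exponent_weight_def powr_powr)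
qed

text \<open>The dual gauge of \<open>x\<close> is below 1 at \<open>i + 1\<close> and not at
  \<open>i\<close>, and \<open>m0\<close> more steps secure the lower bound on the bump. These
  \<open>1 + m0\<close> steps cost a fixed power of the determinant, the larger one being that for
  \<open>pm\<close>.\<close>

lemma exponent_weight_step_norm_le:
  assumes "x \<noteq> 0" and a: "0 \<le> 1 / pp - 1" "1 / pp - 1 \<le> 1 / pm - 1"
    and i: "step_norm (transpose A) P' x = dil_b (transpose A) powi i"
  shows "exponent_weight pm pp (- (i + 1 + int m0)) \<le> dil_b A powr ((1 + real m0) * (1 / pm - 1))
    * max (rpow (step_norm (transpose A) P' x) (1 / pm - 1)) (rpow (step_norm (transpose A) P' x) (1 / pp - 1))"
proof -
  let ?\<rho> = "step_norm (transpose A) P' x"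
  let ?a = "1 / pm - 1" and ?a' = "1 / pp - 1"
  have b: "1 < dil_b A" by (rule dil_b_gt_1)
  have \<rho>: "?\<rho> = dil_b A powr (of_int i)"
  proof -
    have "dil_b (transpose A) = dil_b A" by (simp add: dil_b_def)
    then show ?thesis
      using i b powr_real_of_int'[of "dil_b A" i] by simp
  qed
  have rp: "rpow ?\<rho> c = dil_b A powr (of_int i * c)" for c
    using b by (simp add: rpow_def \<rho> powr_powr)
  have split: "dil_b A powr (of_int (i + 1 + int m0) * c) = dil_b A powr ((1 + real m0) * c) * dil_b A powr (of_int i * c)" for c
    by (simp add: powr_add[symmetric] algebra_simps)
  have "dil_b A powr ((1 + real m0) * ?a') \<le> dil_b A powr ((1 + real m0) * ?a)"
    using b a by (intro powr_mono mult_left_mono) auto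
  then have "dil_b A powr ((1 + real m0) * ?a') * dil_b A powr (of_int i * ?a')
      \<le> dil_b A powr ((1 + real m0) * ?a) * max (dil_b A powr (of_int i * ?a)) (dil_b A powr (of_int i * ?a'))"
    by (intro mult_mono) auto
  moreover have "dil_b A powr ((1 + real m0) * ?a) * dil_b A powr (of_int i * ?a)
      \<le> dil_b A powr ((1 + real m0) * ?a) * max (dil_b A powr (of_int i * ?a)) (dil_b A powr (of_int i * ?a'))"
    by (intro mult_left_mono) auto
  ultimately show ?thesis
    unfolding exponent_weight_uminus rp split by (rule max.boundedI[rotated])
qed

text \<open>Meant for the origin: when \<open>pp\<close> is below 1 the claimed bound there is 0,
  and it is reached by letting the scale grow.\<close>

lemma exponent_weight_tendsto_0:
  assumes a: "0 < 1 / pp - 1" "1 / pp - 1 \<le> 1 / pm - 1"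
  shows "(\<lambda>n. exponent_weight pm pp (int n)) \<longlonglongrightarrow> 0"
proof -
  have b: "1 < dil_b A" by (rule dil_b_gt_1)
  have lim: "(\<lambda>n. dil_b A powr (of_int (- int n) * c)) \<longlonglongrightarrow> 0" if c: "0 < c" for c
  proof -
    have "dil_b A powr (of_int (- int n) * c) = (dil_b A powr (- c)) ^ n" for n
      using b by (simp add: powr_power mult.commute)
    moreover have "(\<lambda>n. (dil_b A powr (- c)) ^ n) \<longlonglongrightarrow> 0"
      using b c by (intro LIMSEQ_power_zero) (simp add: powr_less_one)
    ultimately show ?thesis by simp
  qed
  have "(\<lambda>n. max (dil_b A powr (of_int (- int n) * (1 / pm - 1))) (dil_b A powr (of_int (- int n) * (1 / pp - 1)))) \<longlonglongrightarrow> max 0 0"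
    using a by (intro tendsto_max lim) auto
  then show ?thesis
    using exponent_weight_uminus[of pm pp "- int n" for n] by simp
qed

end

theorem theorem3p1:
  fixes A P P' :: "real^'n^'n"
    and r r' lambda :: real
    and p :: "real^'n \<Rightarrow> real"
    and N :: nat
  assumes "expansive_dilation A"
    and "lower_exponent A lambda"
    and "dilation_ellipsoid A r P"
    and "dilation_ellipsoid (transpose A) r' P'"
    and "p \<in> C_log A P"
    and "0 < p_minus p" and "p_minus p \<le> p_plus p" and "p_plus p \<le> 1"
    and "int N \<ge> \<lfloor>(1 / p_under p - 1) * ln (dil_b A) / ln lambda\<rfloor> + 2"
  shows "\<exists>C>0. \<forall>f\<in>hardy A P N p. \<exists>F :: real^'n \<Rightarrow> complex.
           continuous_on UNIV F \<and>
           dist_eq_fun (dist_fourier f) F \<and>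
           (\<forall>x. cmod (F x) \<le> C * hardy_norm A P N p f *
                  max (rpow (step_norm (transpose A) P' x) (1 / real_of_ereal (p_minus p) - 1))
                      (rpow (step_norm (transpose A) P' x) (1 / real_of_ereal (p_plus p) - 1)))"
proof -
  interpret dual_dilation A P P' r r'
    by unfold_locales (rule assms)+
  define pm where "pm = real_of_ereal (p_minus p)"
  define pp where "pp = real_of_ereal (p_plus p)"
  have p: "p \<in> variable_exponents" using assms(5) by (simp add: C_log_def)
  have pb: "0 < pm" "pm \<le> pp" "pp \<le> 1"
    unfolding pm_def pp_def using p_minus_p_plus_bounds[OF p assms(8)] by auto
  have a: "0 \<le> 1 / pp - 1" "1 / pp - 1 \<le> 1 / pm - 1"
    using pb by (simp_all add: frac_le)
  define R where "R x = max (rpow (step_norm (transpose A) P' x) (1 / pm - 1))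
    (rpow (step_norm (transpose A) P' x) (1 / pp - 1))" for x
  obtain c where c: "0 < c" "(\<lambda>x. of_real c * gaussian x) \<in> schwartz_N A P N"
    using schwartz_N_scaled[OF schwartz_normalized_gaussian] by metis
  obtain m0 :: nat where m0:
    "\<And>j x. dil_gauge (transpose A) P' j x < 1 \<Longrightarrow> 1 / 2 \<le> norm (fourier (bump (- (j + int m0))) x)"
    using norm_fourier_bump_ge_half by metis
  \<comment> \<open>The 2 undoes the lower bound 1/2 on the transform of the bump,
    \<open>1 / c\<close> the normalization of the Gaussian, and the power pays for the shift by
    \<open>1 + m0\<close> scales.\<close>
  define C where "C = 2 / c * dil_b A powr ((1 + real m0) * (1 / pm - 1))"
  have C1: "2 / c \<le> C"
  proof -
    have "1 \<le> dil_b A powr ((1 + real m0) * (1 / pm - 1))"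
      using dil_b_gt_1 a by (intro ge_one_powr_ge_zero) auto
    then show ?thesis using c by (simp add: C_def field_simps)
  qed
  have C0: "0 < C" using C1 c(1) by (meson divide_pos_pos less_le_trans zero_less_numeral)
  have "continuous_on UNIV (fourier_quotient f) \<and> dist_eq_fun (dist_fourier f) (fourier_quotient f) \<and>
      (\<forall>x. cmod (fourier_quotient f x) \<le> C * hardy_norm A P N p f * R x)"
    if f: "f \<in> hardy A P N p" for f
  proof -
    let ?F = "fourier_quotient f"
    let ?S = "{s::real. 0 < s \<and> Lp_modular p (\<lambda>x. grand_maximal A P N f x / ennreal s) \<le> 1}"
    have ft: "f \<in> tempered" using f by (simp add: hardy_def)
    obtain s0 where s0: "s0 \<in> ?S"
      using Lp_modular_grand_maximal_scaled[OF f p assms(8)] by blast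
    have int: "integrable lborel (pairing f (bump k))" for k
      using integrable_pairing_bump(1)[OF f p assms(8) c] s0 by blast
    have F_le: "cmod (?F x) \<le> 2 / c * s * exponent_weight pm pp (- (j + int m0))"
      if s: "s \<in> ?S" and j: "dil_gauge (transpose A) P' j x < 1" for s j x
      using norm_fourier_quotient_le[OF ft int m0[OF j]] s
        integrable_pairing_bump(2)[OF f p assms(8) c, of s "- (j + int m0)"]
      by (simp add: pm_def pp_def)
    have bound: "cmod (?F x) \<le> C * s * R x" if s: "s \<in> ?S" for s x
    proof (cases "x = 0")
      case False
      then obtain i where i: "dil_gauge (transpose A) P' (i + 1) x < 1"
        "step_norm (transpose A) P' x = dil_b (transpose A) powi i"
        using dual.step_norm_eq by metis
      have "cmod (?F x) \<le> 2 / c * s * exponent_weight pm pp (- (i + 1 + int m0))"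
        by (rule F_le[OF s i(1)])
      also have "\<dots> \<le> 2 / c * s * (dil_b A powr ((1 + real m0) * (1 / pm - 1)) * R x)"
        unfolding R_def using s c
        by (intro mult_left_mono[OF exponent_weight_step_norm_le[OF False a i(2)]]) auto
      finally show ?thesis by (simp add: C_def mult_ac)
    next
      case True
      \<comment> \<open>At the origin all dual gauges are 0, so every scale \<open>k\<close> may be
        used. If \<open>pp = 1\<close>, the convention of \<open>rpow\<close> makes
        \<open>R x\<close> at least 1 and \<open>k = 0\<close> suffices; otherwise large
        \<open>k\<close> force the value 0.\<close>
      have g0: "dil_gauge (transpose A) P' j x < 1" for j
        using True by (simp add: dil_gauge_def)
      have F_le0: "cmod (?F x) \<le> 2 / c * s * exponent_weight pm pp k" for k
        using F_le[OF s g0[of "- k - int m0"]] by simp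
      show ?thesis
      proof (cases "1 / pp - 1 = 0")
        case True
        then have "1 \<le> R x" by (simp add: R_def rpow_def)
        moreover have "exponent_weight pm pp 0 = 1" by (simp add: exponent_weight_def)
        ultimately have "cmod (?F x) \<le> 2 / c * s * 1" using F_le0[of 0] by simp
        also have "\<dots> \<le> C * s * R x"
          using \<open>1 \<le> R x\<close> C1 C0 s by (intro mult_mono) auto
        finally show ?thesis .
      next
        case False
        have "(\<lambda>n. 2 / c * s * exponent_weight pm pp (int n)) \<longlonglongrightarrow> 2 / c * s * 0"
        proof (intro tendsto_mult_left exponent_weight_tendsto_0 a(2))
          show "0 < 1 / pp - 1" using False a(1) by linarith
        qed
        then have "cmod (?F x) \<le> 2 / c * s * 0"
          by (rule LIMSEQ_le_const) (use F_le0 in blast)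
        moreover have "0 \<le> R x" by (simp add: R_def rpow_def le_max_iff_disj)
        then have "0 \<le> C * s * R x"
          using C0 s by (intro mult_nonneg_nonneg) auto
        ultimately show ?thesis by simp
      qed
    qed
    have R0: "0 \<le> R x" for x by (simp add: R_def rpow_def le_max_iff_disj)
    \<comment> \<open>The passage to the infimum divides by \<open>C * R x\<close>; where
      \<open>R x\<close> vanishes, a single admissible scaling already gives the value 0.\<close>
    have "cmod (?F x) \<le> C * hardy_norm A P N p f * R x" for x
    proof (cases "R x = 0")
      case True
      then show ?thesis using bound[OF s0, of x] by simp
    next
      case False
      then have CR: "0 < C * R x" using C0 R0[of x] by simp
      have "cmod (?F x) / (C * R x) \<le> Inf ?S"
      proof (rule cInf_greatest)
        show "?S \<noteq> {}" using s0 by blast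
        show "cmod (?F x) / (C * R x) \<le> s" if "s \<in> ?S" for s
          using bound[OF that, of x] CR by (simp add: pos_divide_le_eq mult_ac)
      qed
      then show ?thesis
        using CR by (simp add: hardy_norm_def Lp_norm_def pos_divide_le_eq mult_ac)
    qed
    moreover obtain D q where "\<And>x. cmod (?F x) \<le> D * (1 + norm x) ^ q"
    proof -
      obtain K q where K: "0 < K" "\<And>x. step_norm (transpose A) P' x \<le> K * (1 + norm x) ^ q"
        using dual.step_norm_le_power by metis
      \<comment> \<open>A natural number above both exponents in \<open>R\<close>. Replacing the
        quasi-norm by its maximum with 1 makes its powers increase with the exponent, so the
        \<open>l\<close>-th power dominates and yields polynomial growth.\<close>
      obtain l :: nat where l: "1 / pm - 1 \<le> real l" using real_arch_simple by blast
      have "R x \<le> (1 + K) ^ l * (1 + norm x) ^ (q * l)" for x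
      proof -
        let ?\<rho> = "step_norm (transpose A) P' x"
        have one: "1 \<le> (1 + norm x) ^ q" by simp
        have "1 \<le> (1 + K) * (1 + norm x) ^ q"
          using mult_mono[of 1 "1 + K" 1 "(1 + norm x) ^ q"] one K(1) by simp
        moreover have "?\<rho> \<le> (1 + K) * (1 + norm x) ^ q"
          using K(2)[of x] one unfolding distrib_right by linarith
        ultimately have t: "max 1 ?\<rho> \<le> (1 + K) * (1 + norm x) ^ q" by simp
        have "rpow ?\<rho> e \<le> ((1 + K) * (1 + norm x) ^ q) ^ l" if e: "0 \<le> e" "e \<le> 1 / pm - 1" for e
        proof -
          have "rpow ?\<rho> e \<le> max 1 ?\<rho> powr e"
            using e dual.step_norm_nonneg[of x] by (auto simp: rpow_def intro: powr_mono2)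
          also have "\<dots> \<le> max 1 ?\<rho> powr real l"
            using e l by (intro powr_mono) auto
          also have "\<dots> = max 1 ?\<rho> ^ l" by (simp add: powr_realpow)
          also have "\<dots> \<le> ((1 + K) * (1 + norm x) ^ q) ^ l"
            using t by (intro power_mono) auto
          finally show ?thesis .
        qed
        then have "R x \<le> ((1 + K) * (1 + norm x) ^ q) ^ l"
          unfolding R_def using a by (intro max.boundedI) auto
        then show ?thesis by (simp add: power_mult_distrib power_mult)
      qed
      then have "C * s0 * R x \<le> C * s0 * ((1 + K) ^ l * (1 + norm x) ^ (q * l))" for x
        using C0 s0 by (intro mult_left_mono) auto
      then have "cmod (?F x) \<le> (C * s0 * (1 + K) ^ l) * (1 + norm x) ^ (q * l)" for x
        using bound[OF s0, of x] by (metis order_trans mult.assoc)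
      then show ?thesis using that by blast
    qed
    ultimately show ?thesis
      using continuous_fourier_quotient[OF ft int] tempered_fourier_eq_fourier_quotient[OF ft int] by blast
  qed
  then show ?thesis
    unfolding R_def pm_def pp_def using C0 by blast
qed

end
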